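(* Let $B=\{B(x),x\in[0,1]\}$ be a Brownian motion and let $L$ be the random Schrödinger operator (symbolically $Lf=-f''+B'f$ on $[0,1]$ with boundary conditions $f(0)=f(1)=0$) defined weakly by $$\langle Lf,g\rangle:=\int_0^1 f'(x)g'(x)\,dx+\int_0^1 f(x)g(x)\,dB(x),\qquad f,g\in H_1.$$ Then the operator $L$ has almost surely a discrete spectrum given by the set of eigenvalues.
   Context: All spaces are over $\mathbb R$. $H:=\{h\in L_2[0,1]: h(0)=h(1)=0\}$ and $H_1:=\{h\in H: h\text{ is absolutely continuous}\}$. $B$ is a Brownian motion supported by a filtered probability space $(\Omega,\mathcal F,P)$. By Itô's formula, for $f,g\in H_1$ one has alternatively $\langle Lf,g\rangle=\int_0^1 f'g'\,dx-\int_0^1(f'g+fg')B\,dx$. A value $\lambda\in\mathbb C$ is an eigenvalue of $L$, with eigenfunction $e\in H_1$ ($e\neq0$), if $\langle Le,h\rangle=\lambda\langle e,h\rangle$ for all $h\in H_1$, where $\langle e,h\rangle=\int_0^1 e(x)h(x)\,dx$. *)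

theory Defs
  imports "HOL-Probability.Probability"
begin

locale brownian_motion = prob_space M
  for M :: "'w measure" and F :: "real \<Rightarrow> 'w measure" and B :: "real \<Rightarrow> 'w \<Rightarrow> real" +
  assumes filtration_subalgebra: "\<And>t. t \<in> {0..1} \<Longrightarrow> subalgebra M (F t)"
    and filtration_mono: "\<And>s t. 0 \<le> s \<Longrightarrow> s \<le> t \<Longrightarrow> t \<le> 1 \<Longrightarrow> sets (F s) \<subseteq> sets (F t)"
    and adapted: "\<And>t. t \<in> {0..1} \<Longrightarrow> B t \<in> borel_measurable (F t)"
    and starts_at_0: "AE \<omega> in M. B 0 \<omega> = 0"
    and independent_increments: "\<And>s t. 0 \<le> s \<Longrightarrow> s < t \<Longrightarrow> t \<le> 1 \<Longrightarrow>
      indep_set (sets (F s)) {(\<lambda>\<omega>. B t \<omega> - B s \<omega>) -` A \<inter> space M | A. A \<in> sets borel}"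
    and normal_increments: "\<And>s t. 0 \<le> s \<Longrightarrow> s < t \<Longrightarrow> t \<le> 1 \<Longrightarrow>
      distributed M lborel (\<lambda>\<omega>. B t \<omega> - B s \<omega>) (normal_density 0 (sqrt (t - s)))"
    and continuous_paths: "AE \<omega> in M. continuous_on {0..1} (\<lambda>t. B t \<omega>)"

abbreviation leb01 :: "real measure"
  where "leb01 \<equiv> lebesgue_on {0..1}"

definition abs_continuous01 :: "(real \<Rightarrow> real) \<Rightarrow> bool" where
  "abs_continuous01 f \<longleftrightarrow>
    (\<forall>\<epsilon>>0. \<exists>\<delta>>0. \<forall>d S. d division_of S \<longrightarrow> S \<subseteq> {0..1} \<longrightarrow> (\<Sum>K\<in>d. Sup K - Inf K) < \<delta> \<longrightarrow>
      (\<Sum>K\<in>d. \<bar>f (Sup K) - f (Inf K)\<bar>) < \<epsilon>)"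

definition H_space :: "(real \<Rightarrow> real) set" where
  "H_space = {h \<in> borel_measurable leb01. integrable leb01 (\<lambda>x. (h x)\<^sup>2) \<and> h 0 = 0 \<and> h 1 = 0}"

definition H1_space :: "(real \<Rightarrow> real) set" where
  "H1_space = {h \<in> H_space. abs_continuous01 h}"

definition inner01 :: "(real \<Rightarrow> real) \<Rightarrow> (real \<Rightarrow> real) \<Rightarrow> real" where
  "inner01 f g = (\<integral>x. f x * g x \<partial>leb01)"

text \<open>
  Riemann--Stieltjes integral of \<open>\<phi>\<close> against \<open>b\<close> over the unit interval, as the limit of
  Riemann sums when the mesh tends to 0. For an absolutely continuous (deterministic) \<open>\<phi>\<close> and a
  Brownian path \<open>b\<close> the limit exists for every continuous path and is a version of the Wiener
  integral of \<open>\<phi>\<close>. Unlike the Wiener integral, which is determined only up to a null set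
  depending on \<open>\<phi>\<close>, it is available for all \<open>\<phi>\<close> simultaneously on one fixed path.
\<close>

definition has_stieltjes_integral :: "(real \<Rightarrow> real) \<Rightarrow> (real \<Rightarrow> real) \<Rightarrow> real \<Rightarrow> bool" where
  "has_stieltjes_integral \<phi> b I \<longleftrightarrow>
    (\<forall>\<epsilon>>0. \<exists>\<delta>>0. \<forall>p. p tagged_division_of {0..1} \<longrightarrow> (\<forall>(x, K)\<in>p. Sup K - Inf K < \<delta>) \<longrightarrow>
      \<bar>(\<Sum>(x, K)\<in>p. \<phi> x * (b (Sup K) - b (Inf K))) - I\<bar> < \<epsilon>)"

text \<open>
  \<open>L_form b f g c\<close> says that \<open>\<langle>L f, g\<rangle>\<close>, for the noise path \<open>b\<close>, is defined and equals \<open>c\<close>.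
  It is a relation because mere absolute continuity of \<open>f\<close> and \<open>g\<close> does not make the product of
  the derivatives integrable.
\<close>

definition L_form :: "(real \<Rightarrow> real) \<Rightarrow> (real \<Rightarrow> real) \<Rightarrow> (real \<Rightarrow> real) \<Rightarrow> real \<Rightarrow> bool" where
  "L_form b f g c \<longleftrightarrow>
    integrable leb01 (\<lambda>x. deriv f x * deriv g x) \<and>
    (\<exists>I. has_stieltjes_integral (\<lambda>x. f x * g x) b I \<and>
         c = (\<integral>x. deriv f x * deriv g x \<partial>leb01) + I)"

definition L_eigenvalue :: "(real \<Rightarrow> real) \<Rightarrow> complex \<Rightarrow> bool" where
  "L_eigenvalue b \<mu> \<longleftrightarrow>
    (\<exists>e\<in>H1_space. (\<exists>x\<in>{0..1}. e x \<noteq> 0) \<and>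
      (\<forall>h\<in>H1_space. \<exists>c. L_form b e h c \<and> complex_of_real c = \<mu> * complex_of_real (inner01 e h)))"

text \<open>
  The (unbounded) operator in \<open>H_space\<close> determined by the form, as a graph: \<open>f\<close> is in the domain
  and \<open>L f = v\<close> almost everywhere.
\<close>

definition L_graph :: "(real \<Rightarrow> real) \<Rightarrow> (real \<Rightarrow> real) \<Rightarrow> (real \<Rightarrow> real) \<Rightarrow> bool" where
  "L_graph b f v \<longleftrightarrow> f \<in> H1_space \<and> v \<in> H_space \<and> (\<forall>g\<in>H1_space. L_form b f g (inner01 v g))"

text \<open>
  The spectrum of an operator in a real Hilbert space is that of its complexification.
\<close>

definition HC_space :: "(real \<Rightarrow> complex) set" where
  "HC_space = {u. (\<lambda>x. Re (u x)) \<in> H_space \<and> (\<lambda>x. Im (u x)) \<in> H_space}"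

definition normC01 :: "(real \<Rightarrow> complex) \<Rightarrow> real" where
  "normC01 u = sqrt (\<integral>x. (cmod (u x))\<^sup>2 \<partial>leb01)"

definition LC_graph :: "(real \<Rightarrow> real) \<Rightarrow> (real \<Rightarrow> complex) \<Rightarrow> (real \<Rightarrow> complex) \<Rightarrow> bool" where
  "LC_graph b f v \<longleftrightarrow>
    L_graph b (\<lambda>x. Re (f x)) (\<lambda>x. Re (v x)) \<and> L_graph b (\<lambda>x. Im (f x)) (\<lambda>x. Im (v x))"

text \<open>The equation \<open>(L - \<mu>) f = u\<close>.\<close>

definition LC_shift_graph ::
    "(real \<Rightarrow> real) \<Rightarrow> complex \<Rightarrow> (real \<Rightarrow> complex) \<Rightarrow> (real \<Rightarrow> complex) \<Rightarrow> bool" where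
  "LC_shift_graph b \<mu> f u \<longleftrightarrow> LC_graph b f (\<lambda>x. u x + \<mu> * f x)"

definition L_kernel :: "(real \<Rightarrow> real) \<Rightarrow> complex \<Rightarrow> (real \<Rightarrow> complex) set" where
  "L_kernel b \<mu> = {f. LC_shift_graph b \<mu> f (\<lambda>_. 0)}"

definition L_resolvent_set :: "(real \<Rightarrow> real) \<Rightarrow> complex set" where
  "L_resolvent_set b =
    {\<mu>. (\<forall>f\<in>L_kernel b \<mu>. \<forall>x\<in>{0..1}. f x = 0) \<and>
        (\<exists>C. \<forall>u\<in>HC_space. \<exists>f. LC_shift_graph b \<mu> f u \<and> normC01 f \<le> C * normC01 u)}"

definition L_spectrum :: "(real \<Rightarrow> real) \<Rightarrow> complex set" where
  "L_spectrum b = - L_resolvent_set b"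

definition finite_dimensional01 :: "(real \<Rightarrow> complex) set \<Rightarrow> bool" where
  "finite_dimensional01 V \<longleftrightarrow>
    (\<exists>(n::nat) e. \<forall>f\<in>V. \<exists>c. \<forall>x\<in>{0..1}. f x = (\<Sum>i<n. c i * e i x))"

definition L_has_discrete_spectrum :: "(real \<Rightarrow> real) \<Rightarrow> bool" where
  "L_has_discrete_spectrum b \<longleftrightarrow>
    (\<forall>z. \<not> z islimpt L_spectrum b) \<and>
    (\<forall>\<mu>\<in>L_spectrum b. finite_dimensional01 (L_kernel b \<mu>))"

end

theory Submission
  imports Defs
begin

text \<open>
  The statement holds for every continuous path \<open>b\<close>. Absolutely continuous functions are almost
  everywhere differentiable and are the integrals of their derivatives, so the noise term can be
  integrated by parts: the Riemann--Stieltjes integral of \<open>\<phi>\<close> against \<open>b\<close> is \<open>- \<integral> b \<phi>'\<close>.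
  Testing against tent functions then shows that \<open>L f = v\<close> means \<open>f(0) = f(1) = 0\<close> together
  with \<open>f' = b f + q\<close> and \<open>q' = - b (b f + q) - v\<close>, a linear system with continuous coefficients.

  Let \<open>e\<^sub>\<mu>\<close> solve it for \<open>v = \<mu> e\<^sub>\<mu>\<close> with \<open>e\<^sub>\<mu>(0) = 0\<close> and \<open>q(0) = 1\<close>. Every kernel element of
  \<open>L - \<mu>\<close> is a multiple of \<open>e\<^sub>\<mu>\<close>, and if \<open>e\<^sub>\<mu>(1) \<noteq> 0\<close> the inhomogeneous boundary value problem is
  solved by shooting, with a Gronwall bound; hence \<open>\<mu>\<close> is in the spectrum iff \<open>e\<^sub>\<mu>(1) = 0\<close>, iff it
  is an eigenvalue. The form is symmetric, so eigenvalues are real and the \<open>e\<^sub>\<mu>\<close> of distinct ones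
  are orthogonal. As \<open>e\<^sub>\<mu>\<close> depends continuously on \<open>\<mu>\<close>, at a limit point \<open>z\<close> of eigenvalues \<open>e\<^sub>z\<close>
  would be orthogonal to itself.
\<close>

section \<open>Differentiability of functions of bounded variation\<close>

text \<open>Membership in \<open>H1_space\<close> makes \<open>f'\<close> integrable but not square
  integrable, so the form is only partially defined there, and the usual route through a coercive
  form and a compact resolvent does not apply directly. Regularity has to be extracted from the
  equation instead: testing against functions with bounded slope determines \<open>f' - b f\<close>
  up to an additive constant, and \<open>f'\<close> turns out to be continuous on the open interval.
  The form is written with the pointwise \<open>deriv\<close>, an arbitrary number wherever
  \<open>f\<close> is not differentiable. Integrals of \<open>deriv f\<close> therefore say nothing
  about \<open>f\<close> until almost everywhere differentiability is proved, which is why the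
  development starts from Vitali coverings. The form is real while the spectrum lives in the
  complexification. Initial value problems are solved over the complex numbers, and the real and
  imaginary parts of the solutions are handed to the real form.\<close>

lemma division_telescope:
  fixes f :: "real \<Rightarrow> 'a::real_normed_vector"
  assumes "d division_of {a..b}" "a \<le> b"
  shows "(\<Sum>K\<in>d. f (Sup K) - f (Inf K)) = f b - f a"
proof -
  \<comment> \<open>Tagging each piece by its left end makes the telescoping rule for tagged
    divisions applicable.\<close>
  let ?p = "(\<lambda>K. (Inf K, K)) ` d"
  have K: "\<exists>u v. K = {u..v} \<and> u \<le> v" if "K \<in> d" for K
    using division_ofD(3,4)[OF assms(1) that] by auto
  have "?p tagged_division_of {a..b}"
  proof (rule tagged_division_ofI)
    show "finite ?p" using division_ofD(1)[OF assms(1)] by simp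
    show "\<Union>{K. \<exists>x. (x, K) \<in> ?p} = {a..b}"
      using division_ofD(6)[OF assms(1)] by (auto simp: image_iff)
    fix x k assume "(x, k) \<in> ?p"
    then have k: "k \<in> d" "x = Inf k" by auto
    with K show "x \<in> k" by fastforce
    show "k \<subseteq> {a..b}" "\<exists>a b. k = cbox a b"
      using division_ofD(2,4)[OF assms(1) k(1)] by auto
    fix x' k' assume "(x', k') \<in> ?p" "(x, k) \<noteq> (x', k')"
    then show "interior k \<inter> interior k' = {}"
      using k division_ofD(5)[OF assms(1)] by auto
  qed
  from additive_tagged_division_1[OF assms(2) this, of f]
  show ?thesis
    by (subst (asm) sum.reindex) (auto simp: inj_on_def)
qed

lemma division_piece:
  fixes d :: "real set set"
  assumes "d division_of S" "K \<in> d"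
  shows "K = {Inf K..Sup K}" "Inf K \<le> Sup K" "Inf K \<in> S" "Sup K \<in> S"
proof -
  obtain u v where uv: "K = {u..v}" "u \<le> v"
    using division_ofD(3,4)[OF assms] by auto
  then have "u \<in> S" "v \<in> S"
    using division_ofD(2)[OF assms] by auto
  with uv show "K = {Inf K..Sup K}" "Inf K \<le> Sup K" "Inf K \<in> S" "Sup K \<in> S"
    by auto
qed

lemma division_length_le:
  fixes d :: "real set set"
  assumes "d division_of S" "S \<subseteq> {a..b}" "a \<le> b"
  shows "(\<Sum>K\<in>d. Sup K - Inf K) \<le> b - a"
proof -
  have "(\<Sum>K\<in>d. Sup K - Inf K) = (\<Sum>K\<in>d. measure lborel K)"
    by (intro sum.cong refl) (use division_piece(1,2)[OF assms(1)] in \<open>metis content_real\<close>)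
  also have "\<dots> \<le> measure lborel (cbox a b)"
    using assms by (intro subadditive_content_division[OF assms(1)]) auto
  finally show ?thesis using \<open>a \<le> b\<close> by simp
qed

text \<open>Vitali extracts from the fine cover a countable disjoint subfamily that misses only a
  null part of \<open>E\<close>. Its finite subfamilies are divisions, so \<open>bd\<close> bounds
  their measures by \<open>B\<close>, and the bound passes to the countable union. For each
  exceptional set of slopes it then remains to bound the lengths of finitely many nonoverlapping
  intervals.\<close>

lemma interval_Vitali_bound:
  fixes E :: "real set"
  assumes cov: "\<And>x \<delta>. x \<in> E \<Longrightarrow> \<delta> > 0 \<Longrightarrow> \<exists>i\<in>K. x \<in> i \<and> Sup i - Inf i < \<delta>"
    and K: "\<And>i. i \<in> K \<Longrightarrow> \<exists>c d. c < d \<and> i = {c..d}"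
    and bd: "\<And>D. finite D \<Longrightarrow> D \<subseteq> K \<Longrightarrow> D division_of \<Union>D \<Longrightarrow> (\<Sum>i\<in>D. Sup i - Inf i) \<le> B"
  obtains T where "E \<subseteq> T" "T \<in> lmeasurable" "measure lebesgue T \<le> B"
proof -
  \<comment> \<open>Midpoint and half-length, because the covering theorem speaks of balls.\<close>
  define a where "a i = (Inf i + Sup i) / 2" for i :: "real set"
  define r where "r i = (Sup i - Inf i) / 2" for i :: "real set"
  have cb: "cball (a i) (r i) = i" and r: "0 < r i" if "i \<in> K" for i
    using K[OF that] by (auto simp: a_def r_def cball_eq_atLeastAtMost field_simps)
  have S: "\<exists>i. i \<in> K \<and> x \<in> cball (a i) (r i) \<and> r i < d" if "x \<in> E" "0 < d" for x d
  proof -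
    from cov[OF that] obtain i where i: "i \<in> K" "x \<in> i" "Sup i - Inf i < d"
      by blast
    with cb[of i] r[of i] have "r i < d"
      unfolding r_def by auto
    moreover have "x \<in> cball (a i) (r i)"
      by (subst cb) (fact i)+
    ultimately show ?thesis using i(1) by blast
  qed
  obtain C where C: "countable C" "C \<subseteq> K"
     "pairwise (\<lambda>i j. disjnt (cball (a i) (r i)) (cball (a j) (r j))) C"
     "negligible (E - (\<Union>i\<in>C. cball (a i) (r i)))"
    by (rule Vitali_covering_theorem_cballs[of K r E a]) (use r S in blast)+
  have dj: "pairwise disjnt C"
    using C(2,3) cb by (simp add: pairwise_def subset_eq)
  have neg: "negligible (E - \<Union>C)"
  proof -
    have "(\<Union>i\<in>C. cball (a i) (r i)) = \<Union>C"
      using C(2) cb by auto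
    with C(4) show ?thesis by simp
  qed
  have meas: "i \<in> lmeasurable" if "i \<in> C" for i
    using K[of i] that C(2) by auto
  have fin: "measure lebesgue (\<Union>i\<in>D. i) \<le> B" if "D \<subseteq> C" "finite D" for D
  proof -
    have "D division_of \<Union>D"
    proof (rule division_ofI)
      show "\<exists>a b. k = cbox a b" "k \<noteq> {}" if "k \<in> D" for k
        using K[of k] that \<open>D \<subseteq> C\<close> C(2) by fastforce+
      show "interior k1 \<inter> interior k2 = {}" if "k1 \<in> D" "k2 \<in> D" "k1 \<noteq> k2" for k1 k2
        using dj that \<open>D \<subseteq> C\<close> interior_subset unfolding pairwise_def disjnt_def by blast
    qed (use that in auto)
    then have "(\<Sum>i\<in>D. Sup i - Inf i) \<le> B"
      using that C(2) by (intro bd) auto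
    moreover have "measure lebesgue (\<Union>i\<in>D. i) \<le> (\<Sum>i\<in>D. measure lebesgue i)"
      using that meas by (intro measure_UNION_le) (auto simp: fmeasurableD)
    moreover have "measure lebesgue i = Sup i - Inf i" if "i \<in> D" for i
    proof -
      have "i \<in> K" using that \<open>D \<subseteq> C\<close> C(2) by blast
      from K[OF this] obtain c d where "c < d" "i = {c..d}" by blast
      then show ?thesis by simp
    qed
    ultimately show ?thesis by simp
  qed
  have T: "(\<Union>i\<in>C. i) \<in> lmeasurable" "measure lebesgue (\<Union>i\<in>C. i) \<le> B"
    using fmeasurable_UN_bound[OF C(1) meas fin] measure_UN_bound[OF C(1) meas fin] by blast+
  show thesis
  proof
    show "E \<subseteq> \<Union>C \<union> (E - \<Union>C)" by auto
    show "\<Union>C \<union> (E - \<Union>C) \<in> lmeasurable"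
      using T(1) negligible_imp_measurable[OF neg] by (intro fmeasurable.Un) simp_all
    have "measure lebesgue (\<Union>C \<union> (E - \<Union>C)) \<le> measure lebesgue (\<Union>C) + measure lebesgue (E - \<Union>C)"
      using T neg by (intro measure_Un_le) (auto simp: negligible_imp_sets)
    then show "measure lebesgue (\<Union>C \<union> (E - \<Union>C)) \<le> B"
      using T neg negligible_imp_measure0 by fastforce
  qed
qed

text \<open>Inside each piece of a partition whose variation is nearly maximal, a disjoint Vitali family
  of intervals on which \<open>h\<close> moves against the increment of that piece raises the variation by at
  least \<open>2 \<eta>\<close> times its total length; hence that length is small.\<close>

lemma negligible_oscillating_slopes:
  fixes h :: "real \<Rightarrow> real"
  assumes bv: "\<And>d S. d division_of S \<Longrightarrow> S \<subseteq> {a..b} \<Longrightarrow> (\<Sum>K\<in>d. \<bar>h (Sup K) - h (Inf K)\<bar>) \<le> V"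
    and \<eta>: "\<eta> > 0"
  shows "negligible {x \<in> {a<..<b}. (\<exists>\<^sub>F y in at x. (h y - h x) / (y - x) < - \<eta>) \<and>
                                  (\<exists>\<^sub>F y in at x. (h y - h x) / (y - x) > \<eta>)}" (is "negligible ?E")
  unfolding negligible_outer_le
proof (intro allI impI)
  fix e :: real assume "e > 0"
  let ?inc = "\<lambda>K. h (Sup K) - h (Inf K)"
  define A where "A = {\<Sum>K\<in>d. \<bar>?inc K\<bar> | d S. d division_of S \<and> S \<subseteq> {a..b}}"
  have bdd: "bdd_above A"
    unfolding A_def bdd_above_def using bv by blast
  have "0 \<in> A"
    unfolding A_def by (intro CollectI exI[of _ "{}"]) auto
  \<comment> \<open>The gap \<open>2 * \<eta> * e\<close> is what opposing intervals of total length
    \<open>e\<close> would add to the variation, so a finite family of them has to be shorter than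
    that.\<close>
  then obtain P0 S0 where P0: "P0 division_of S0" "S0 \<subseteq> {a..b}" "Sup A - 2 * \<eta> * e < (\<Sum>K\<in>P0. \<bar>?inc K\<bar>)"
    using less_cSup_iff[of A "Sup A - 2 * \<eta> * e"] bdd \<open>e > 0\<close> \<eta> unfolding A_def by auto
  then obtain P where P: "P0 \<subseteq> P" "P division_of cbox a b"
    using partial_division_extend_interval[of P0 a b] division_ofD(6)[OF P0(1)]
    by (metis box_real(2))
  have finP: "finite P" using P by auto
  have "(\<Sum>K\<in>P0. \<bar>?inc K\<bar>) \<le> (\<Sum>K\<in>P. \<bar>?inc K\<bar>)"
    using P finP by (intro sum_mono2) auto
  with P0 have Psup: "Sup A - 2 * \<eta> * e < (\<Sum>K\<in>P. \<bar>?inc K\<bar>)" by linarith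
  define good where "good i J \<longleftrightarrow> (\<exists>c d. c < d \<and> i = {c..d}) \<and> i \<subseteq> J \<and>
     \<eta> * (Sup i - Inf i) \<le> \<bar>?inc i\<bar> \<and> (if ?inc J \<le> 0 then 0 \<le> ?inc i else ?inc i \<le> 0)" for i J
  define K where "K = {i. \<exists>J\<in>P. good i J}"
  \<comment> \<open>The endpoints of the pieces form a finite, hence null, set. Off this set
    \<open>x\<close> is interior to its piece, and so are all nearby second endpoints
    \<open>y\<close>.\<close>
  define N where "N = Inf ` P \<union> Sup ` P"
  have "finite N" using finP by (simp add: N_def)
  have cov: "\<exists>i\<in>K. x \<in> i \<and> Sup i - Inf i < \<delta>" if x: "x \<in> ?E - N" and \<delta>: "\<delta> > 0" for x \<delta>
  proof -
    obtain J where J: "J \<in> P" "x \<in> J"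
      using x division_ofD(6)[OF P(2)] by fastforce
    obtain u v where uv: "J = {u..v}" "u \<le> v" "Inf J = u" "Sup J = v"
      using division_piece[OF P(2) J(1)] by blast
    with J x have "u < x" "x < v"
      unfolding N_def by force+
    then have ev: "\<forall>\<^sub>F y in at x. \<bar>y - x\<bar> < \<delta> \<and> u < y \<and> y < v \<and> y \<noteq> x"
      using \<delta> unfolding eventually_at
      by (intro exI[of _ "min \<delta> (min (x - u) (v - x))"]) (auto simp: dist_real_def)
    \<comment> \<open>Membership in \<open>?E\<close> supplies steep slopes of both signs
      arbitrarily near \<open>x\<close>. The sign opposing \<open>?inc J\<close> is selected, the
      positive one if that increment is zero.\<close>
    define Q where "Q y \<longleftrightarrow> (if ?inc J \<le> 0 then (h y - h x) / (y - x) > \<eta> else (h y - h x) / (y - x) < - \<eta>)" for y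
    have "\<exists>\<^sub>F y in at x. Q y"
      using x unfolding Q_def by (cases "?inc J \<le> 0") auto
    from frequently_eventually_conj[OF this ev]
    obtain y where y: "Q y" "\<bar>y - x\<bar> < \<delta>" "u < y" "y < v" "y \<noteq> x"
      using frequently_ex by fastforce
    define i where "i = {min x y..max x y}"
    have i: "Sup i = max x y" "Inf i = min x y"
      by (auto simp: i_def)
    have inc: "?inc i = (h y - h x) / (y - x) * (Sup i - Inf i)"
      using y(5) by (auto simp: i min_def max_def field_simps)
    have pos: "Sup i - Inf i > 0" "Sup i - Inf i < \<delta>" "x \<in> i"
      using y by (auto simp: i i_def)
    have "(h y - h x) / (y - x) > \<eta> \<or> (h y - h x) / (y - x) < - \<eta>"
      using y(1) unfolding Q_def by presburger
    then have "\<eta> \<le> \<bar>(h y - h x) / (y - x)\<bar>"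
      by (elim disjE) linarith+
    then have "\<eta> * (Sup i - Inf i) \<le> \<bar>(h y - h x) / (y - x)\<bar> * (Sup i - Inf i)"
      using pos by (intro mult_right_mono) auto
    then have 1: "\<eta> * (Sup i - Inf i) \<le> \<bar>?inc i\<bar>"
      unfolding inc using pos by (simp add: abs_mult)
    have 2: "if ?inc J \<le> 0 then 0 \<le> ?inc i else ?inc i \<le> 0"
    proof (cases "?inc J \<le> 0")
      case True
      with y(1) \<eta> have "0 \<le> (h y - h x) / (y - x)"
        unfolding Q_def by simp
      with pos True show ?thesis
        unfolding inc by (simp only: if_True) (intro mult_nonneg_nonneg; simp)
    next
      case False
      with y(1) \<eta> have "(h y - h x) / (y - x) \<le> 0"
        unfolding Q_def by simp
      with pos False show ?thesis
        unfolding inc by (simp only: if_False) (intro mult_nonpos_nonneg; simp)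
    qed
    have "min x y < max x y" "i \<subseteq> J"
      using y uv(1) \<open>u < x\<close> \<open>x < v\<close> by (auto simp: i_def)
    then have "good i J"
      unfolding good_def using 1 2 i_def by blast
    with pos J show ?thesis unfolding K_def by blast
  qed
  have KI: "\<exists>c d. c < d \<and> i = {c..d}" if "i \<in> K" for i
    using that unfolding K_def good_def by blast
  have bd: "(\<Sum>i\<in>D. Sup i - Inf i) \<le> e" if D: "finite D" "D \<subseteq> K" "D division_of \<Union>D" for D
  proof -
    obtain Jof where Jof: "\<And>i. i \<in> D \<Longrightarrow> Jof i \<in> P \<and> good i (Jof i)"
      using D(2) unfolding K_def by (simp add: subset_eq) metis
    define DJ where "DJ J = {i\<in>D. Jof i = J}" for J
    have ex: "\<exists>q. DJ J \<subseteq> q \<and> q division_of J" if "J \<in> P" for J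
    proof -
      from division_ofD(4)[OF P(2) that] obtain u v where uv: "J = cbox u v"
        by auto
      have "DJ J division_of \<Union>(DJ J)"
        by (rule division_of_subset[OF D(3)]) (auto simp: DJ_def)
      moreover have "\<Union>(DJ J) \<subseteq> cbox u v"
        using Jof uv unfolding DJ_def good_def by blast
      ultimately show ?thesis
        using partial_division_extend_interval[of "DJ J" u v] uv by metis
    qed
    then obtain q where q: "\<And>J. J \<in> P \<Longrightarrow> DJ J \<subseteq> q J" "\<And>J. J \<in> P \<Longrightarrow> q J division_of J"
      by metis
    \<comment> \<open>A singleton piece may belong to the divisions of two adjacent
      \<open>J\<close>. Without singletons the families for distinct \<open>J\<close> are disjoint,
      and no variation is lost since their increments are zero.\<close>
    define q' where "q' J = {K \<in> q J. Inf K < Sup K}" for J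
    have q'int: "interior K \<noteq> {}" "interior K \<subseteq> interior J" if "J \<in> P" "K \<in> q' J" for J K
    proof -
      have "K \<in> q J" "Inf K < Sup K" using that unfolding q'_def by auto
      then show "interior K \<noteq> {}"
        using division_piece(1)[OF q(2)[OF that(1)] \<open>K \<in> q J\<close>]
        by (metis greaterThanLessThan_empty_iff interior_atLeastAtMost_real not_less)
      show "interior K \<subseteq> interior J"
        using division_ofD(2)[OF q(2)[OF that(1)] \<open>K \<in> q J\<close>] by (rule interior_mono)
    qed
    have finq: "finite (q J)" if "J \<in> P" for J
      using q(2)[OF that] by auto
    have Q: "(\<Union>J\<in>P. q' J) division_of \<Union>(\<Union>J\<in>P. q' J)"
    proof (rule division_ofI)
      show "finite (\<Union>J\<in>P. q' J)"
        using finP finq by (auto simp: q'_def)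
      show "K \<noteq> {}" "\<exists>a b. K = cbox a b" if "K \<in> (\<Union>J\<in>P. q' J)" for K
        using that q(2) division_ofD(3,4) unfolding q'_def by blast+
      show "interior k1 \<inter> interior k2 = {}" if "k1 \<in> (\<Union>J\<in>P. q' J)" "k2 \<in> (\<Union>J\<in>P. q' J)" "k1 \<noteq> k2" for k1 k2
      proof -
        from that obtain J1 J2 where J: "J1 \<in> P" "k1 \<in> q' J1" "J2 \<in> P" "k2 \<in> q' J2"
          by blast
        show ?thesis
        proof (cases "J1 = J2")
          case True
          then show ?thesis
            using J that(3) division_ofD(5)[OF q(2)] unfolding q'_def by auto
        next
          case False
          then have "interior J1 \<inter> interior J2 = {}"
            using division_ofD(5)[OF P(2)] J by blast
          then show ?thesis
            using q'int(2)[OF J(1,2)] q'int(2)[OF J(3,4)] by blast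
        qed
      qed
    qed auto
    have "\<Union>(\<Union>J\<in>P. q' J) \<subseteq> {a..b}"
      using division_ofD(2)[OF q(2)] division_ofD(2)[OF P(2)] unfolding q'_def by fastforce
    with Q have "(\<Sum>K\<in>(\<Union>J\<in>P. q' J). \<bar>?inc K\<bar>) \<in> A"
      unfolding A_def by blast
    then have "(\<Sum>K\<in>(\<Union>J\<in>P. q' J). \<bar>?inc K\<bar>) \<le> Sup A"
      using bdd by (rule cSup_upper)
    also have "(\<Sum>K\<in>(\<Union>J\<in>P. q' J). \<bar>?inc K\<bar>) = (\<Sum>J\<in>P. \<Sum>K\<in>q' J. \<bar>?inc K\<bar>)"
    proof (rule sum.UNION_disjoint)
      show "\<forall>i\<in>P. \<forall>j\<in>P. i \<noteq> j \<longrightarrow> q' i \<inter> q' j = {}"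
      proof (intro ballI impI)
        fix i j assume ij: "i \<in> P" "j \<in> P" "i \<noteq> j"
        then have "interior i \<inter> interior j = {}"
          using division_ofD(5)[OF P(2)] by blast
        then show "q' i \<inter> q' j = {}"
          using q'int[OF ij(1)] q'int[OF ij(2)] by fastforce
      qed
    qed (use finP finq in \<open>auto simp: q'_def\<close>)
    also have "\<dots> = (\<Sum>J\<in>P. \<Sum>K\<in>q J. \<bar>?inc K\<bar>)"
    proof (rule sum.cong[OF refl])
      fix J assume J: "J \<in> P"
      have deg: "\<forall>i\<in>q J - q' J. \<bar>?inc i\<bar> = 0"
      proof
        fix i assume "i \<in> q J - q' J"
        then have "Inf i = Sup i"
          using division_piece(2)[OF q(2)[OF J], of i] by (auto simp: q'_def)
        then show "\<bar>?inc i\<bar> = 0" by simp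
      qed
      show "(\<Sum>K\<in>q' J. \<bar>?inc K\<bar>) = (\<Sum>K\<in>q J. \<bar>?inc K\<bar>)"
        by (rule sum.mono_neutral_left[OF finq[OF J] _ deg]) (auto simp: q'_def)
    qed
    finally have le: "(\<Sum>J\<in>P. \<Sum>K\<in>q J. \<bar>?inc K\<bar>) \<le> Sup A" .
    have each: "\<bar>?inc J\<bar> + 2 * (\<Sum>i\<in>DJ J. \<eta> * (Sup i - Inf i)) \<le> (\<Sum>K\<in>q J. \<bar>?inc K\<bar>)" if J: "J \<in> P" for J
    proof -
      obtain u v where uv: "J = {u..v}" "u \<le> v" "Inf J = u" "Sup J = v"
        using division_piece[OF P(2) J] by blast
      have tele: "(\<Sum>K\<in>q J. ?inc K) = ?inc J"
        using division_telescope[of "q J" u v h] q(2)[OF J] uv by simp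
      have split: "(\<Sum>K\<in>q J. g K) = (\<Sum>K\<in>q J - DJ J. g K) + (\<Sum>K\<in>DJ J. g K)" for g :: "real set \<Rightarrow> real"
        using sum.subset_diff[OF q(1)[OF J] finq[OF J]] by blast
      have gd: "\<eta> * (Sup i - Inf i) \<le> \<bar>?inc i\<bar>" "if ?inc J \<le> 0 then 0 \<le> ?inc i else ?inc i \<le> 0" if "i \<in> DJ J" for i
        using Jof[of i] that unfolding DJ_def good_def by auto
      have s: "(\<Sum>K\<in>DJ J. \<eta> * (Sup K - Inf K)) \<le> (\<Sum>K\<in>DJ J. \<bar>?inc K\<bar>)"
        using gd by (intro sum_mono) auto
      have t: "\<bar>\<Sum>K\<in>q J - DJ J. ?inc K\<bar> \<le> (\<Sum>K\<in>q J - DJ J. \<bar>?inc K\<bar>)"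
        by (rule sum_abs)
      \<comment> \<open>The members of \<open>DJ J\<close> move against \<open>?inc J\<close>, so
        the other pieces of \<open>q J\<close> have to make up for that movement too. Their
        variation is at least this left-hand side; counting \<open>DJ J\<close> itself once more
        gives the factor 2 in \<open>each\<close>.\<close>
      have "\<bar>?inc J\<bar> + (\<Sum>K\<in>DJ J. \<bar>?inc K\<bar>) \<le> \<bar>?inc J - (\<Sum>K\<in>DJ J. ?inc K)\<bar>"
      proof (cases "?inc J \<le> 0")
        case False
        have "(\<Sum>K\<in>DJ J. \<bar>?inc K\<bar>) = - (\<Sum>K\<in>DJ J. ?inc K)"
          unfolding sum_negf[symmetric]
          using gd(2) False by (intro sum.cong) auto
        with False show ?thesis by linarith
      next
        case True
        have "(\<Sum>K\<in>DJ J. \<bar>?inc K\<bar>) = (\<Sum>K\<in>DJ J. ?inc K)"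
          using gd(2) True by (intro sum.cong) auto
        with True show ?thesis by linarith
      qed
      with split[of ?inc] split[of "\<lambda>K. \<bar>?inc K\<bar>"] s t tele show ?thesis
        by linarith
    qed
    have "(\<Sum>J\<in>P. \<bar>?inc J\<bar>) + 2 * (\<Sum>J\<in>P. \<Sum>i\<in>DJ J. \<eta> * (Sup i - Inf i)) \<le> (\<Sum>J\<in>P. \<Sum>K\<in>q J. \<bar>?inc K\<bar>)"
      using sum_mono[of P, OF each] by (simp add: sum.distrib sum_distrib_left)
    moreover have "(\<Sum>J\<in>P. \<Sum>i\<in>DJ J. \<eta> * (Sup i - Inf i)) = (\<Sum>i\<in>D. \<eta> * (Sup i - Inf i))"
      unfolding DJ_def by (rule sum.group) (use D finP Jof in auto)
    ultimately have "2 * (\<eta> * (\<Sum>i\<in>D. Sup i - Inf i)) < 2 * \<eta> * e"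
      using le Psup by (simp add: sum_distrib_left)
    with \<eta> show ?thesis by simp
  qed
  obtain T where T: "?E - N \<subseteq> T" "T \<in> lmeasurable" "measure lebesgue T \<le> e"
    using interval_Vitali_bound[OF cov KI bd] by blast
  have N: "negligible N" using \<open>finite N\<close> by (rule negligible_finite)
  have "measure lebesgue (T \<union> N) \<le> measure lebesgue T + measure lebesgue N"
    using T N by (intro measure_Un_le) (auto simp: negligible_imp_sets)
  then show "\<exists>T. ?E \<subseteq> T \<and> T \<in> lmeasurable \<and> measure lebesgue T \<le> e"
    using T negligible_imp_measurable[OF N] negligible_imp_measure0[OF N]
    by (intro exI[of _ "T \<union> N"] conjI fmeasurable.Un) auto
qed

text \<open>Nonoverlapping intervals on which \<open>h\<close> changes by at least \<open>m\<close>
  times the length have total length at most \<open>V / m\<close>, which is small for large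
  \<open>m\<close>.\<close>

lemma negligible_unbounded_slopes:
  fixes h :: "real \<Rightarrow> real"
  assumes bv: "\<And>d S. d division_of S \<Longrightarrow> S \<subseteq> {a..b} \<Longrightarrow> (\<Sum>K\<in>d. \<bar>h (Sup K) - h (Inf K)\<bar>) \<le> V"
  shows "negligible {x \<in> {a<..<b}. \<forall>m. \<exists>\<^sub>F y in at x. \<bar>(h y - h x) / (y - x)\<bar> > m}" (is "negligible ?E")
  unfolding negligible_outer_le
proof (intro allI impI)
  fix e :: real assume "e > 0"
  let ?inc = "\<lambda>K. h (Sup K) - h (Inf K)"
  have "0 \<le> V" using bv[of "{}" "{}"] by simp
  \<comment> \<open>\<open>V + 1\<close> instead of \<open>V\<close> keeps \<open>m\<close> positive
    even if \<open>V = 0\<close>.\<close>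
  define m where "m = (V + 1) / e"
  have "m > 0" using \<open>0 \<le> V\<close> \<open>e > 0\<close> by (simp add: m_def)
  define K where "K = {{c..d} | c d. c < d \<and> {c..d} \<subseteq> {a..b} \<and> m * (d - c) \<le> \<bar>h d - h c\<bar>}"
  have cov: "\<exists>i\<in>K. x \<in> i \<and> Sup i - Inf i < \<delta>" if x: "x \<in> ?E" and \<delta>: "\<delta> > 0" for x \<delta>
  proof -
    have "a < x" "x < b" using x by auto
    then have ev: "\<forall>\<^sub>F y in at x. \<bar>y - x\<bar> < \<delta> \<and> a < y \<and> y < b \<and> y \<noteq> x"
      using \<delta> unfolding eventually_at
      by (intro exI[of _ "min \<delta> (min (x - a) (b - x))"]) (auto simp: dist_real_def)
    have "\<exists>\<^sub>F y in at x. \<bar>(h y - h x) / (y - x)\<bar> > m"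
      using x by blast
    from frequently_eventually_conj[OF this ev]
    obtain y where y: "\<bar>(h y - h x) / (y - x)\<bar> > m" "\<bar>y - x\<bar> < \<delta>" "a < y" "y < b" "y \<noteq> x"
      using frequently_ex by fastforce
    have "m * \<bar>y - x\<bar> \<le> \<bar>h y - h x\<bar>"
      using y(1,5) by (simp add: field_simps)
    then have "{min x y..max x y} \<in> K"
      unfolding K_def using y \<open>a < x\<close> \<open>x < b\<close>
      by (intro CollectI exI[of _ "min x y"] exI[of _ "max x y"]) (auto simp: min_def max_def abs_if split: if_splits)
    then show ?thesis
      using y by (intro bexI[of _ "{min x y..max x y}"]) auto
  qed
  have KI: "\<exists>c d. c < d \<and> i = {c..d}" if "i \<in> K" for i
    using that unfolding K_def by blast
  have bd: "(\<Sum>i\<in>D. Sup i - Inf i) \<le> e" if D: "finite D" "D \<subseteq> K" "D division_of \<Union>D" for D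
  proof -
    have "m * (\<Sum>i\<in>D. Sup i - Inf i) \<le> (\<Sum>i\<in>D. \<bar>?inc i\<bar>)"
      unfolding sum_distrib_left using D(2) unfolding K_def by (intro sum_mono) fastforce
    also have "\<dots> \<le> V"
      by (rule bv[OF D(3)]) (use D(2) in \<open>auto simp: K_def\<close>)
    finally have "m * (\<Sum>i\<in>D. Sup i - Inf i) \<le> m * e"
      using \<open>e > 0\<close> by (simp add: m_def)
    with \<open>m > 0\<close> show ?thesis by simp
  qed
  obtain T where T: "?E \<subseteq> T" "T \<in> lmeasurable" "measure lebesgue T \<le> e"
    using interval_Vitali_bound[OF cov KI bd] by blast
  then show "\<exists>T. ?E \<subseteq> T \<and> T \<in> lmeasurable \<and> measure lebesgue T \<le> e"
    by blast
qed

text \<open>A bounded real function without a limit has its lower limit strictly below its upper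
  limit, which leaves room for two levels in between. Taking them rational keeps the later union of
  exceptional sets countable.\<close>

lemma frequently_if_not_tendsto_real:
  fixes s :: "'a \<Rightarrow> real"
  assumes "F \<noteq> bot" "\<And>l. \<not> (s \<longlongrightarrow> l) F"
  shows "(\<forall>m. \<exists>\<^sub>F y in F. \<bar>s y\<bar> > m) \<or>
         (\<exists>p\<in>\<rat>. \<exists>q\<in>\<rat>. p < q \<and> (\<exists>\<^sub>F y in F. s y < p) \<and> (\<exists>\<^sub>F y in F. q < s y))"
proof (rule ccontr)
  assume contra: "\<not> ?thesis"
  then obtain m where "\<forall>\<^sub>F y in F. \<bar>s y\<bar> \<le> m"
    by (auto simp: frequently_def not_less)
  then have ub: "Limsup F (\<lambda>y. ereal (s y)) \<le> m" and lb: "- m \<le> Liminf F (\<lambda>y. ereal (s y))"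
    by (auto intro!: Limsup_bounded Liminf_bounded elim!: eventually_mono)
  have le: "Liminf F (\<lambda>y. ereal (s y)) \<le> Limsup F (\<lambda>y. ereal (s y))"
    by (rule Liminf_le_Limsup[OF assms(1)])
  show False
  proof (cases "Liminf F (\<lambda>y. ereal (s y)) = Limsup F (\<lambda>y. ereal (s y))")
    case True
    then have lim: "((\<lambda>y. ereal (s y)) \<longlongrightarrow> Limsup F (\<lambda>y. ereal (s y))) F"
      using Liminf_eq_Limsup[OF assms(1)] by blast
    obtain l where "Limsup F (\<lambda>y. ereal (s y)) = ereal l"
      using ub lb True by (cases "Limsup F (\<lambda>y. ereal (s y))") auto
    with lim assms(2) show False by simp
  next
    case False
    with le have "Liminf F (\<lambda>y. ereal (s y)) < Limsup F (\<lambda>y. ereal (s y))" by simp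
    then obtain p0 where p0: "Liminf F (\<lambda>y. ereal (s y)) < ereal p0" "ereal p0 < Limsup F (\<lambda>y. ereal (s y))"
      using ereal_dense2 by blast
    then obtain q0 where q0: "ereal p0 < ereal q0" "ereal q0 < Limsup F (\<lambda>y. ereal (s y))"
      using ereal_dense2 by blast
    then obtain r where r: "r \<in> \<rat>" "p0 < r" "r < q0"
      using Rats_dense_in_real[of p0 q0] by auto
    then obtain r' where r': "r' \<in> \<rat>" "r < r'" "r' < q0"
      using Rats_dense_in_real[of r q0] by auto
    have "\<exists>\<^sub>F y in F. s y < r"
    proof (rule ccontr)
      assume "\<not> ?thesis"
      then have "\<forall>\<^sub>F y in F. ereal r \<le> ereal (s y)" by (auto simp: frequently_def not_less)
      from Liminf_bounded[OF this] p0 r show False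
        by (metis ereal_less_eq(3) leD le_less_trans less_imp_le order_trans)
    qed
    moreover have "\<exists>\<^sub>F y in F. r' < s y"
    proof (rule ccontr)
      assume "\<not> ?thesis"
      then have "\<forall>\<^sub>F y in F. ereal (s y) \<le> ereal r'" by (auto simp: frequently_def not_less)
      from Limsup_bounded[OF this] q0 r' show False
        by (metis ereal_less_eq(3) leD less_imp_le order_trans)
    qed
    ultimately show False using contra r r' by blast
  qed
qed

lemma bounded_variation_differentiable_ae:
  fixes h :: "real \<Rightarrow> real"
  assumes bv: "\<And>d S. d division_of S \<Longrightarrow> S \<subseteq> {a..b} \<Longrightarrow> (\<Sum>K\<in>d. \<bar>h (Sup K) - h (Inf K)\<bar>) \<le> V"
    and "a < b"
  shows "negligible {x \<in> {a<..<b}. \<not> h field_differentiable at x}"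
proof -
  define s where "s h x y = (h y - h x) / (y - x)" for h :: "real \<Rightarrow> real" and x y
  define U where "U = {x \<in> {a<..<b}. \<forall>m. \<exists>\<^sub>F y in at x. \<bar>s h x y\<bar> > m}"
  define E where "E = (\<lambda>(p, q). {x \<in> {a<..<b}. (\<exists>\<^sub>F y in at x. s h x y < p) \<and> (\<exists>\<^sub>F y in at x. s h x y > q)})"
  have U: "negligible U"
    unfolding U_def s_def by (rule negligible_unbounded_slopes[OF bv])
  have E: "negligible (E (p, q))" if "p < q" for p q
  proof -
    \<comment> \<open>Subtracting the mean slope \<open>c\<close> moves the levels \<open>p\<close>
      and \<open>q\<close> to the symmetric levels that \<open>negligible_oscillating_slopes\<close>
      needs. The variation grows by at most \<open>\<bar>c\<bar> * (b - a)\<close>.\<close>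
    define c where "c = (p + q) / 2"
    define g where "g x = h x - c * x" for x
    have bvg: "(\<Sum>K\<in>d. \<bar>g (Sup K) - g (Inf K)\<bar>) \<le> V + \<bar>c\<bar> * (b - a)" if d: "d division_of S" "S \<subseteq> {a..b}" for d S
    proof -
      have len: "(\<Sum>K\<in>d. Sup K - Inf K) \<le> b - a"
        using division_length_le[OF d] \<open>a < b\<close> by simp
      have "(\<Sum>K\<in>d. \<bar>g (Sup K) - g (Inf K)\<bar>) \<le> (\<Sum>K\<in>d. \<bar>h (Sup K) - h (Inf K)\<bar> + \<bar>c\<bar> * (Sup K - Inf K))"
      proof (rule sum_mono)
        fix K assume "K \<in> d"
        have eq: "g (Sup K) - g (Inf K) = (h (Sup K) - h (Inf K)) - c * (Sup K - Inf K)"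
          by (simp add: g_def algebra_simps)
        have "\<bar>c * (Sup K - Inf K)\<bar> = \<bar>c\<bar> * (Sup K - Inf K)"
          using division_piece(2)[OF d(1) \<open>K \<in> d\<close>] by (simp add: abs_mult)
        then show "\<bar>g (Sup K) - g (Inf K)\<bar> \<le> \<bar>h (Sup K) - h (Inf K)\<bar> + \<bar>c\<bar> * (Sup K - Inf K)"
          unfolding eq by linarith
      qed
      also have "\<dots> = (\<Sum>K\<in>d. \<bar>h (Sup K) - h (Inf K)\<bar>) + \<bar>c\<bar> * (\<Sum>K\<in>d. Sup K - Inf K)"
        by (simp add: sum.distrib sum_distrib_left)
      also have "\<dots> \<le> V + \<bar>c\<bar> * (b - a)"
        using bv[OF d] len by (intro add_mono mult_left_mono) auto
      finally show ?thesis .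
    qed
    from negligible_oscillating_slopes[where \<eta> = "(q - p) / 2", OF bvg] that
    have neg: "negligible {x \<in> {a<..<b}. (\<exists>\<^sub>F y in at x. s g x y < - ((q - p) / 2)) \<and>
                                  (\<exists>\<^sub>F y in at x. s g x y > (q - p) / 2)}"
      by (simp add: s_def)
    have sl: "s g x y = s h x y - c" if "y \<noteq> x" for x y
      using that by (simp add: s_def g_def field_simps)
    have ne: "\<forall>\<^sub>F y in at x. y \<noteq> x" for x :: real
      by (simp add: eventually_at_filter)
    have "(\<exists>\<^sub>F y in at x. s g x y < - ((q - p) / 2))" if "\<exists>\<^sub>F y in at x. s h x y < p" for x
      using frequently_eventually_conj[OF that ne[of x]]
      by (rule frequently_elim1) (simp add: sl c_def field_simps)
    moreover have "(\<exists>\<^sub>F y in at x. s g x y > (q - p) / 2)" if "\<exists>\<^sub>F y in at x. s h x y > q" for x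
      using frequently_eventually_conj[OF that ne[of x]]
      by (rule frequently_elim1) (simp add: sl c_def field_simps)
    ultimately show ?thesis
      unfolding E_def by (intro negligible_subset[OF neg]) auto
  qed
  define R where "R = {(p, q). p \<in> \<rat> \<and> q \<in> \<rat> \<and> p < (q::real)}"
  have "R \<subseteq> \<rat> \<times> \<rat>" by (auto simp: R_def)
  then have "countable R"
    using countable_rat countable_SIGMA countable_subset by metis
  then have "negligible (\<Union>(E ` R))"
    using E by (intro negligible_countable_Union) (auto simp: R_def)
  then have "negligible (U \<union> \<Union>(E ` R))"
    using U by (rule negligible_Un[rotated])
  then show ?thesis
  proof (rule negligible_subset, safe)
    fix x assume x: "x \<in> {a<..<b}" "\<not> h field_differentiable at x" "x \<notin> \<Union>(E ` R)"
    have "\<not> (s h x \<longlongrightarrow> l) (at x)" for l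
      using x(2) unfolding field_differentiable_def has_field_derivative_iff s_def by blast
    from frequently_if_not_tendsto_real[OF _ this] x(1,3) show "x \<in> U"
      unfolding E_def U_def R_def by (simp add: Bex_def) blast
  qed
qed

section \<open>The fundamental theorem for absolutely continuous functions\<close>

text \<open>This is absolute continuity with \<open>\<epsilon> = 1\<close>: inside an interval
  shorter than \<open>\<delta>\<close> every division is short enough. Working locally avoids
  cutting arbitrary divisions at grid points; negligibility and integrability can be patched
  together from short intervals afterwards.\<close>

lemma abs_continuous01_locally_bounded_variation:
  assumes "abs_continuous01 f"
  obtains \<delta> where "\<delta> > 0"
    "\<And>a b d S. 0 \<le> a \<Longrightarrow> a \<le> b \<Longrightarrow> b \<le> 1 \<Longrightarrow> b - a < \<delta> \<Longrightarrow> d division_of S \<Longrightarrow> S \<subseteq> {a..b} \<Longrightarrow>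
       (\<Sum>K\<in>d. \<bar>f (Sup K) - f (Inf K)\<bar>) \<le> 1"
proof -
  obtain \<delta> where \<delta>: "\<delta> > 0" "\<And>d S. d division_of S \<Longrightarrow> S \<subseteq> {0..1} \<Longrightarrow> (\<Sum>K\<in>d. Sup K - Inf K) < \<delta> \<Longrightarrow>
      (\<Sum>K\<in>d. \<bar>f (Sup K) - f (Inf K)\<bar>) < 1"
    using assms unfolding abs_continuous01_def by (meson zero_less_one)
  show thesis
  proof (rule that[OF \<delta>(1)])
    fix a b d S assume *: "0 \<le> a" "a \<le> b" "b \<le> 1" "b - a < \<delta>" "d division_of S" "S \<subseteq> {a..b}"
    have "(\<Sum>K\<in>d. Sup K - Inf K) < \<delta>"
      using division_length_le[OF *(5,6,2)] *(4) by linarith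
    moreover have "S \<subseteq> {0..1}" using * by fastforce
    ultimately show "(\<Sum>K\<in>d. \<bar>f (Sup K) - f (Inf K)\<bar>) \<le> 1"
      using \<delta>(2)[OF *(5)] by (simp add: less_imp_le)
  qed
qed

lemma abs_continuous01_differentiable_ae:
  assumes "abs_continuous01 f"
  shows "negligible {x \<in> {0<..<1}. \<not> f field_differentiable at x}" (is "negligible ?N")
proof -
  obtain \<delta> where \<delta>: "\<delta> > 0"
    "\<And>a b d S. 0 \<le> a \<Longrightarrow> a \<le> b \<Longrightarrow> b \<le> 1 \<Longrightarrow> b - a < \<delta> \<Longrightarrow> d division_of S \<Longrightarrow> S \<subseteq> {a..b} \<Longrightarrow>
       (\<Sum>K\<in>d. \<bar>f (Sup K) - f (Inf K)\<bar>) \<le> 1"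
    using abs_continuous01_locally_bounded_variation[OF assms] by blast
  \<comment> \<open>Negligibility is a local property, so bounded variation in a short interval
    around each point is enough.\<close>
  have "\<exists>U. openin (top_of_set ?N) U \<and> x \<in> U \<and> negligible U" if x: "x \<in> ?N" for x
  proof -
    define a where "a = max 0 (x - \<delta> / 3)"
    define b where "b = min 1 (x + \<delta> / 3)"
    have ab: "0 \<le> a" "a < b" "b \<le> 1" "b - a < \<delta>" "x \<in> {a<..<b}"
      using x \<delta>(1) by (auto simp: a_def b_def)
    have "negligible {x \<in> {a<..<b}. \<not> f field_differentiable at x}"
      by (rule bounded_variation_differentiable_ae[OF \<delta>(2)[of a b] ab(2)]) (use ab in auto)
    then have "negligible (?N \<inter> {a<..<b})"
      by (rule negligible_subset) auto
    then show ?thesis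
      using x ab(5) by (intro exI[of _ "?N \<inter> {a<..<b}"]) (auto intro: openin_open_Int)
  qed
  then show ?thesis
    using locally_negligible_alt by blast
qed

text \<open>A gauge can treat good and bad tags differently. At a point of differentiability the
  increment of \<open>f\<close> is close to \<open>deriv f x\<close> times the length; pieces tagged
  in the null set \<open>N\<close> are forced into an open set of small measure, where absolute
  continuity makes their increments small. Integrability of \<open>deriv f\<close> comes out of the
  argument instead of going into it.\<close>

lemma abs_continuous01_has_integral_deriv:
  assumes ac: "abs_continuous01 f" and uv: "0 \<le> u" "u \<le> v" "v \<le> 1"
  shows "(deriv f has_integral (f v - f u)) {u..v}"
proof -
  define N where "N = {x \<in> {0<..<1}. \<not> f field_differentiable at x} \<union> {0, 1}"
  have N: "negligible N"
    unfolding N_def using abs_continuous01_differentiable_ae[OF ac] by (auto intro: negligible_Un)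
  \<comment> \<open>On \<open>N\<close> the value of \<open>deriv f\<close> carries no information.
    The value 0 removes those tags from the Riemann sums, and \<open>deriv f\<close> itself is
    restored at the end by a spike on \<open>N\<close>.\<close>
  define g where "g x = (if x \<in> N then 0 else deriv f x)" for x
  have "(g has_integral (f v - f u)) {u..v}"
    unfolding has_integral_real
  proof (intro allI impI)
    fix e :: real assume "e > 0"
    then obtain \<delta> where \<delta>: "\<delta> > 0" "\<And>d S. d division_of S \<Longrightarrow> S \<subseteq> {0..1} \<Longrightarrow> (\<Sum>K\<in>d. Sup K - Inf K) < \<delta> \<Longrightarrow>
      (\<Sum>K\<in>d. \<bar>f (Sup K) - f (Inf K)\<bar>) < e / 2"
      using ac unfolding abs_continuous01_def by (meson half_gt_zero)
    obtain G where G: "open G" "N \<subseteq> G" "G - N \<in> lmeasurable" "emeasure lebesgue (G - N) < ennreal \<delta>"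
      using sets_lebesgue_outer_open[OF negligible_imp_sets[OF N] \<delta>(1)] by metis
    have Gm: "G \<in> lmeasurable" "measure lebesgue G < \<delta>"
    proof -
      have eq: "G = (G - N) \<union> N" using G(2) by blast
      show "G \<in> lmeasurable"
        by (subst eq) (intro fmeasurable.Un G(3) negligible_imp_measurable[OF N])
      have "measure lebesgue G \<le> measure lebesgue (G - N) + measure lebesgue N"
        by (subst eq) (intro measure_Un_le fmeasurableD G(3) negligible_imp_measurable[OF N])
      moreover have "measure lebesgue (G - N) < \<delta>"
        using G(3,4) \<delta>(1) by (simp add: emeasure_eq_measure2 ennreal_less_iff)
      ultimately show "measure lebesgue G < \<delta>"
        using negligible_imp_measure0[OF N] by simp
    qed
    \<comment> \<open>Error budget: the slope error \<open>e / 4\<close> sums to at most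
      \<open>e / 4\<close> because the total length is at most 1, and the pieces tagged in
      \<open>N\<close> contribute less than \<open>e / 2\<close>.\<close>
    have "\<exists>r>0. (x \<in> N \<longrightarrow> ball x r \<subseteq> G) \<and>
        (x \<in> {0..1} - N \<longrightarrow> (\<forall>y\<in>ball x r. \<bar>f y - f x - deriv f x * (y - x)\<bar> \<le> e / 4 * \<bar>y - x\<bar>))" for x
    proof (cases "x \<in> N")
      case True
      then show ?thesis
        using G(1,2) open_contains_ball by auto
    next
      case False
      show ?thesis
      proof (cases "x \<in> {0..1}")
        case True
        with False have "f field_differentiable at x"
          unfolding N_def by auto
        then have "(f has_derivative (\<lambda>h. deriv f x * h)) (at x)"
          using field_differentiable_derivI has_field_derivative_def by blast
        then obtain r where "r > 0" "\<And>y. norm (y - x) < r \<Longrightarrow> norm (f y - f x - deriv f x * (y - x)) \<le> e / 4 * norm (y - x)"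
          unfolding has_derivative_at_alt using \<open>e > 0\<close> by (metis divide_pos_pos zero_less_numeral)
        with False show ?thesis
          by (intro exI[of _ r]) (auto simp: dist_real_def abs_minus_commute)
      qed (use False in \<open>auto intro!: exI[of _ 1]\<close>)
    qed
    then obtain r where r: "\<And>x. r x > 0" "\<And>x. x \<in> N \<Longrightarrow> ball x (r x) \<subseteq> G"
      "\<And>x y. x \<in> {0..1} - N \<Longrightarrow> y \<in> ball x (r x) \<Longrightarrow> \<bar>f y - f x - deriv f x * (y - x)\<bar> \<le> e / 4 * \<bar>y - x\<bar>"
      by metis
    show "\<exists>\<gamma>. gauge \<gamma> \<and> (\<forall>\<D>. \<D> tagged_division_of {u..v} \<and> \<gamma> fine \<D> \<longrightarrow>
           norm ((\<Sum>(x, k)\<in>\<D>. measure lborel k *\<^sub>R g x) - (f v - f u)) < e)"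
    proof (intro exI[of _ "\<lambda>x. ball x (r x)"] conjI allI impI)
      show "gauge (\<lambda>x. ball x (r x))"
        using r(1) gauge_ball_dependent by blast
      fix p assume "p tagged_division_of {u..v} \<and> (\<lambda>x. ball x (r x)) fine p"
      then have p: "p tagged_division_of {u..v}" and fine: "\<And>x K. (x, K) \<in> p \<Longrightarrow> K \<subseteq> ball x (r x)"
        by (auto simp: fine_def)
      have fin: "finite p" using p by auto
      define p1 where "p1 = {z \<in> p. fst z \<in> N}"
      let ?inc = "\<lambda>K. f (Sup K) - f (Inf K)"
      have piece: "K = {Inf K..Sup K} \<and> Inf K \<le> Sup K \<and> Inf K \<in> K \<and> Sup K \<in> K \<and> measure lborel K = Sup K - Inf K
          \<and> x \<in> K \<and> K \<subseteq> {u..v}" if "(x, K) \<in> p" for x K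
      proof -
        from tagged_division_ofD(2,3,4)[OF p that] obtain c d where "K = {c..d}" "x \<in> K" "K \<subseteq> {u..v}" by auto
        then show ?thesis by auto
      qed
      have tele: "(\<Sum>(x, K)\<in>p. ?inc K) = f v - f u"
        by (rule additive_tagged_division_1[OF uv(2) p])
      have tele': "(\<Sum>(x, K)\<in>p. Sup K - Inf K) = v - u"
        by (rule additive_tagged_division_1[OF uv(2) p])
      have regular: "\<bar>measure lborel K *\<^sub>R g x - ?inc K\<bar> \<le> e / 4 * (Sup K - Inf K)" if "(x, K) \<in> p - p1" for x K
      proof -
        have xK: "(x, K) \<in> p" "x \<notin> N" using that by (auto simp: p1_def)
        note P = piece[OF xK(1)]
        have x01: "x \<in> {0..1} - N" using P xK(2) uv by auto
        have x: "Inf K \<le> x" "x \<le> Sup K" using P by auto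
        have ball: "Inf K \<in> ball x (r x)" "Sup K \<in> ball x (r x)"
          using P fine[OF xK(1)] by blast+
        have A: "\<bar>f (Sup K) - f x - deriv f x * (Sup K - x)\<bar> \<le> e / 4 * (Sup K - x)"
          "\<bar>f (Inf K) - f x - deriv f x * (Inf K - x)\<bar> \<le> e / 4 * (x - Inf K)"
          using r(3)[OF x01 ball(2)] r(3)[OF x01 ball(1)] x by auto
        have m: "measure lborel K = Sup K - Inf K" using P by blast
        have "measure lborel K *\<^sub>R g x - ?inc K =
            (f (Inf K) - f x - deriv f x * (Inf K - x)) - (f (Sup K) - f x - deriv f x * (Sup K - x))"
          unfolding m using xK(2) by (simp add: g_def algebra_simps)
        moreover have "e / 4 * (Sup K - Inf K) = e / 4 * (Sup K - x) + e / 4 * (x - Inf K)"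
          by (simp add: field_simps)
        ultimately show ?thesis
          using A by linarith
      qed
      have "p1 tagged_partial_division_of {u..v}"
        using p tagged_partial_division_subset[of p "{u..v}" p1] by (auto simp: tagged_division_of_def p1_def)
      then have p1: "p1 tagged_division_of \<Union>(snd ` p1)"
        by (rule tagged_partial_division_of_Union_self)
      then have div1: "snd ` p1 division_of \<Union>(snd ` p1)"
        by (rule division_of_tagged_division)
      \<comment> \<open>Two tags can share a piece only if its interior is empty. For a function
        vanishing on such pieces, the sum over tagged pairs is therefore a sum over pieces, which is
        what absolute continuity controls.\<close>
      have over: "(\<Sum>(x, K)\<in>p1. \<phi> K) = (\<Sum>K\<in>snd ` p1. \<phi> K)"
        if "\<And>c. \<phi> {c..c} = 0" "\<phi> {} = 0" for \<phi> :: "real set \<Rightarrow> real"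
      proof (rule sum.over_tagged_division_lemma[OF p1])
        fix c d :: real assume "box c d = {}"
        then have "d \<le> c" by (simp add: box_real)
        then show "\<phi> (cbox c d) = 0"
          using that by (cases "c = d") auto
      qed
      have sub1: "\<Union>(snd ` p1) \<subseteq> G"
        using fine r(2) unfolding p1_def by fastforce
      have "(\<Sum>K\<in>snd ` p1. Sup K - Inf K) = (\<Sum>K\<in>snd ` p1. measure lebesgue K)"
      proof (rule sum.cong[OF refl])
        fix K assume "K \<in> snd ` p1"
        then obtain x where "(x, K) \<in> p" by (auto simp: p1_def)
        then have "K = {Inf K..Sup K}" "Inf K \<le> Sup K" using piece by blast+
        then obtain c d where "K = {c..d}" "c \<le> d" by blast
        then show "Sup K - Inf K = measure lebesgue K" by simp
      qed
      also have "\<dots> = measure lebesgue (\<Union>(snd ` p1))"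
        by (rule content_division[OF div1])
      also have "\<dots> \<le> measure lebesgue G"
        using sub1 Gm(1) division_of_closed[OF div1] by (intro measure_mono_fmeasurable) (auto intro: borel_closed)
      finally have "(\<Sum>K\<in>snd ` p1. Sup K - Inf K) < \<delta>" using Gm(2) by linarith
      moreover have "\<Union>(snd ` p1) \<subseteq> {0..1}"
        using piece uv unfolding p1_def by fastforce
      ultimately have small: "(\<Sum>K\<in>snd ` p1. \<bar>?inc K\<bar>) < e / 2"
        using \<delta>(2)[OF div1] by blast
      \<comment> \<open>The increment over the empty set would involve unspecified values of
        \<open>Sup {}\<close> and \<open>Inf {}\<close>, while \<open>over\<close> asks for 0 there.
        Pieces of \<open>p1\<close> are nonempty, so \<open>\<phi>\<close> agrees with the absolute
        increment on all of them.\<close>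
      define \<phi> where "\<phi> K = (if K = {} then 0 else \<bar>?inc K\<bar>)" for K
      have ne: "K \<noteq> {}" if "(x, K) \<in> p1" for x K
        using piece[of x K] that unfolding p1_def by auto
      have "(\<Sum>(x, K)\<in>p1. \<bar>?inc K\<bar>) = (\<Sum>(x, K)\<in>p1. \<phi> K)"
        by (rule sum.cong[OF refl]) (use ne in \<open>auto simp: \<phi>_def\<close>)
      also have "\<dots> = (\<Sum>K\<in>snd ` p1. \<phi> K)"
        by (rule over) (auto simp: \<phi>_def)
      also have "\<dots> = (\<Sum>K\<in>snd ` p1. \<bar>?inc K\<bar>)"
        by (rule sum.cong[OF refl]) (use ne in \<open>auto simp: \<phi>_def\<close>)
      finally have 1: "(\<Sum>(x, K)\<in>p1. \<bar>?inc K\<bar>) < e / 2"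
        using small by simp
      have g0: "(\<Sum>(x, K)\<in>p1. \<bar>measure lborel K *\<^sub>R g x - ?inc K\<bar>) = (\<Sum>(x, K)\<in>p1. \<bar>?inc K\<bar>)"
        by (intro sum.cong refl) (auto simp: p1_def g_def)
      have "(\<Sum>(x, K)\<in>p - p1. \<bar>measure lborel K *\<^sub>R g x - ?inc K\<bar>) \<le> (\<Sum>(x, K)\<in>p - p1. e / 4 * (Sup K - Inf K))"
        using regular by (intro sum_mono) auto
      also have "\<dots> \<le> (\<Sum>(x, K)\<in>p. e / 4 * (Sup K - Inf K))"
        using fin piece \<open>e > 0\<close> by (intro sum_mono2) auto
      also have "\<dots> = e / 4 * (v - u)"
        unfolding tele'[symmetric] sum_distrib_left by (simp add: case_prod_unfold)
      also have "\<dots> \<le> e / 4"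
        using uv \<open>e > 0\<close> by (simp add: mult_left_le)
      finally have 2: "(\<Sum>(x, K)\<in>p - p1. \<bar>measure lborel K *\<^sub>R g x - ?inc K\<bar>) \<le> e / 4" .
      have "norm ((\<Sum>(x, k)\<in>p. measure lborel k *\<^sub>R g x) - (f v - f u)) = \<bar>\<Sum>(x, K)\<in>p. measure lborel K *\<^sub>R g x - ?inc K\<bar>"
        unfolding tele[symmetric] by (simp add: case_prod_unfold sum_subtractf)
      also have "\<dots> \<le> (\<Sum>(x, K)\<in>p. \<bar>measure lborel K *\<^sub>R g x - ?inc K\<bar>)"
        by (rule order_trans[OF sum_abs]) (simp add: case_prod_unfold)
      also have "\<dots> = (\<Sum>(x, K)\<in>p - p1. \<bar>measure lborel K *\<^sub>R g x - ?inc K\<bar>) + (\<Sum>(x, K)\<in>p1. \<bar>measure lborel K *\<^sub>R g x - ?inc K\<bar>)"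
        using fin by (intro sum.subset_diff) (auto simp: p1_def)
      also have "\<dots> < e"
        using 1 2 g0 \<open>e > 0\<close> by linarith
      finally show "norm ((\<Sum>(x, k)\<in>p. measure lborel k *\<^sub>R g x) - (f v - f u)) < e" .
    qed
  qed
  then show ?thesis
    by (rule has_integral_spike[OF N, rotated]) (auto simp: g_def)
qed

text \<open>The integral of \<open>deriv f\<close> over a piece is the increment of
  \<open>f\<close>, so a variation bound for \<open>f\<close> is one for the indefinite integral,
  and this upgrades gauge integrability to absolute integrability. It is available on intervals
  shorter than \<open>\<delta>\<close>; finitely many steps of length \<open>1 / Suc n\<close> reach
  the point 1.\<close>

lemma abs_continuous01_deriv_absolutely_integrable:
  assumes ac: "abs_continuous01 f"
  shows "deriv f absolutely_integrable_on {0..1}"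
proof -
  obtain \<delta> where \<delta>: "\<delta> > 0"
    "\<And>a b d S. 0 \<le> a \<Longrightarrow> a \<le> b \<Longrightarrow> b \<le> 1 \<Longrightarrow> b - a < \<delta> \<Longrightarrow> d division_of S \<Longrightarrow> S \<subseteq> {a..b} \<Longrightarrow>
       (\<Sum>K\<in>d. \<bar>f (Sup K) - f (Inf K)\<bar>) \<le> 1"
    using abs_continuous01_locally_bounded_variation[OF ac] by blast
  obtain n where n: "inverse (real (Suc n)) < \<delta>"
    using reals_Archimedean[OF \<delta>(1)] by blast
  have small: "deriv f absolutely_integrable_on {a..b}" if ab: "0 \<le> a" "a \<le> b" "b \<le> 1" "b - a < \<delta>" for a b
    unfolding cbox_interval[symmetric]
  proof (rule bounded_variation_absolutely_integrable_interval[where B = 1])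
    show "deriv f integrable_on cbox a b"
      using abs_continuous01_has_integral_deriv[OF ac ab(1-3)] by auto
    fix d assume d: "d division_of cbox a b"
    have "(\<Sum>K\<in>d. norm (integral K (deriv f))) = (\<Sum>K\<in>d. \<bar>f (Sup K) - f (Inf K)\<bar>)"
    proof (rule sum.cong[OF refl])
      fix K assume K: "K \<in> d"
      note P = division_piece[OF d K]
      have "(deriv f has_integral (f (Sup K) - f (Inf K))) {Inf K..Sup K}"
        using P ab by (intro abs_continuous01_has_integral_deriv[OF ac]) auto
      then have "integral K (deriv f) = f (Sup K) - f (Inf K)"
        using P(1) integral_unique by metis
      then show "norm (integral K (deriv f)) = \<bar>f (Sup K) - f (Inf K)\<bar>" by simp
    qed
    also have "\<dots> \<le> 1"
      using \<delta>(2)[OF ab d] by simp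
    finally show "(\<Sum>K\<in>d. norm (integral K (deriv f))) \<le> 1" .
  qed
  have "deriv f absolutely_integrable_on {0..real i / real (Suc n)}" if "i \<le> Suc n" for i
    using that
  proof (induction i)
    case 0
    then show ?case using small[of 0 0] \<delta>(1) by simp
  next
    case (Suc i)
    define c where "c = real i / real (Suc n)"
    define c' where "c' = real (Suc i) / real (Suc n)"
    have "c' - c = inverse (real (Suc n))"
      by (simp add: c_def c'_def field_simps)
    then have *: "0 \<le> c" "c \<le> c'" "c' \<le> 1" "c' - c < \<delta>"
      using Suc.prems n by (auto simp: c_def c'_def divide_right_mono)
    then have "deriv f absolutely_integrable_on {c..c'}"
      by (intro small)
    moreover have "deriv f absolutely_integrable_on {0..c}"
      unfolding c_def using Suc by simp
    ultimately show ?case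
      unfolding c'_def[symmetric] using * absolutely_integrable_on_combine by blast
  qed
  from this[of "Suc n"] show ?thesis by simp
qed

section \<open>Riemann--Stieltjes integrals and integration by parts\<close>

lemma absolutely_integrable_on_iff_integrable01:
  fixes h :: "real \<Rightarrow> real"
  shows "h absolutely_integrable_on {0..1} \<longleftrightarrow> integrable leb01 h"
  by (simp add: set_integrable_def integrable_restrict_space)

lemma lebesgue_integral01_eq:
  fixes h :: "real \<Rightarrow> real"
  assumes "h absolutely_integrable_on {0..1}"
  shows "integral\<^sup>L leb01 h = integral {0..1} h"
  using assms by (intro lebesgue_integral_eq_integral) (auto simp: absolutely_integrable_on_iff_integrable01)

lemma absolutely_integrable_continuous_mult:
  fixes g h :: "real \<Rightarrow> real"
  assumes "continuous_on {a..b} g" "h absolutely_integrable_on {a..b}"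
  shows "(\<lambda>x. g x * h x) absolutely_integrable_on {a..b}"
proof (rule absolutely_integrable_bounded_measurable_product_real)
  show "g \<in> borel_measurable (lebesgue_on {a..b})"
    using assms(1) by (intro continuous_imp_measurable_on_sets_lebesgue) auto
  show "bounded (g ` {a..b})"
    using assms(1) by (intro compact_imp_bounded compact_continuous_image) auto
qed (use assms in auto)

lemma abs_continuous01_continuous:
  assumes "abs_continuous01 f"
  shows "continuous_on {0..1} f"
proof -
  have "continuous_on {0..1} (\<lambda>x. integral {0..x} (deriv f))"
    using abs_continuous01_has_integral_deriv[OF assms, of 0 1]
    by (intro indefinite_integral_continuous_1) auto
  then have "continuous_on {0..1} (\<lambda>x. f 0 + integral {0..x} (deriv f))"
    by (intro continuous_intros)
  moreover have "f 0 + integral {0..x} (deriv f) = f x" if "x \<in> {0..1}" for x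
    using abs_continuous01_has_integral_deriv[OF assms, of 0 x] that by (simp add: integral_unique)
  ultimately show ?thesis
    by (rule continuous_on_eq)
qed

lemma Lipschitz_imp_abs_continuous01:
  assumes L: "\<And>x y. 0 \<le> x \<Longrightarrow> x \<le> y \<Longrightarrow> y \<le> 1 \<Longrightarrow> \<bar>f y - f x\<bar> \<le> C * (y - x)"
  shows "abs_continuous01 f"
  unfolding abs_continuous01_def
proof (intro allI impI)
  fix \<epsilon> :: real assume "\<epsilon> > 0"
  show "\<exists>\<delta>>0. \<forall>d S. d division_of S \<longrightarrow> S \<subseteq> {0..1} \<longrightarrow> (\<Sum>K\<in>d. Sup K - Inf K) < \<delta> \<longrightarrow>
      (\<Sum>K\<in>d. \<bar>f (Sup K) - f (Inf K)\<bar>) < \<epsilon>"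
  proof (intro exI[of _ "\<epsilon> / (\<bar>C\<bar> + 1)"] conjI allI impI)
    fix d S assume d: "d division_of S" "S \<subseteq> {0..1}" "(\<Sum>K\<in>d. Sup K - Inf K) < \<epsilon> / (\<bar>C\<bar> + 1)"
    have "(\<Sum>K\<in>d. \<bar>f (Sup K) - f (Inf K)\<bar>) \<le> (\<Sum>K\<in>d. (\<bar>C\<bar> + 1) * (Sup K - Inf K))"
    proof (rule sum_mono)
      fix K assume K: "K \<in> d"
      note P = division_piece[OF d(1) K]
      have "\<bar>f (Sup K) - f (Inf K)\<bar> \<le> C * (Sup K - Inf K)"
        using P d(2) by (intro L) auto
      also have "\<dots> \<le> (\<bar>C\<bar> + 1) * (Sup K - Inf K)"
        using P by (intro mult_right_mono) auto
      finally show "\<bar>f (Sup K) - f (Inf K)\<bar> \<le> (\<bar>C\<bar> + 1) * (Sup K - Inf K)" .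
    qed
    also have "\<dots> = (\<bar>C\<bar> + 1) * (\<Sum>K\<in>d. Sup K - Inf K)"
      by (simp add: sum_distrib_left)
    also have "\<dots> < \<epsilon>"
      using d(3) by (simp add: field_simps)
    finally show "(\<Sum>K\<in>d. \<bar>f (Sup K) - f (Inf K)\<bar>) < \<epsilon>" .
  qed (use \<open>\<epsilon> > 0\<close> in \<open>auto intro: divide_pos_pos\<close>)
qed

lemma abs_continuous01_mult:
  assumes f: "abs_continuous01 f" and g: "abs_continuous01 g"
  shows "abs_continuous01 (\<lambda>x. f x * g x)"
  unfolding abs_continuous01_def
proof (intro allI impI)
  fix \<epsilon> :: real assume "\<epsilon> > 0"
  have "bounded (f ` {0..1})" "bounded (g ` {0..1})"
    using f g by (auto intro!: compact_imp_bounded compact_continuous_image abs_continuous01_continuous)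
  then obtain Mf Mg where M: "\<And>x. x \<in> {0..1} \<Longrightarrow> \<bar>f x\<bar> \<le> Mf" "\<And>x. x \<in> {0..1} \<Longrightarrow> \<bar>g x\<bar> \<le> Mg"
    unfolding bounded_iff image_iff Bex_def real_norm_def by blast
  have M0: "0 \<le> Mf" "0 \<le> Mg" using M(1)[of 0] M(2)[of 0] by auto
  \<comment> \<open>Each factor contributes its bound times the variation of the other. The
    \<open>+ 1\<close> covers vanishing bounds, and the 2 leaves a strict inequality.\<close>
  define \<eta> where "\<eta> = \<epsilon> / (2 * (Mf + Mg + 1))"
  have \<eta>: "\<eta> > 0" using \<open>\<epsilon> > 0\<close> M0 by (auto simp: \<eta>_def intro!: divide_pos_pos)
  obtain \<delta>1 where \<delta>1: "\<delta>1 > 0" "\<And>d S. d division_of S \<Longrightarrow> S \<subseteq> {0..1} \<Longrightarrow> (\<Sum>K\<in>d. Sup K - Inf K) < \<delta>1 \<Longrightarrow>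
      (\<Sum>K\<in>d. \<bar>f (Sup K) - f (Inf K)\<bar>) < \<eta>"
    using f \<eta> unfolding abs_continuous01_def by meson
  obtain \<delta>2 where \<delta>2: "\<delta>2 > 0" "\<And>d S. d division_of S \<Longrightarrow> S \<subseteq> {0..1} \<Longrightarrow> (\<Sum>K\<in>d. Sup K - Inf K) < \<delta>2 \<Longrightarrow>
      (\<Sum>K\<in>d. \<bar>g (Sup K) - g (Inf K)\<bar>) < \<eta>"
    using g \<eta> unfolding abs_continuous01_def by meson
  show "\<exists>\<delta>>0. \<forall>d S. d division_of S \<longrightarrow> S \<subseteq> {0..1} \<longrightarrow> (\<Sum>K\<in>d. Sup K - Inf K) < \<delta> \<longrightarrow>
      (\<Sum>K\<in>d. \<bar>f (Sup K) * g (Sup K) - f (Inf K) * g (Inf K)\<bar>) < \<epsilon>"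
  proof (intro exI[of _ "min \<delta>1 \<delta>2"] conjI allI impI)
    fix d S assume d: "d division_of S" "S \<subseteq> {0..1}" "(\<Sum>K\<in>d. Sup K - Inf K) < min \<delta>1 \<delta>2"
    have "(\<Sum>K\<in>d. \<bar>f (Sup K) * g (Sup K) - f (Inf K) * g (Inf K)\<bar>)
        \<le> (\<Sum>K\<in>d. Mf * \<bar>g (Sup K) - g (Inf K)\<bar> + Mg * \<bar>f (Sup K) - f (Inf K)\<bar>)"
    proof (rule sum_mono)
      fix K assume K: "K \<in> d"
      note P = division_piece[OF d(1) K]
      have eq: "f (Sup K) * g (Sup K) - f (Inf K) * g (Inf K) =
          f (Sup K) * (g (Sup K) - g (Inf K)) + g (Inf K) * (f (Sup K) - f (Inf K))"
        by (simp add: algebra_simps)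
      have "\<bar>f (Sup K) * (g (Sup K) - g (Inf K))\<bar> \<le> Mf * \<bar>g (Sup K) - g (Inf K)\<bar>"
        "\<bar>g (Inf K) * (f (Sup K) - f (Inf K))\<bar> \<le> Mg * \<bar>f (Sup K) - f (Inf K)\<bar>"
        unfolding abs_mult using M P d(2) by (auto intro!: mult_right_mono)
      then show "\<bar>f (Sup K) * g (Sup K) - f (Inf K) * g (Inf K)\<bar>
          \<le> Mf * \<bar>g (Sup K) - g (Inf K)\<bar> + Mg * \<bar>f (Sup K) - f (Inf K)\<bar>"
        unfolding eq by linarith
    qed
    also have "\<dots> = Mf * (\<Sum>K\<in>d. \<bar>g (Sup K) - g (Inf K)\<bar>) + Mg * (\<Sum>K\<in>d. \<bar>f (Sup K) - f (Inf K)\<bar>)"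
      by (simp add: sum.distrib sum_distrib_left)
    also have "\<dots> \<le> Mf * \<eta> + Mg * \<eta>"
      using \<delta>1(2)[OF d(1,2)] \<delta>2(2)[OF d(1,2)] d(3) M0 by (intro add_mono mult_left_mono) auto
    also have "\<dots> \<le> (Mf + Mg + 1) * \<eta>"
      using \<eta> by (simp add: algebra_simps)
    also have "\<dots> = \<epsilon> / 2"
      unfolding \<eta>_def using M0 by (simp add: field_simps)
    also have "\<dots> < \<epsilon>" using \<open>\<epsilon> > 0\<close> by simp
    finally show "(\<Sum>K\<in>d. \<bar>f (Sup K) * g (Sup K) - f (Inf K) * g (Inf K)\<bar>) < \<epsilon>" .
  qed (use \<delta>1 \<delta>2 in auto)
qed

lemma abs_continuous01_deriv_mult_ae:
  assumes f: "abs_continuous01 f" and g: "abs_continuous01 g"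
  obtains N where "negligible N"
    "\<And>x. x \<in> {0..1} - N \<Longrightarrow> deriv (\<lambda>x. f x * g x) x = deriv f x * g x + f x * deriv g x"
proof
  let ?N = "{x \<in> {0<..<1}. \<not> f field_differentiable at x} \<union>
    {x \<in> {0<..<1}. \<not> g field_differentiable at x} \<union> {0, 1}"
  show "negligible ?N"
    using f g by (intro negligible_Un abs_continuous01_differentiable_ae) auto
  show "deriv (\<lambda>x. f x * g x) x = deriv f x * g x + f x * deriv g x" if "x \<in> {0..1} - ?N" for x
    using that by (subst deriv_mult) auto
qed

section \<open>Limits of Riemann-Stieltjes sums\<close>

lemma tagged_division_piece:
  assumes "p tagged_division_of {a..b::real}" "(x, K) \<in> p"
  shows "K = {Inf K..Sup K}" "Inf K \<le> x" "x \<le> Sup K" "a \<le> Inf K" "Sup K \<le> b"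
proof -
  from tagged_division_ofD(2,3,4)[OF assms] obtain c d where "K = {c..d}" "x \<in> K" "K \<subseteq> {a..b}" by auto
  then show "K = {Inf K..Sup K}" "Inf K \<le> x" "x \<le> Sup K" "a \<le> Inf K" "Sup K \<le> b" by auto
qed

text \<open>Two limits can be compared only along an actual division of small mesh; Cousin's lemma
  for a constant gauge provides one.\<close>

lemma has_stieltjes_integral_unique:
  assumes "has_stieltjes_integral \<phi> b I" "has_stieltjes_integral \<phi> b J"
  shows "I = J"
proof (rule ccontr)
  assume "I \<noteq> J"
  define \<epsilon> where "\<epsilon> = \<bar>I - J\<bar> / 2"
  have "\<epsilon> > 0" using \<open>I \<noteq> J\<close> by (simp add: \<epsilon>_def)
  obtain \<delta>1 where \<delta>1: "\<delta>1 > 0" "\<And>p. p tagged_division_of {0..1} \<Longrightarrow> (\<forall>(x, K)\<in>p. Sup K - Inf K < \<delta>1) \<Longrightarrow>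
      \<bar>(\<Sum>(x, K)\<in>p. \<phi> x * (b (Sup K) - b (Inf K))) - I\<bar> < \<epsilon>"
    using assms(1) \<open>\<epsilon> > 0\<close> unfolding has_stieltjes_integral_def by meson
  obtain \<delta>2 where \<delta>2: "\<delta>2 > 0" "\<And>p. p tagged_division_of {0..1} \<Longrightarrow> (\<forall>(x, K)\<in>p. Sup K - Inf K < \<delta>2) \<Longrightarrow>
      \<bar>(\<Sum>(x, K)\<in>p. \<phi> x * (b (Sup K) - b (Inf K))) - J\<bar> < \<epsilon>"
    using assms(2) \<open>\<epsilon> > 0\<close> unfolding has_stieltjes_integral_def by meson
  \<comment> \<open>A piece inside a ball of radius \<open>r\<close> has length below
    \<open>2 * r\<close>, the smaller of the two mesh bounds.\<close>
  define r where "r = min \<delta>1 \<delta>2 / 2"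
  have "gauge (\<lambda>x::real. ball x r)" using \<delta>1(1) \<delta>2(1) by (auto simp: r_def intro: gauge_ball)
  then obtain p where p: "p tagged_division_of {0..1::real}" "(\<lambda>x. ball x r) fine p"
    by (rule fine_division_exists_real)
  have "Sup K - Inf K < min \<delta>1 \<delta>2" if "(x, K) \<in> p" for x K
  proof -
    note P = tagged_division_piece[OF p(1) that]
    have "{Inf K..Sup K} \<subseteq> ball x r"
      using fineD[OF p(2) that] P(1) by simp
    then have "Inf K \<in> ball x r" "Sup K \<in> ball x r"
      using P(2,3) by (simp_all add: subset_eq)
    then have "\<bar>x - Inf K\<bar> < r" "\<bar>x - Sup K\<bar> < r"
      by (auto simp: dist_real_def)
    then have "Sup K - Inf K < 2 * r" by linarith
    then show ?thesis by (simp add: r_def)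
  qed
  then have "\<bar>(\<Sum>(x, K)\<in>p. \<phi> x * (b (Sup K) - b (Inf K))) - I\<bar> < \<epsilon>"
    "\<bar>(\<Sum>(x, K)\<in>p. \<phi> x * (b (Sup K) - b (Inf K))) - J\<bar> < \<epsilon>"
    by (intro \<delta>1(2) \<delta>2(2) p(1); force)+
  then show False
    unfolding \<epsilon>_def by (simp add: abs_if split: if_splits)
qed

text \<open>Both ways of turning Riemann--Stieltjes sums into integrals reduce to this estimate: on
  each piece the sum and the integral differ by at most the oscillation times \<open>\<integral>\<bar>w\<bar>\<close>.\<close>

lemma has_stieltjes_integralI:
  assumes w: "w absolutely_integrable_on {0..1}"
    and est: "\<And>\<epsilon>. \<epsilon> > 0 \<Longrightarrow> \<exists>\<delta>>0. \<forall>x u v. 0 \<le> u \<longrightarrow> u \<le> x \<longrightarrow> x \<le> v \<longrightarrow> v \<le> 1 \<longrightarrow> v - u < \<delta> \<longrightarrow>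
      \<bar>\<phi> x * (b v - b u) - (F v - F u)\<bar> \<le> \<epsilon> * integral {u..v} (\<lambda>t. \<bar>w t\<bar>)"
  shows "has_stieltjes_integral \<phi> b (F 1 - F 0)"
  unfolding has_stieltjes_integral_def
proof (intro allI impI)
  fix \<epsilon> :: real assume "\<epsilon> > 0"
  define A where "A = integral {0..1} (\<lambda>t. \<bar>w t\<bar>)"
  have aw: "(\<lambda>t. \<bar>w t\<bar>) integrable_on {0..1}"
    using w by (simp add: absolutely_integrable_on_def)
  have "A \<ge> 0" unfolding A_def by (intro integral_nonneg aw) auto
  then have "\<epsilon> / (A + 1) > 0" using \<open>\<epsilon> > 0\<close> by (intro divide_pos_pos) auto
  from est[OF this] obtain \<delta> where \<delta>: "\<delta> > 0" "\<And>x u v. 0 \<le> u \<Longrightarrow> u \<le> x \<Longrightarrow> x \<le> v \<Longrightarrow> v \<le> 1 \<Longrightarrow> v - u < \<delta> \<Longrightarrow>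
      \<bar>\<phi> x * (b v - b u) - (F v - F u)\<bar> \<le> \<epsilon> / (A + 1) * integral {u..v} (\<lambda>t. \<bar>w t\<bar>)"
    by blast
  show "\<exists>\<delta>>0. \<forall>p. p tagged_division_of {0..1} \<longrightarrow> (\<forall>(x, K)\<in>p. Sup K - Inf K < \<delta>) \<longrightarrow>
      \<bar>(\<Sum>(x, K)\<in>p. \<phi> x * (b (Sup K) - b (Inf K))) - (F 1 - F 0)\<bar> < \<epsilon>"
  proof (intro exI[of _ \<delta>] conjI allI impI \<delta>(1))
    fix p assume p: "p tagged_division_of {0..1::real}" and fine: "\<forall>(x, K)\<in>p. Sup K - Inf K < \<delta>"
    have each: "\<bar>\<phi> x * (b (Sup K) - b (Inf K)) - (F (Sup K) - F (Inf K))\<bar> \<le> \<epsilon> / (A + 1) * integral K (\<lambda>t. \<bar>w t\<bar>)"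
      if "(x, K) \<in> p" for x K
    proof -
      note P = tagged_division_piece[OF p that]
      have "\<bar>\<phi> x * (b (Sup K) - b (Inf K)) - (F (Sup K) - F (Inf K))\<bar>
          \<le> \<epsilon> / (A + 1) * integral {Inf K..Sup K} (\<lambda>t. \<bar>w t\<bar>)"
        using P that fine by (intro \<delta>(2)) auto
      then show ?thesis
        using P(1) by metis
    qed
    have tele: "(\<Sum>(x, K)\<in>p. F (Sup K) - F (Inf K)) = F 1 - F 0"
      by (rule additive_tagged_division_1[OF _ p]) simp
    have "\<bar>(\<Sum>(x, K)\<in>p. \<phi> x * (b (Sup K) - b (Inf K))) - (F 1 - F 0)\<bar>
        = \<bar>\<Sum>(x, K)\<in>p. \<phi> x * (b (Sup K) - b (Inf K)) - (F (Sup K) - F (Inf K))\<bar>"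
      unfolding tele[symmetric] by (simp add: case_prod_unfold sum_subtractf)
    also have "\<dots> \<le> (\<Sum>(x, K)\<in>p. \<bar>\<phi> x * (b (Sup K) - b (Inf K)) - (F (Sup K) - F (Inf K))\<bar>)"
      by (rule order_trans[OF sum_abs]) (simp add: case_prod_unfold)
    also have "\<dots> \<le> (\<Sum>(x, K)\<in>p. \<epsilon> / (A + 1) * integral K (\<lambda>t. \<bar>w t\<bar>))"
      using each by (intro sum_mono) (auto split: prod.splits)
    also have "\<dots> = \<epsilon> / (A + 1) * (\<Sum>(x, K)\<in>p. integral K (\<lambda>t. \<bar>w t\<bar>))"
      by (simp add: sum_distrib_left case_prod_unfold)
    also have "(\<Sum>(x, K)\<in>p. integral K (\<lambda>t. \<bar>w t\<bar>)) = A"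
      unfolding A_def using integral_combine_tagged_division_topdown[of "\<lambda>t. \<bar>w t\<bar>" 0 1 p] aw p by simp
    also have "\<epsilon> / (A + 1) * A < \<epsilon>"
      using \<open>\<epsilon> > 0\<close> \<open>A \<ge> 0\<close> by (simp add: field_simps)
    finally show "\<bar>(\<Sum>(x, K)\<in>p. \<phi> x * (b (Sup K) - b (Inf K))) - (F 1 - F 0)\<bar> < \<epsilon>" .
  qed
qed

text \<open>The weight may change sign, so the error of freezing \<open>\<psi>\<close> at
  \<open>c\<close> is measured against \<open>\<bar>w\<bar>\<close>. That integral is additive over
  pieces, and the errors of a whole Riemann sum add up to \<open>\<epsilon>\<close> times a fixed
  number.\<close>

lemma integral_deviation_bound:
  fixes w \<psi> :: "real \<Rightarrow> real"
  assumes w: "w absolutely_integrable_on {0..1}" and \<psi>: "continuous_on {0..1} \<psi>"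
    and uv: "0 \<le> u" "u \<le> v" "v \<le> 1" and \<epsilon>: "\<And>t. t \<in> {u..v} \<Longrightarrow> \<bar>\<psi> t - c\<bar> \<le> \<epsilon>"
  shows "\<bar>integral {u..v} (\<lambda>t. \<psi> t * w t) - c * integral {u..v} w\<bar> \<le> \<epsilon> * integral {u..v} (\<lambda>t. \<bar>w t\<bar>)"
proof -
  have sub: "{u..v} \<subseteq> {0..1}" using uv by auto
  have w': "w absolutely_integrable_on {u..v}"
    using w sub by (rule absolutely_integrable_on_subinterval)
  have "(\<lambda>t. \<psi> t * w t) absolutely_integrable_on {u..v}"
    using continuous_on_subset[OF \<psi> sub] w' by (rule absolutely_integrable_continuous_mult)
  then have i1: "(\<lambda>t. \<psi> t * w t) integrable_on {u..v}" and i2: "w integrable_on {u..v}"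
    and i3: "(\<lambda>t. \<bar>w t\<bar>) integrable_on {u..v}"
    using w' by (auto simp: absolutely_integrable_on_def)
  have "integral {u..v} (\<lambda>t. \<psi> t * w t) - c * integral {u..v} w = integral {u..v} (\<lambda>t. \<psi> t * w t - c * w t)"
    using i1 integrable_on_cmult_left[OF i2, of c]
    by (subst Henstock_Kurzweil_Integration.integral_diff) auto
  also have "\<bar>\<dots>\<bar> \<le> integral {u..v} (\<lambda>t. \<epsilon> * \<bar>w t\<bar>)"
  proof -
    have "norm (integral {u..v} (\<lambda>t. \<psi> t * w t - c * w t)) \<le> integral {u..v} (\<lambda>t. \<epsilon> * \<bar>w t\<bar>)"
    proof (rule integral_norm_bound_integral)
      show "norm (\<psi> t * w t - c * w t) \<le> \<epsilon> * \<bar>w t\<bar>" if "t \<in> {u..v}" for t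
        using mult_right_mono[OF \<epsilon>[OF that], of "\<bar>w t\<bar>"]
        by (simp add: abs_mult[symmetric] left_diff_distrib)
    qed (use i1 integrable_on_cmult_left[OF i2, of c] integrable_on_cmult_left[OF i3, of \<epsilon>] in
        \<open>auto intro!: integrable_diff\<close>)
    then show ?thesis by simp
  qed
  finally show ?thesis by simp
qed

lemma uniformly_close01:
  fixes \<psi> :: "real \<Rightarrow> real"
  assumes "continuous_on {0..1} \<psi>" "\<epsilon> > 0"
  obtains \<delta> where "\<delta> > 0" "\<And>s t. s \<in> {0..1} \<Longrightarrow> t \<in> {0..1} \<Longrightarrow> \<bar>s - t\<bar> < \<delta> \<Longrightarrow> \<bar>\<psi> s - \<psi> t\<bar> \<le> \<epsilon>"
proof -
  have "uniformly_continuous_on {0..1} \<psi>"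
    using assms(1) by (intro compact_uniformly_continuous) auto
  then obtain \<delta> where "\<delta> > 0" "\<And>s t. t \<in> {0..1} \<Longrightarrow> s \<in> {0..1} \<Longrightarrow> dist s t < \<delta> \<Longrightarrow> dist (\<psi> s) (\<psi> t) < \<epsilon>"
    using assms(2) unfolding uniformly_continuous_on_def by metis
  then show thesis
    by (intro that[of \<delta>]) (auto simp: dist_real_def less_imp_le)
qed

lemma integral01_increment:
  fixes h :: "real \<Rightarrow> real"
  assumes "h integrable_on {0..1}" "0 \<le> u" "u \<le> v" "v \<le> 1"
  shows "integral {0..v} h - integral {0..u} h = integral {u..v} h"
proof -
  have "h integrable_on {0..v}"
    using assms by (intro integrable_on_subinterval[OF assms(1)]) auto
  from Henstock_Kurzweil_Integration.integral_combine[OF assms(2,3) this] show ?thesis by simp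
qed

text \<open>The increment of the integrator over a piece is exactly the integral of
  \<open>w\<close>, so the only error comes from freezing \<open>\<psi>\<close> at the tag.
  Comparing this value with the one from \<open>has_stieltjes_integral_by_parts\<close> later yields
  ordinary integration by parts.\<close>

lemma has_stieltjes_integral_indefinite:
  assumes w: "w absolutely_integrable_on {0..1}" and \<psi>: "continuous_on {0..1} \<psi>"
  shows "has_stieltjes_integral \<psi> (\<lambda>x. integral {0..x} w) (integral {0..1} (\<lambda>t. \<psi> t * w t))"
proof -
  define F where "F x = integral {0..x} (\<lambda>t. \<psi> t * w t)" for x
  have pw: "(\<lambda>t. \<psi> t * w t) integrable_on {0..1}" and w': "w integrable_on {0..1}"
    using absolutely_integrable_continuous_mult[OF \<psi> w] w by (auto simp: absolutely_integrable_on_def)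
  have "has_stieltjes_integral \<psi> (\<lambda>x. integral {0..x} w) (F 1 - F 0)"
  proof (rule has_stieltjes_integralI[OF w])
    fix \<epsilon> :: real assume "\<epsilon> > 0"
    then obtain \<delta> where \<delta>: "\<delta> > 0" "\<And>s t. s \<in> {0..1} \<Longrightarrow> t \<in> {0..1} \<Longrightarrow> \<bar>s - t\<bar> < \<delta> \<Longrightarrow> \<bar>\<psi> s - \<psi> t\<bar> \<le> \<epsilon>"
      using uniformly_close01[OF \<psi>] by blast
    show "\<exists>\<delta>>0. \<forall>x u v. 0 \<le> u \<longrightarrow> u \<le> x \<longrightarrow> x \<le> v \<longrightarrow> v \<le> 1 \<longrightarrow> v - u < \<delta> \<longrightarrow>
        \<bar>\<psi> x * (integral {0..v} w - integral {0..u} w) - (F v - F u)\<bar> \<le> \<epsilon> * integral {u..v} (\<lambda>t. \<bar>w t\<bar>)"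
    proof (intro exI[of _ \<delta>] conjI \<delta>(1) allI impI)
      fix x u v :: real assume a: "0 \<le> u" "u \<le> x" "x \<le> v" "v \<le> 1" "v - u < \<delta>"
      have "\<bar>integral {u..v} (\<lambda>t. \<psi> t * w t) - \<psi> x * integral {u..v} w\<bar> \<le> \<epsilon> * integral {u..v} (\<lambda>t. \<bar>w t\<bar>)"
        using a by (intro integral_deviation_bound[OF w \<psi>] \<delta>(2)) auto
      then show "\<bar>\<psi> x * (integral {0..v} w - integral {0..u} w) - (F v - F u)\<bar> \<le> \<epsilon> * integral {u..v} (\<lambda>t. \<bar>w t\<bar>)"
        using a integral01_increment[OF pw, of u v] integral01_increment[OF w', of u v]
        by (simp add: F_def abs_minus_commute)
    qed
  qed
  then show ?thesis by (simp add: F_def)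
qed

text \<open>A continuous path may have infinite variation, so the derivative has to be placed on
  \<open>\<phi>\<close>. A piece from \<open>u\<close> to \<open>v\<close> is split at its tag
  \<open>x\<close>: \<open>b\<close> is frozen at \<open>b u\<close> on the left part and at
  \<open>b v\<close> on the right part, and the increments of \<open>\<phi>\<close> recombine to
  \<open>\<phi> x * (b v - b u)\<close> up to the increment of \<open>b * \<phi>\<close>.\<close>

lemma has_stieltjes_integral_by_parts:
  assumes ac: "abs_continuous01 \<phi>" and b: "continuous_on {0..1} b" and "\<phi> 0 = 0" "\<phi> 1 = 0"
  shows "has_stieltjes_integral \<phi> b (- integral {0..1} (\<lambda>x. b x * deriv \<phi> x))"
proof -
  note w = abs_continuous01_deriv_absolutely_integrable[OF ac]
  have bw: "(\<lambda>t. b t * deriv \<phi> t) integrable_on {0..1}" and aw: "(\<lambda>t. \<bar>deriv \<phi> t\<bar>) integrable_on {0..1}"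
    using absolutely_integrable_continuous_mult[OF b w] w by (auto simp: absolutely_integrable_on_def)
  \<comment> \<open>The primitive suggested by the product rule. As \<open>\<phi>\<close> vanishes
    at both ends, \<open>F 1 - F 0\<close> is the claimed value.\<close>
  define F where "F x = b x * \<phi> x - integral {0..x} (\<lambda>t. b t * deriv \<phi> t)" for x
  have "has_stieltjes_integral \<phi> b (F 1 - F 0)"
  proof (rule has_stieltjes_integralI[OF w])
    fix \<epsilon> :: real assume "\<epsilon> > 0"
    then obtain \<delta> where \<delta>: "\<delta> > 0" "\<And>s t. s \<in> {0..1} \<Longrightarrow> t \<in> {0..1} \<Longrightarrow> \<bar>s - t\<bar> < \<delta> \<Longrightarrow> \<bar>b s - b t\<bar> \<le> \<epsilon>"
      using uniformly_close01[OF b] by blast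
    show "\<exists>\<delta>>0. \<forall>x u v. 0 \<le> u \<longrightarrow> u \<le> x \<longrightarrow> x \<le> v \<longrightarrow> v \<le> 1 \<longrightarrow> v - u < \<delta> \<longrightarrow>
        \<bar>\<phi> x * (b v - b u) - (F v - F u)\<bar> \<le> \<epsilon> * integral {u..v} (\<lambda>t. \<bar>deriv \<phi> t\<bar>)"
    proof (intro exI[of _ \<delta>] conjI \<delta>(1) allI impI)
      fix x u v :: real assume a: "0 \<le> u" "u \<le> x" "x \<le> v" "v \<le> 1" "v - u < \<delta>"
      have inc: "integral {s..t} (deriv \<phi>) = \<phi> t - \<phi> s" if "0 \<le> s" "s \<le> t" "t \<le> 1" for s t
        using abs_continuous01_has_integral_deriv[OF ac that] by (rule integral_unique)
      have "\<bar>integral {u..x} (\<lambda>t. b t * deriv \<phi> t) - b u * integral {u..x} (deriv \<phi>)\<bar> \<le> \<epsilon> * integral {u..x} (\<lambda>t. \<bar>deriv \<phi> t\<bar>)"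
        using a by (intro integral_deviation_bound[OF w b] \<delta>(2)) auto
      moreover have "\<bar>integral {x..v} (\<lambda>t. b t * deriv \<phi> t) - b v * integral {x..v} (deriv \<phi>)\<bar> \<le> \<epsilon> * integral {x..v} (\<lambda>t. \<bar>deriv \<phi> t\<bar>)"
        using a by (intro integral_deviation_bound[OF w b] \<delta>(2)) auto
      moreover have "integral {u..v} (\<lambda>t. \<bar>deriv \<phi> t\<bar>) = integral {u..x} (\<lambda>t. \<bar>deriv \<phi> t\<bar>) + integral {x..v} (\<lambda>t. \<bar>deriv \<phi> t\<bar>)"
        using a integral01_increment[OF aw, of u v] integral01_increment[OF aw, of u x] integral01_increment[OF aw, of x v] by simp
      then have "\<epsilon> * integral {u..v} (\<lambda>t. \<bar>deriv \<phi> t\<bar>) = \<epsilon> * integral {u..x} (\<lambda>t. \<bar>deriv \<phi> t\<bar>) + \<epsilon> * integral {x..v} (\<lambda>t. \<bar>deriv \<phi> t\<bar>)"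
        by (simp add: distrib_left)
      moreover have "\<phi> x * (b v - b u) - (F v - F u) =
          (integral {u..x} (\<lambda>t. b t * deriv \<phi> t) - b u * integral {u..x} (deriv \<phi>)) +
          (integral {x..v} (\<lambda>t. b t * deriv \<phi> t) - b v * integral {x..v} (deriv \<phi>))"
      proof -
        have i: "integral {u..x} (deriv \<phi>) = \<phi> x - \<phi> u" "integral {x..v} (deriv \<phi>) = \<phi> v - \<phi> x"
          using a inc by auto
        show ?thesis
          unfolding F_def i using a integral01_increment[OF bw, of u x] integral01_increment[OF bw, of x v]
          by (simp add: algebra_simps)
      qed
      ultimately show "\<bar>\<phi> x * (b v - b u) - (F v - F u)\<bar> \<le> \<epsilon> * integral {u..v} (\<lambda>t. \<bar>deriv \<phi> t\<bar>)"
        by linarith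
    qed
  qed
  then show ?thesis using assms(3,4) by (simp add: F_def)
qed

text \<open>Both sides evaluate the Stieltjes integral of \<open>g\<close> against the indefinite
  integral of \<open>w\<close>; uniqueness of the limit identifies them.\<close>

lemma integral_by_parts_abs_continuous01:
  assumes g: "abs_continuous01 g" "g 0 = 0" "g 1 = 0" and w: "w absolutely_integrable_on {0..1}"
  shows "integral {0..1} (\<lambda>x. g x * w x) = - integral {0..1} (\<lambda>x. integral {0..x} w * deriv g x)"
proof (rule has_stieltjes_integral_unique)
  show "has_stieltjes_integral g (\<lambda>x. integral {0..x} w) (integral {0..1} (\<lambda>t. g t * w t))"
    by (rule has_stieltjes_integral_indefinite[OF w abs_continuous01_continuous[OF g(1)]])
  have "continuous_on {0..1} (\<lambda>x. integral {0..x} w)"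
    using w by (intro indefinite_integral_continuous_1) (auto simp: absolutely_integrable_on_def)
  from has_stieltjes_integral_by_parts[OF g(1) this g(2,3)]
  show "has_stieltjes_integral g (\<lambda>x. integral {0..x} w) (- integral {0..1} (\<lambda>x. integral {0..x} w * deriv g x))" .
qed

section \<open>The operator as a first-order system\<close>

text \<open>\<open>L f = v\<close> as a first-order system for \<open>f\<close> and the quasi-derivative \<open>q = f' - b f\<close>, in integrated
  form: the distributional derivative of \<open>b\<close> no longer occurs in it.\<close>

definition quasi_solution :: "(real \<Rightarrow> real) \<Rightarrow> (real \<Rightarrow> 'a::euclidean_space) \<Rightarrow> (real \<Rightarrow> 'a) \<Rightarrow> (real \<Rightarrow> 'a) \<Rightarrow> bool" where
  "quasi_solution b v f q \<longleftrightarrow> continuous_on {0..1} f \<and> continuous_on {0..1} q \<and>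
    (\<forall>x\<in>{0..1}. f x = integral {0..x} (\<lambda>t. b t *\<^sub>R f t + q t)) \<and>
    (\<forall>x\<in>{0..1}. q x = q 0 - integral {0..x} (\<lambda>t. b t *\<^sub>R (b t *\<^sub>R f t + q t) + v t))"

lemma continuous01_absolutely_integrable:
  fixes h :: "real \<Rightarrow> real"
  assumes "continuous_on {0..1} h"
  shows "h absolutely_integrable_on {0..1}"
  using assms by (rule absolutely_integrable_continuous_real)

lemma H_spaceI_continuous:
  assumes "continuous_on {0..1} h" "h 0 = 0" "h 1 = 0"
  shows "h \<in> H_space"
proof -
  have "h \<in> borel_measurable leb01"
    using assms(1) by (intro continuous_imp_measurable_on_sets_lebesgue) auto
  moreover have "integrable leb01 (\<lambda>x. (h x)\<^sup>2)"
    using assms(1) by (intro continuous_imp_integrable_real continuous_intros)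
  ultimately show ?thesis using assms by (simp add: H_space_def)
qed

lemma H1_spaceI:
  assumes "abs_continuous01 h" "h 0 = 0" "h 1 = 0"
  shows "h \<in> H1_space"
  using assms H_spaceI_continuous[OF abs_continuous01_continuous] by (simp add: H1_space_def)

lemma H1_spaceD:
  assumes "h \<in> H1_space"
  shows "abs_continuous01 h" "h 0 = 0" "h 1 = 0"
  using assms by (auto simp: H1_space_def H_space_def)

lemma H_space_absolutely_integrable:
  assumes "v \<in> H_space"
  shows "v absolutely_integrable_on {0..1}"
proof (rule measurable_bounded_by_integrable_imp_absolutely_integrable[where g = "\<lambda>x. 1 + (v x)\<^sup>2"])
  show "v \<in> borel_measurable leb01" using assms by (simp add: H_space_def)
  have "(\<lambda>x. (v x)\<^sup>2) integrable_on {0..1}"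
    using assms by (intro integrable_on_lebesgue_on) (auto simp: H_space_def)
  then show "(\<lambda>x. 1 + (v x)\<^sup>2) integrable_on {0..1}"
    by (intro integrable_add integrable_const_ivl) auto
  \<comment> \<open>Expanding the square gives
    \<open>\<bar>v x\<bar> \<le> 1 + (v x)\<^sup>2\<close>, the integrable majorant chosen
    above.\<close>
  have "0 \<le> (\<bar>v x\<bar> - 1)\<^sup>2 + \<bar>v x\<bar>" for x by simp
  then show "norm (v x) \<le> 1 + (v x)\<^sup>2" for x
    by (simp add: power2_eq_square algebra_simps)
qed auto

text \<open>Integrating the noise term by parts leaves \<open>b\<close> undifferentiated. The two
  terms with a single derivative are always integrable, being a continuous function times an
  integrable one; only the product of both derivatives imposes a condition.\<close>

lemma L_form_iff:
  assumes f: "abs_continuous01 f" and g: "abs_continuous01 g" "g 0 = 0" "g 1 = 0"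
    and b: "continuous_on {0..1} b"
  shows "L_form b f g c \<longleftrightarrow> (\<lambda>x. deriv f x * deriv g x) absolutely_integrable_on {0..1} \<and>
    c = integral {0..1} (\<lambda>x. deriv f x * deriv g x) -
        (integral {0..1} (\<lambda>x. b x * g x * deriv f x) + integral {0..1} (\<lambda>x. b x * f x * deriv g x))"
proof -
  note fc = abs_continuous01_continuous[OF f] and gc = abs_continuous01_continuous[OF g(1)]
  note f' = abs_continuous01_deriv_absolutely_integrable[OF f]
    and g' = abs_continuous01_deriv_absolutely_integrable[OF g(1)]
  have i: "(\<lambda>x. b x * g x * deriv f x) absolutely_integrable_on {0..1}"
    "(\<lambda>x. b x * f x * deriv g x) absolutely_integrable_on {0..1}"
    using b fc gc by (auto intro!: absolutely_integrable_continuous_mult f' g' continuous_intros)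
  obtain N where N: "negligible N"
    "\<And>x. x \<in> {0..1} - N \<Longrightarrow> deriv (\<lambda>x. f x * g x) x = deriv f x * g x + f x * deriv g x"
    using abs_continuous01_deriv_mult_ae[OF f g(1)] by blast
  have "has_stieltjes_integral (\<lambda>x. f x * g x) b (- integral {0..1} (\<lambda>x. b x * deriv (\<lambda>x. f x * g x) x))"
    using g by (intro has_stieltjes_integral_by_parts abs_continuous01_mult f b) auto
  also have "integral {0..1} (\<lambda>x. b x * deriv (\<lambda>x. f x * g x) x) =
      integral {0..1} (\<lambda>x. b x * g x * deriv f x + b x * f x * deriv g x)"
    using N(1) by (rule integral_spike) (simp add: N(2) algebra_simps)
  also have "\<dots> = integral {0..1} (\<lambda>x. b x * g x * deriv f x) + integral {0..1} (\<lambda>x. b x * f x * deriv g x)"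
    using i by (intro Henstock_Kurzweil_Integration.integral_add) (auto simp: absolutely_integrable_on_def)
  finally have S: "has_stieltjes_integral (\<lambda>x. f x * g x) b
     (- (integral {0..1} (\<lambda>x. b x * g x * deriv f x) + integral {0..1} (\<lambda>x. b x * f x * deriv g x)))" .
  have uniq: "has_stieltjes_integral (\<lambda>x. f x * g x) b I \<longleftrightarrow>
      I = - (integral {0..1} (\<lambda>x. b x * g x * deriv f x) + integral {0..1} (\<lambda>x. b x * f x * deriv g x))" for I
    using S has_stieltjes_integral_unique by blast
  show ?thesis
  proof (cases "(\<lambda>x. deriv f x * deriv g x) absolutely_integrable_on {0..1}")
    case True
    show ?thesis
      unfolding L_form_def absolutely_integrable_on_iff_integrable01[symmetric] uniq lebesgue_integral01_eq[OF True]
      using True by auto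
  next
    case False
    then show ?thesis
      by (simp add: L_form_def absolutely_integrable_on_iff_integrable01)
  qed
qed

lemma inner01_eq:
  assumes "v absolutely_integrable_on {0..1}" "continuous_on {0..1} g"
  shows "inner01 v g = integral {0..1} (\<lambda>x. g x * v x)"
  unfolding inner01_def
  using lebesgue_integral01_eq[OF absolutely_integrable_continuous_mult[OF assms(2,1)]]
  by (simp add: mult.commute)

section \<open>Equivalence of the operator graph and the first-order system\<close>

lemma deriv_eq_if_indefinite_integral:
  fixes f u :: "real \<Rightarrow> real"
  assumes uc: "continuous_on {0..1} u" and fI: "\<And>x. x \<in> {0..1} \<Longrightarrow> f x = integral {0..x} u"
    and x: "x \<in> {0<..<1}"
  shows "deriv f x = u x"
proof -
  have "((\<lambda>x. integral {0..x} u) has_real_derivative u x) (at x within {0..1})"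
    using x by (intro integral_has_real_derivative uc) auto
  then have "(f has_real_derivative u x) (at x within {0..1})"
    by (rule has_field_derivative_transform_within[where d = 1]) (use x fI in auto)
  moreover have "at x within {0..1} = at x"
    using x by (intro at_within_interior) auto
  ultimately show ?thesis by (auto intro: DERIV_imp_deriv)
qed

text \<open>The function \<open>u = b f + q\<close> is the derivative of \<open>f\<close> and is
  continuous, so \<open>f\<close> is Lipschitz and its derivative times any integrable
  \<open>deriv g\<close> is integrable. Moving the derivative from \<open>q\<close> to
  \<open>g\<close> by parts reproduces the form, with the terms in \<open>b g u\<close>
  cancelling.\<close>

lemma L_graph_if_quasi_solution:
  assumes b: "continuous_on {0..1} b" and sol: "quasi_solution b v f q" and "f 1 = 0"
    and v: "v \<in> H_space"
  shows "L_graph b f v"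
proof -
  define u where "u t = b t * f t + q t" for t
  have ut: "b t *\<^sub>R f t + q t = u t" for t by (simp add: u_def)
  have fc: "continuous_on {0..1} f" and qc: "continuous_on {0..1} q"
    and fI: "\<And>x. x \<in> {0..1} \<Longrightarrow> f x = integral {0..x} u"
    and qI: "\<And>x. x \<in> {0..1} \<Longrightarrow> q x = q 0 - integral {0..x} (\<lambda>t. b t * u t + v t)"
    using sol unfolding quasi_solution_def ut unfolding real_scaleR_def by blast+
  have uc: "continuous_on {0..1} u"
    unfolding u_def using b fc qc by (intro continuous_intros)
  note va = H_space_absolutely_integrable[OF v]
  have "f 0 = 0" using fI[of 0] by simp
  have "bounded (u ` {0..1})"
    using uc by (intro compact_imp_bounded compact_continuous_image) auto
  then obtain C where C: "\<And>x. x \<in> {0..1} \<Longrightarrow> \<bar>u x\<bar> \<le> C"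
    unfolding bounded_iff image_iff Bex_def real_norm_def by blast
  have ui: "u integrable_on {0..1}"
    using uc by (rule integrable_continuous_real)
  have ac: "abs_continuous01 f"
  proof (rule Lipschitz_imp_abs_continuous01)
    fix x y :: real assume xy: "0 \<le> x" "x \<le> y" "y \<le> 1"
    have "f y - f x = integral {x..y} u"
      using integral01_increment[OF ui xy] fI[of x] fI[of y] xy by simp
    also have "\<bar>\<dots>\<bar> \<le> C * (y - x)"
      using integral_bound[of x y u C] xy C continuous_on_subset[OF uc, of "{x..y}"] by auto
    finally show "\<bar>f y - f x\<bar> \<le> C * (y - x)" .
  qed
  have f': "deriv f x = u x" if "x \<in> {0<..<1}" for x
    using uc fI that by (rule deriv_eq_if_indefinite_integral)
  have H1: "f \<in> H1_space"
    using ac \<open>f 0 = 0\<close> \<open>f 1 = 0\<close> by (rule H1_spaceI)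
  have "L_form b f g (inner01 v g)" if g: "g \<in> H1_space" for g
  proof -
    note G = H1_spaceD[OF g]
    note gc = abs_continuous01_continuous[OF G(1)] and g' = abs_continuous01_deriv_absolutely_integrable[OF G(1)]
    \<comment> \<open>The two-sided \<open>deriv\<close> is not controlled at the endpoints, which
      are therefore discarded as a null set.\<close>
    have neg: "negligible {0, 1::real}" by simp
    have A0: "(\<lambda>x. u x * deriv g x) absolutely_integrable_on {0..1}"
      by (rule absolutely_integrable_continuous_mult[OF uc g'])
    have ae: "deriv f x = u x" if "x \<in> {0..1} - {0, 1}" for x
      using f' that by auto
    have A: "(\<lambda>x. deriv f x * deriv g x) absolutely_integrable_on {0..1}"
      by (rule absolutely_integrable_spike[OF A0 neg]) (simp add: ae)
    have I1: "integral {0..1} (\<lambda>x. deriv f x * deriv g x) = integral {0..1} (\<lambda>x. u x * deriv g x)"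
      by (rule integral_spike[OF neg]) (simp add: ae)
    have I2: "integral {0..1} (\<lambda>x. b x * g x * deriv f x) = integral {0..1} (\<lambda>x. b x * g x * u x)"
      by (rule integral_spike[OF neg]) (simp add: ae)
    define w where "w x = - (b x * u x + v x)" for x
    have bu: "(\<lambda>x. b x * u x) absolutely_integrable_on {0..1}"
      using b uc by (intro continuous01_absolutely_integrable continuous_intros)
    have w: "w absolutely_integrable_on {0..1}"
      using bu va by (auto simp: w_def[abs_def] absolutely_integrable_on_iff_integrable01)
    have W: "integral {0..x} w = q x - q 0" if "x \<in> {0..1}" for x
      using qI[OF that] by (simp add: w_def[abs_def] del: minus_add_distrib)
    have "integral {0..1} (\<lambda>x. g x * w x) = - integral {0..1} (\<lambda>x. integral {0..x} w * deriv g x)"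
      by (rule integral_by_parts_abs_continuous01[OF G w])
    also have "integral {0..1} (\<lambda>x. integral {0..x} w * deriv g x) = integral {0..1} (\<lambda>x. q x * deriv g x - q 0 * deriv g x)"
      by (rule integral_cong) (simp add: W algebra_simps)
    also have "\<dots> = integral {0..1} (\<lambda>x. q x * deriv g x) - q 0 * integral {0..1} (deriv g)"
    proof -
      have "(\<lambda>x. q x * deriv g x) integrable_on {0..1}" "deriv g integrable_on {0..1}"
        using absolutely_integrable_continuous_mult[OF qc g'] g' by (auto simp: absolutely_integrable_on_def)
      from Henstock_Kurzweil_Integration.integral_diff[OF this(1) integrable_on_cmult_left[OF this(2), of "q 0"]]
      show ?thesis by simp
    qed
    \<comment> \<open>Both boundary values of \<open>g\<close> are 0, which removes the free
      constant \<open>q 0\<close>.\<close>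
    also have "integral {0..1} (deriv g) = 0"
      using abs_continuous01_has_integral_deriv[OF G(1), of 0 1] G by (auto intro: integral_unique)
    finally have P1: "integral {0..1} (\<lambda>x. g x * w x) = - integral {0..1} (\<lambda>x. q x * deriv g x)" by simp
    have i1: "(\<lambda>x. b x * g x * u x) integrable_on {0..1}"
      using b uc gc by (intro integrable_continuous_real continuous_intros)
    have i2: "(\<lambda>x. g x * v x) integrable_on {0..1}"
      using absolutely_integrable_continuous_mult[OF gc va] by (auto simp: absolutely_integrable_on_def)
    have "integral {0..1} (\<lambda>x. g x * w x) = integral {0..1} (\<lambda>x. - (b x * g x * u x) - g x * v x)"
      by (rule integral_cong) (simp add: w_def algebra_simps)
    also have "\<dots> = - integral {0..1} (\<lambda>x. b x * g x * u x) - integral {0..1} (\<lambda>x. g x * v x)"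
      using integrable_neg[OF i1] i2 by (subst Henstock_Kurzweil_Integration.integral_diff) auto
    finally have P2: "integral {0..1} (\<lambda>x. g x * w x) = - integral {0..1} (\<lambda>x. b x * g x * u x) - integral {0..1} (\<lambda>x. g x * v x)" .
    have j1: "(\<lambda>x. b x * f x * deriv g x) integrable_on {0..1}"
      using absolutely_integrable_continuous_mult[OF continuous_on_mult[OF b fc] g'] by (auto simp: absolutely_integrable_on_def)
    have j2: "(\<lambda>x. q x * deriv g x) integrable_on {0..1}"
      using absolutely_integrable_continuous_mult[OF qc g'] by (auto simp: absolutely_integrable_on_def)
    have "integral {0..1} (\<lambda>x. u x * deriv g x) = integral {0..1} (\<lambda>x. b x * f x * deriv g x + q x * deriv g x)"
      by (rule integral_cong) (simp add: u_def algebra_simps)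
    also have "\<dots> = integral {0..1} (\<lambda>x. b x * f x * deriv g x) + integral {0..1} (\<lambda>x. q x * deriv g x)"
      by (rule Henstock_Kurzweil_Integration.integral_add[OF j1 j2])
    finally have P3: "integral {0..1} (\<lambda>x. u x * deriv g x) = integral {0..1} (\<lambda>x. b x * f x * deriv g x) + integral {0..1} (\<lambda>x. q x * deriv g x)" .
    show ?thesis
      unfolding L_form_iff[OF ac G b] using A I1 I2 P1 P2 P3 inner01_eq[OF va gc] by simp
  qed
  with H1 v show ?thesis by (simp add: L_graph_def)
qed

text \<open>For \<open>s\<close> in the unit interval this tent is Green's kernel of the Dirichlet
  Laplacian. Its derivative is the indicator of the part left of \<open>s\<close> minus the mean
  \<open>s\<close> of that indicator, so integrating \<open>k\<close> against it compares the
  integral of \<open>k\<close> up to \<open>s\<close> with \<open>s\<close> times the total.\<close>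

lemma tent_deriv:
  fixes s x :: real
  assumes "x \<noteq> s"
  shows "deriv (\<lambda>x. min x s - s * x) x = (if x < s then 1 - s else - s)"
proof (cases "x < s")
  case True
  have "((\<lambda>y. (1 - s) * y) has_real_derivative (1 - s)) (at x)"
    by (auto intro!: derivative_eq_intros)
  then have "((\<lambda>x. min x s - s * x) has_real_derivative (1 - s)) (at x)"
    by (rule has_field_derivative_transform_within_open[of _ _ _ "{..<s}"]) (use True in \<open>auto simp: algebra_simps\<close>)
  with True show ?thesis by (simp add: DERIV_imp_deriv)
next
  case False
  have "((\<lambda>y. s - s * y) has_real_derivative (- s)) (at x)"
    by (auto intro!: derivative_eq_intros)
  then have "((\<lambda>x. min x s - s * x) has_real_derivative (- s)) (at x)"
    by (rule has_field_derivative_transform_within_open[of _ _ _ "{s<..}"]) (use False assms in \<open>auto simp: algebra_simps\<close>)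
  with False show ?thesis by (simp add: DERIV_imp_deriv)
qed

lemma tent_H1_space:
  assumes "s \<in> {0..1}"
  shows "(\<lambda>x. min x s - s * x) \<in> H1_space"
proof (rule H1_spaceI)
  show "abs_continuous01 (\<lambda>x. min x s - s * x)"
  proof (rule Lipschitz_imp_abs_continuous01[where C = 2])
    fix x y :: real assume "0 \<le> x" "x \<le> y" "y \<le> 1"
    then have "0 \<le> s * (y - x)" "s * (y - x) \<le> 1 * (y - x)" "\<bar>min y s - min x s\<bar> \<le> y - x"
      using assms mult_right_mono[of s 1 "y - x"] by auto
    then show "\<bar>min y s - s * y - (min x s - s * x)\<bar> \<le> 2 * (y - x)"
      by (simp add: right_diff_distrib)
  qed
qed (use assms in auto)

text \<open>A du Bois-Reymond argument. \<open>W\<close> is what the terms not containing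
  \<open>deriv g\<close> become after integration by parts, so the weak equation for a tent
  \<open>g\<close> says that \<open>k = f' - b f - W\<close> is orthogonal to
  \<open>deriv g\<close>. Hence \<open>k\<close> has the same integrals over initial segments as a
  constant \<open>c\<close>, and \<open>q = W + c\<close> is the quasi-derivative.\<close>

lemma quasi_solution_if_L_graph:
  assumes b: "continuous_on {0..1} b" and L: "L_graph b f v"
  shows "\<exists>q. quasi_solution b v f q"
proof -
  have f: "f \<in> H1_space" and v: "v \<in> H_space" and form: "\<And>g. g \<in> H1_space \<Longrightarrow> L_form b f g (inner01 v g)"
    using L by (auto simp: L_graph_def)
  note F = H1_spaceD[OF f]
  note fc = abs_continuous01_continuous[OF F(1)] and f' = abs_continuous01_deriv_absolutely_integrable[OF F(1)]
  note va = H_space_absolutely_integrable[OF v]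
  define w where "w x = - (b x * deriv f x + v x)" for x
  define W where "W x = integral {0..x} w" for x
  have bf': "(\<lambda>x. b x * deriv f x) absolutely_integrable_on {0..1}"
    by (rule absolutely_integrable_continuous_mult[OF b f'])
  have w: "w absolutely_integrable_on {0..1}"
    using bf' va by (auto simp: w_def[abs_def] absolutely_integrable_on_iff_integrable01)
  have Wc: "continuous_on {0..1} W"
    unfolding W_def using w by (intro indefinite_integral_continuous_1) (auto simp: absolutely_integrable_on_def)
  define k where "k x = deriv f x - (b x * f x + W x)" for x
  have bfW: "continuous_on {0..1} (\<lambda>x. b x * f x + W x)"
    using b fc Wc by (intro continuous_intros)
  have ki: "k integrable_on {0..1}"
    unfolding k_def using f' integrable_continuous_real[OF bfW]
    by (intro integrable_diff) (auto simp: absolutely_integrable_on_def)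
  define c where "c = integral {0..1} k"
  have key: "integral {0..s} k = s * c" if s: "s \<in> {0..1}" for s
  proof -
    define g where "g x = min x s - s * x" for x
    have g: "g \<in> H1_space" unfolding g_def by (rule tent_H1_space[OF s])
    note G = H1_spaceD[OF g]
    note gc = abs_continuous01_continuous[OF G(1)] and g' = abs_continuous01_deriv_absolutely_integrable[OF G(1)]
    have i0: "(\<lambda>x. deriv f x * deriv g x) integrable_on {0..1}"
      and e0: "inner01 v g = integral {0..1} (\<lambda>x. deriv f x * deriv g x) -
        (integral {0..1} (\<lambda>x. b x * g x * deriv f x) + integral {0..1} (\<lambda>x. b x * f x * deriv g x))"
      using form[OF g] unfolding L_form_iff[OF F(1) G b] by (auto simp: absolutely_integrable_on_def)
    have i1: "(\<lambda>x. b x * g x * deriv f x) integrable_on {0..1}"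
      using absolutely_integrable_continuous_mult[OF continuous_on_mult[OF b gc] f'] by (auto simp: absolutely_integrable_on_def)
    have i2: "(\<lambda>x. b x * f x * deriv g x) integrable_on {0..1}"
      using absolutely_integrable_continuous_mult[OF continuous_on_mult[OF b fc] g'] by (auto simp: absolutely_integrable_on_def)
    have i3: "(\<lambda>x. W x * deriv g x) integrable_on {0..1}"
      using absolutely_integrable_continuous_mult[OF Wc g'] by (auto simp: absolutely_integrable_on_def)
    have i4: "(\<lambda>x. g x * v x) integrable_on {0..1}"
      using absolutely_integrable_continuous_mult[OF gc va] by (auto simp: absolutely_integrable_on_def)
    have "integral {0..1} (\<lambda>x. g x * w x) = integral {0..1} (\<lambda>x. - (b x * g x * deriv f x) - g x * v x)"
      by (rule integral_cong) (simp add: w_def algebra_simps)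
    also have "\<dots> = - integral {0..1} (\<lambda>x. b x * g x * deriv f x) - integral {0..1} (\<lambda>x. g x * v x)"
      using integrable_neg[OF i1] i4 by (subst Henstock_Kurzweil_Integration.integral_diff) auto
    finally have e1: "integral {0..1} (\<lambda>x. W x * deriv g x) = integral {0..1} (\<lambda>x. b x * g x * deriv f x) + integral {0..1} (\<lambda>x. g x * v x)"
      using integral_by_parts_abs_continuous01[OF G w] by (simp add: W_def)
    have "integral {0..1} (\<lambda>x. k x * deriv g x) = integral {0..1} (\<lambda>x. deriv f x * deriv g x - (b x * f x * deriv g x + W x * deriv g x))"
      by (rule integral_cong) (simp add: k_def algebra_simps)
    also have "\<dots> = integral {0..1} (\<lambda>x. deriv f x * deriv g x) - (integral {0..1} (\<lambda>x. b x * f x * deriv g x) + integral {0..1} (\<lambda>x. W x * deriv g x))"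
      using i0 i2 i3 by (simp add: Henstock_Kurzweil_Integration.integral_diff Henstock_Kurzweil_Integration.integral_add integrable_add)
    also have "\<dots> = 0"
      using e0 e1 inner01_eq[OF va gc] by simp
    finally have zero: "integral {0..1} (\<lambda>x. k x * deriv g x) = 0" .
    have k1: "(k has_integral integral {0..s} k) {0..s}" and k2: "(k has_integral integral {s..1} k) {s..1}"
      using s by (auto intro!: integrable_integral integrable_on_subinterval[OF ki])
    have "((\<lambda>x. k x * deriv g x) has_integral (1 - s) * integral {0..s} k) {0..s}"
    proof (rule has_integral_spike[OF _ _ has_integral_mult_right[OF k1]])
      show "negligible {s}" by simp
    qed (use s in \<open>simp add: g_def[abs_def] tent_deriv\<close>)
    moreover have "((\<lambda>x. k x * deriv g x) has_integral (- s) * integral {s..1} k) {s..1}"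
    proof (rule has_integral_spike[OF _ _ has_integral_mult_right[OF k2]])
      show "negligible {s}" by simp
    qed (use s in \<open>simp add: g_def[abs_def] tent_deriv\<close>)
    ultimately have "((\<lambda>x. k x * deriv g x) has_integral (1 - s) * integral {0..s} k + (- s) * integral {s..1} k) {0..1}"
      using s by (intro has_integral_combine[where c = s]) auto
    then have "(1 - s) * integral {0..s} k + (- s) * integral {s..1} k = 0"
      using zero integral_unique by metis
    moreover have "c = integral {0..s} k + integral {s..1} k"
      unfolding c_def using s integral01_increment[OF ki, of s 1] by simp
    ultimately show ?thesis by (simp add: algebra_simps)
  qed
  define q where "q x = W x + c" for x
  have qc: "continuous_on {0..1} q" unfolding q_def by (intro continuous_intros Wc)
  define u where "u x = b x * f x + q x" for x
  have uc: "continuous_on {0..1} u" unfolding u_def by (intro continuous_intros b fc qc)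
  \<comment> \<open>The integrals of \<open>k - c\<close> over initial segments vanish, so
    subtracting \<open>k - c\<close> turns \<open>deriv f\<close> into the continuous
    \<open>u\<close> without any statement about single values of \<open>k\<close>.\<close>
  have fI: "f x = integral {0..x} u" if x: "x \<in> {0..1}" for x
  proof -
    have "(deriv f has_integral f x) {0..x}"
      using abs_continuous01_has_integral_deriv[OF F(1), of 0 x] x F(2) by simp
    moreover have "(k has_integral s * c) {0..s}" if "s \<in> {0..1}" for s
      using key[OF that] that integrable_integral[OF integrable_on_subinterval[OF ki, of 0 s]] by simp
    from this[OF x] have "((\<lambda>t. k t - c) has_integral x * c - x * c) {0..x}"
      using has_integral_const_real[of c 0 x] x by (intro has_integral_diff) auto
    ultimately have "((\<lambda>t. deriv f t - (k t - c)) has_integral f x - 0) {0..x}"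
      by (intro has_integral_diff) auto
    moreover have "(\<lambda>t. deriv f t - (k t - c)) = u"
      by (auto simp: k_def u_def q_def)
    ultimately show ?thesis by (simp add: integral_unique)
  qed
  have fu: "deriv f x = u x" if "x \<in> {0<..<1}" for x
    using uc fI that by (rule deriv_eq_if_indefinite_integral)
  \<comment> \<open>\<open>W\<close> was built from \<open>deriv f\<close>; this is now known to be
    \<open>u\<close> on the open interval, which brings the second equation into the required
    form.\<close>
  have qI: "q x = q 0 - integral {0..x} (\<lambda>t. b t * u t + v t)" if "x \<in> {0..1}" for x
  proof -
    have "integral {0..x} (\<lambda>t. b t * u t + v t) = integral {0..x} (\<lambda>t. - w t)"
    proof (rule integral_spike)
      show "negligible {0, 1::real}" by simp
      show "- w t = b t * u t + v t" if "t \<in> {0..x} - {0, 1}" for t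
        using that \<open>x \<in> {0..1}\<close> by (simp add: w_def fu)
    qed
    then show ?thesis by (simp add: q_def W_def)
  qed
  show ?thesis
  proof (rule exI[of _ q])
    have ut: "b t *\<^sub>R f t + q t = u t" for t by (simp add: u_def)
    show "quasi_solution b v f q"
      unfolding quasi_solution_def ut unfolding real_scaleR_def using fc qc fI qI by blast
  qed
qed

section \<open>Volterra equations and solutions of the system\<close>

text \<open>The weight \<open>exp (2 * K * x)\<close>, as in Bielecki's norm, makes integration with
  factor \<open>K\<close> a contraction by 1/2 on the whole interval. Gronwall's inequality and
  Picard iteration both rest on it.\<close>

lemma exp_weighted_integral_bound:
  fixes g :: "real \<Rightarrow> real"
  assumes K: "K > 0" and g: "continuous_on {0..1} g" and x: "x \<in> {0..1}"
    and le: "\<And>t. t \<in> {0..1} \<Longrightarrow> g t \<le> m * exp (2 * K * t)" and m: "0 \<le> m"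
  shows "K * integral {0..x} g \<le> m / 2 * exp (2 * K * x)"
proof -
  have ex: "((\<lambda>t. m * exp (2 * K * t)) has_integral (m / (2 * K) * exp (2 * K * x) - m / (2 * K) * exp (2 * K * 0))) {0..x}"
    using x K by (intro fundamental_theorem_of_calculus)
      (auto intro!: derivative_eq_intros simp: has_real_derivative_iff_has_vector_derivative[symmetric])
  have "integral {0..x} g \<le> integral {0..x} (\<lambda>t. m * exp (2 * K * t))"
    using x le by (intro integral_le integrable_continuous_real continuous_on_subset[OF g] has_integral_integrable[OF ex]) auto
  also have "\<dots> = m / (2 * K) * exp (2 * K * x) - m / (2 * K)"
    using integral_unique[OF ex] by simp
  also have "\<dots> \<le> m / (2 * K) * exp (2 * K * x)"
    using m K by simp
  finally have "K * integral {0..x} g \<le> K * (m / (2 * K) * exp (2 * K * x))"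
    using K by (intro mult_left_mono) auto
  also have "\<dots> = m / 2 * exp (2 * K * x)"
    using K by (simp add: field_simps)
  finally show ?thesis .
qed

text \<open>Where \<open>\<phi>\<close> divided by the exponential weight is maximal, the integral
  term is at most half of the left-hand side. Absorbing it leaves \<open>2 * a\<close>.\<close>

lemma gronwall01:
  fixes \<phi> :: "real \<Rightarrow> real"
  assumes K: "K > 0" and \<phi>: "continuous_on {0..1} \<phi>" "\<And>x. x \<in> {0..1} \<Longrightarrow> 0 \<le> \<phi> x" and a: "0 \<le> a"
    and le: "\<And>x. x \<in> {0..1} \<Longrightarrow> \<phi> x \<le> a + K * integral {0..x} \<phi>" and x: "x \<in> {0..1}"
  shows "\<phi> x \<le> 2 * a * exp (2 * K)"
proof -
  have "continuous_on {0..1} (\<lambda>x. exp (- (2 * K * x)) * \<phi> x)"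
    by (intro continuous_intros \<phi>)
  then obtain x0 where x0: "x0 \<in> {0..1}" "\<And>y. y \<in> {0..1} \<Longrightarrow> exp (- (2 * K * y)) * \<phi> y \<le> exp (- (2 * K * x0)) * \<phi> x0"
    using continuous_attains_sup[of "{0..1::real}" "\<lambda>x. exp (- (2 * K * x)) * \<phi> x"] by auto
  define m where "m = exp (- (2 * K * x0)) * \<phi> x0"
  have m0: "0 \<le> m" unfolding m_def using \<phi>(2)[OF x0(1)] by simp
  have le_m: "\<phi> t \<le> m * exp (2 * K * t)" if "t \<in> {0..1}" for t
    using x0(2)[OF that] unfolding m_def[symmetric] by (simp add: exp_minus field_simps)
  have eq: "\<phi> x0 = m * exp (2 * K * x0)"
    by (simp add: m_def exp_minus field_simps)
  have "\<phi> x0 \<le> a + m / 2 * exp (2 * K * x0)"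
    using le[OF x0(1)] exp_weighted_integral_bound[OF K \<phi>(1) x0(1) le_m m0] by linarith
  then have "m * exp (2 * K * x0) \<le> 2 * a"
    unfolding eq by (simp add: field_simps)
  moreover have "m * 1 \<le> m * exp (2 * K * x0)"
    using m0 K x0(1) by (intro mult_left_mono) auto
  ultimately have "m \<le> 2 * a" by simp
  have "\<phi> x \<le> m * exp (2 * K * x)" by (rule le_m[OF x])
  also have "\<dots> \<le> 2 * a * exp (2 * K)"
    using \<open>m \<le> 2 * a\<close> m0 K x by (intro mult_mono) auto
  finally show ?thesis .
qed

text \<open>Picard iteration without subdividing the interval: differences of successive iterates
  halve relative to the exponential weight. Keeping \<open>d\<close> outside \<open>F\<close> admits
  sources that are merely integrable, since these enter through their continuous indefinite
  integrals.\<close>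

lemma volterra_solution_exists:
  fixes F :: "real \<Rightarrow> 'a::euclidean_space \<Rightarrow> 'a"
  assumes K: "K > 0" and d: "continuous_on {0..1} d"
    and Fc: "\<And>y. continuous_on {0..1} y \<Longrightarrow> continuous_on {0..1} (\<lambda>t. F t (y t))"
    and lip: "\<And>t y z. t \<in> {0..1} \<Longrightarrow> norm (F t y - F t z) \<le> K * norm (y - z)"
  shows "\<exists>y. continuous_on {0..1} y \<and> (\<forall>x\<in>{0..1}. y x = d x + integral {0..x} (\<lambda>t. F t (y t)))"
proof -
  define P where "P y x = d x + integral {0..x} (\<lambda>t. F t (y t))" for y x
  have Pc: "continuous_on {0..1} (P y)" if "continuous_on {0..1} y" for y
    unfolding P_def using Fc[OF that]
    by (intro continuous_intros d indefinite_integral_continuous_1 integrable_continuous_real)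
  have Pdiff: "norm (P y x - P z x) \<le> K * integral {0..x} (\<lambda>t. norm (y t - z t))"
    if y: "continuous_on {0..1} y" and z: "continuous_on {0..1} z" and x: "x \<in> {0..1}" for y z x
  proof -
    have sub: "{0..x} \<subseteq> {0..1}" using x by auto
    have iy: "(\<lambda>t. F t (y t)) integrable_on {0..x}" and iz: "(\<lambda>t. F t (z t)) integrable_on {0..x}"
      using continuous_on_subset[OF Fc[OF y] sub] continuous_on_subset[OF Fc[OF z] sub]
      by (auto intro: integrable_continuous_real)
    have in_: "(\<lambda>t. norm (y t - z t)) integrable_on {0..x}"
      by (intro integrable_continuous_real continuous_intros continuous_on_subset[OF y sub] continuous_on_subset[OF z sub])
    have "P y x - P z x = integral {0..x} (\<lambda>t. F t (y t) - F t (z t))"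
      using Henstock_Kurzweil_Integration.integral_diff[OF iy iz] by (simp add: P_def)
    also have "norm \<dots> \<le> integral {0..x} (\<lambda>t. K * norm (y t - z t))"
      using lip sub integrable_on_cmult_left[OF in_, of K]
      by (intro integral_norm_bound_integral integrable_diff iy iz) auto
    finally show ?thesis by simp
  qed
  define Y where "Y n = (P ^^ n) d" for n
  have Y0: "Y 0 = d" and YS: "Y (Suc n) = P (Y n)" for n by (auto simp: Y_def)
  have Yc: "continuous_on {0..1} (Y n)" for n
    by (induction n) (auto simp: Y0 YS d intro: Pc)
  have "bounded ((\<lambda>x. Y 1 x - Y 0 x) ` {0..1})"
    by (intro compact_imp_bounded compact_continuous_image continuous_intros Yc) auto
  then obtain m where m: "\<And>x. x \<in> {0..1} \<Longrightarrow> norm (Y 1 x - Y 0 x) \<le> m"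
    unfolding bounded_iff image_iff Bex_def by blast
  have m0: "0 \<le> m" using order_trans[OF norm_ge_zero m[of 0]] by simp
  have step: "norm (Y (Suc n) x - Y n x) \<le> m / 2 ^ n * exp (2 * K * x)" if "x \<in> {0..1}" for n x
    using that
  proof (induction n arbitrary: x)
    case 0
    have "norm (Y 1 x - Y 0 x) * 1 \<le> m * exp (2 * K * x)"
      using m[OF 0] 0 K m0 by (intro mult_mono) auto
    then show ?case by simp
  next
    case (Suc n)
    have "norm (Y (Suc (Suc n)) x - Y (Suc n) x) \<le> K * integral {0..x} (\<lambda>t. norm (Y (Suc n) t - Y n t))"
      unfolding YS[of "Suc n"] using Pdiff[OF Yc[of "Suc n"] Yc[of n] Suc.prems] by (simp add: YS[of n])
    also have "\<dots> \<le> m / 2 ^ n / 2 * exp (2 * K * x)"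
      using Suc m0 by (intro exp_weighted_integral_bound K continuous_intros Yc) auto
    finally show ?case by (simp add: field_simps)
  qed
  define D where "D n x = Y (Suc n) x - Y n x" for n x
  \<comment> \<open>Replacing the weight by its maximum gives a geometric majorant independent of
    \<open>x\<close>, as the M-test requires.\<close>
  have Dle: "norm (D n x) \<le> m * exp (2 * K) * (1 / 2) ^ n" if "x \<in> {0..1}" for n x
  proof -
    have "m / 2 ^ n * exp (2 * K * x) \<le> m / 2 ^ n * exp (2 * K)"
      using that K m0 by (intro mult_left_mono) auto
    with step[OF that, of n] show ?thesis by (simp add: D_def power_divide field_simps)
  qed
  have sm: "summable (\<lambda>n. m * exp (2 * K) * (1 / 2) ^ n)"
    by (intro summable_mult summable_geometric) auto
  have ul: "uniform_limit {0..1} (\<lambda>n x. \<Sum>i<n. D i x) (\<lambda>x. suminf (\<lambda>i. D i x)) sequentially"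
    by (rule Weierstrass_m_test[OF _ sm]) (use Dle in auto)
  have partial: "(\<Sum>i<n. D i x) = Y n x - d x" for n x
    unfolding D_def using sum_lessThan_telescope[of "\<lambda>i. Y i x" n] by (simp add: Y0)
  define y where "y x = d x + suminf (\<lambda>i. D i x)" for x
  have lim: "uniform_limit {0..1} Y y sequentially"
  proof -
    have "uniform_limit {0..1} (\<lambda>n x. d x + (\<Sum>i<n. D i x)) (\<lambda>x. d x + suminf (\<lambda>i. D i x)) sequentially"
      by (intro uniform_limit_add ul uniform_limit_const)
    then show ?thesis unfolding partial by (simp add: y_def[abs_def])
  qed
  have yc: "continuous_on {0..1} y"
    by (rule uniform_limit_theorem[OF _ lim]) (use Yc in auto)
  have "y x = P y x" if x: "x \<in> {0..1}" for x
  proof -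
    have "(\<lambda>n. P (Y n) x) \<longlonglongrightarrow> P y x"
    proof (rule LIMSEQ_I)
      fix r :: real assume "r > 0"
      then have "r / (2 * K) > 0" using K by simp
      from uniform_limitD[OF lim this] obtain N where N: "\<And>n t. n \<ge> N \<Longrightarrow> t \<in> {0..1} \<Longrightarrow> dist (Y n t) (y t) < r / (2 * K)"
        unfolding eventually_sequentially by blast
      have "norm (P (Y n) x - P y x) < r" if "n \<ge> N" for n
      proof -
        have "norm (P (Y n) x - P y x) \<le> K * integral {0..x} (\<lambda>t. norm (Y n t - y t))"
          by (rule Pdiff[OF Yc yc x])
        also have "integral {0..x} (\<lambda>t. norm (Y n t - y t)) \<le> integral {0..x} (\<lambda>t. r / (2 * K))"
        proof (rule integral_le)
          have sub: "{0..x} \<subseteq> {0..1}" using x by auto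
          show "(\<lambda>t. norm (Y n t - y t)) integrable_on {0..x}"
            by (intro integrable_continuous_real continuous_intros continuous_on_subset[OF Yc sub] continuous_on_subset[OF yc sub])
          show "norm (Y n t - y t) \<le> r / (2 * K)" if "t \<in> {0..x}" for t
            using N[OF \<open>n \<ge> N\<close>, of t] that x by (auto simp: dist_norm intro: less_imp_le)
        qed auto
        also have "\<dots> = x * (r / (2 * K))" using x by simp
        also have "\<dots> \<le> 1 * (r / (2 * K))" using x \<open>r / (2 * K) > 0\<close> by (intro mult_right_mono) auto
        finally have "norm (P (Y n) x - P y x) \<le> r / 2" using K by (simp add: field_simps)
        with \<open>r > 0\<close> show ?thesis by simp
      qed
      then show "\<exists>no. \<forall>n\<ge>no. norm (P (Y n) x - P y x) < r" by blast
    qed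
    moreover have "(\<lambda>n. P (Y n) x) \<longlonglongrightarrow> y x"
      using LIMSEQ_Suc[OF tendsto_uniform_limitI[OF lim x]] by (simp add: YS)
    ultimately show ?thesis using LIMSEQ_unique by blast
  qed
  then show ?thesis
    using yc unfolding P_def by blast
qed

lemma quasi_solution_exists:
  fixes u :: "real \<Rightarrow> complex"
  assumes b: "continuous_on {0..1} b" and u: "u integrable_on {0..1}"
  shows "\<exists>f q. quasi_solution b (\<lambda>x. u x + \<mu> * f x) f q \<and> q 0 = q0"
proof -
  have "bounded (b ` {0..1})"
    using b by (intro compact_imp_bounded compact_continuous_image) auto
  then obtain B where B: "\<And>x. x \<in> {0..1} \<Longrightarrow> \<bar>b x\<bar> \<le> B"
    unfolding bounded_iff image_iff Bex_def real_norm_def by blast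
  have B0: "0 \<le> B" using B[of 0] by simp
  \<comment> \<open>The expression \<open>b f + q\<close> is bounded by \<open>1 + B\<close> times
    the norm of the pair. It occurs once alone and once multiplied by \<open>b\<close>, hence the
    second factor \<open>1 + B\<close>; \<open>norm \<mu>\<close> accounts for the spectral
    term.\<close>
  define K where "K = (1 + B) * (1 + B) + norm \<mu>"
  have K: "K > 0" using B0 by (simp add: K_def add_pos_nonneg)
  define F where "F t y = (b t *\<^sub>R fst y + snd y, - (b t *\<^sub>R (b t *\<^sub>R fst y + snd y)) - \<mu> * fst y)"
    for t and y :: "complex \<times> complex"
  define d where "d x = (0::complex, q0 - integral {0..x} u)" for x
  have "continuous_on {0..1} d"
    unfolding d_def by (intro continuous_intros indefinite_integral_continuous_1 u)
  moreover have Fc: "continuous_on {0..1} (\<lambda>t. F t (y t))" if "continuous_on {0..1} y" for y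
    unfolding F_def by (intro continuous_intros b that)
  moreover have "norm (F t y - F t z) \<le> K * norm (y - z)" if t: "t \<in> {0..1}" for t y z
  proof -
    define h where "h = y - z"
    have hle: "norm (fst h) \<le> norm h" "norm (snd h) \<le> norm h"
      by (metis norm_fst_le prod.collapse, metis norm_snd_le prod.collapse)
    have "F t y - F t z = F t h"
      by (simp add: F_def h_def algebra_simps)
    also have "norm (F t h) \<le> norm (b t *\<^sub>R fst h + snd h) + norm (- (b t *\<^sub>R (b t *\<^sub>R fst h + snd h)) - \<mu> * fst h)"
      unfolding F_def by (rule norm_Pair_le)
    also have "norm (- (b t *\<^sub>R (b t *\<^sub>R fst h + snd h)) - \<mu> * fst h) \<le> \<bar>b t\<bar> * norm (b t *\<^sub>R fst h + snd h) + norm \<mu> * norm (fst h)"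
      by (rule order_trans[OF norm_triangle_ineq4]) (simp add: norm_mult)
    also have "norm (b t *\<^sub>R fst h + snd h) + (\<bar>b t\<bar> * norm (b t *\<^sub>R fst h + snd h) + norm \<mu> * norm (fst h))
        = (1 + \<bar>b t\<bar>) * norm (b t *\<^sub>R fst h + snd h) + norm \<mu> * norm (fst h)"
      by (simp add: algebra_simps)
    also have "\<dots> \<le> (1 + B) * ((1 + B) * norm h) + norm \<mu> * norm h"
    proof (intro add_mono mult_mono)
      have "norm (b t *\<^sub>R fst h + snd h) \<le> \<bar>b t\<bar> * norm (fst h) + norm (snd h)"
        by (rule order_trans[OF norm_triangle_ineq]) simp
      also have "\<dots> \<le> B * norm h + norm h"
        using B[OF t] B0 hle by (intro add_mono mult_mono) auto
      finally show "norm (b t *\<^sub>R fst h + snd h) \<le> (1 + B) * norm h" by (simp add: algebra_simps)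
      show "norm (fst h) \<le> norm h" by (rule hle)
    qed (use B[OF t] B0 in auto)
    also have "\<dots> = K * norm h" by (simp add: K_def algebra_simps)
    finally show ?thesis by (simp add: h_def)
  qed
  ultimately obtain y where yc: "continuous_on {0..1} y"
    and yI: "\<And>x. x \<in> {0..1} \<Longrightarrow> y x = d x + integral {0..x} (\<lambda>t. F t (y t))"
    using volterra_solution_exists[of K d F] K by blast
  define f where "f x = fst (y x)" for x
  define q where "q x = snd (y x)" for x
  have fc: "continuous_on {0..1} f" and qc: "continuous_on {0..1} q"
    unfolding f_def q_def by (intro continuous_intros yc)+
  have Fi: "(\<lambda>t. F t (y t)) integrable_on {0..x}" if "x \<in> {0..1}" for x
    using that by (intro integrable_continuous_real continuous_on_subset[OF Fc[OF yc]]) auto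
  have fI: "f x = integral {0..x} (\<lambda>t. b t *\<^sub>R f t + q t)" if x: "x \<in> {0..1}" for x
  proof -
    have "f x = fst (integral {0..x} (\<lambda>t. F t (y t)))"
      unfolding f_def by (subst yI[OF x]) (simp add: d_def)
    also have "\<dots> = integral {0..x} (fst \<circ> (\<lambda>t. F t (y t)))"
      by (rule integral_linear[OF Fi[OF x] bounded_linear_fst, symmetric])
    finally show ?thesis by (simp add: o_def F_def f_def q_def)
  qed
  have q0: "q 0 = q0"
    unfolding q_def by (subst yI) (auto simp: d_def)
  have qI: "q x = q 0 - integral {0..x} (\<lambda>t. b t *\<^sub>R (b t *\<^sub>R f t + q t) + (u t + \<mu> * f t))" if x: "x \<in> {0..1}" for x
  proof -
    have ui: "u integrable_on {0..x}"
      using x by (intro integrable_on_subinterval[OF u]) auto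
    have "q x = q0 - integral {0..x} u + snd (integral {0..x} (\<lambda>t. F t (y t)))"
      unfolding q_def by (subst yI[OF x]) (simp add: d_def)
    also have "snd (integral {0..x} (\<lambda>t. F t (y t))) = integral {0..x} (snd \<circ> (\<lambda>t. F t (y t)))"
      by (rule integral_linear[OF Fi[OF x] bounded_linear_snd, symmetric])
    also have "q0 - integral {0..x} u + integral {0..x} (snd \<circ> (\<lambda>t. F t (y t))) =
        q0 - (integral {0..x} u - integral {0..x} (snd \<circ> (\<lambda>t. F t (y t))))"
      by simp
    also have "integral {0..x} u - integral {0..x} (snd \<circ> (\<lambda>t. F t (y t))) = integral {0..x} (\<lambda>t. u t - (snd \<circ> (\<lambda>t. F t (y t))) t)"
      by (rule Henstock_Kurzweil_Integration.integral_diff[OF ui integrable_linear[OF Fi[OF x] bounded_linear_snd], symmetric])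
    also have "(\<lambda>t. u t - (snd \<circ> (\<lambda>t. F t (y t))) t) = (\<lambda>t. b t *\<^sub>R (b t *\<^sub>R f t + q t) + (u t + \<mu> * f t))"
      by (auto simp: F_def f_def q_def algebra_simps)
    finally show ?thesis by (simp add: q0)
  qed
  have "quasi_solution b (\<lambda>x. u x + \<mu> * f x) f q"
    unfolding quasi_solution_def using fc qc fI qI by blast
  with q0 show ?thesis by blast
qed

text \<open>Gronwall's inequality for \<open>norm (f x) + norm (q x)\<close>. The bound is linear in
  the data and explicit in \<open>\<mu>\<close>, so this single estimate serves uniqueness, the
  resolvent bound and continuity in \<open>\<mu>\<close>.\<close>

lemma quasi_solution_bound:
  fixes u :: "real \<Rightarrow> complex"
  assumes b: "continuous_on {0..1} b" "\<And>t. t \<in> {0..1} \<Longrightarrow> \<bar>b t\<bar> \<le> B" and u: "u absolutely_integrable_on {0..1}"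
    and sol: "quasi_solution b (\<lambda>x. u x + \<mu> * f x) f q" and x: "x \<in> {0..1}"
  shows "norm (f x) + norm (q x) \<le>
    2 * (norm (q 0) + integral {0..1} (\<lambda>t. norm (u t))) * exp (2 * ((1 + B) * (1 + B) + norm \<mu>))"
proof -
  define K where "K = (1 + B) * (1 + B) + norm \<mu>"
  have B0: "0 \<le> B" using b(2)[of 0] by simp
  have K: "K > 0" using B0 by (simp add: K_def add_pos_nonneg)
  define U where "U = integral {0..1} (\<lambda>t. norm (u t))"
  have nu: "(\<lambda>t. norm (u t)) integrable_on {0..1}" and ui: "u integrable_on {0..1}"
    using u by (auto simp: absolutely_integrable_on_def)
  have U0: "0 \<le> U" unfolding U_def by (intro integral_nonneg nu) auto
  define \<phi> where "\<phi> x = norm (f x) + norm (q x)" for x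
  have fc: "continuous_on {0..1} f" and qc: "continuous_on {0..1} q"
    and fI: "\<And>x. x \<in> {0..1} \<Longrightarrow> f x = integral {0..x} (\<lambda>t. b t *\<^sub>R f t + q t)"
    and qI: "\<And>x. x \<in> {0..1} \<Longrightarrow> q x = q 0 - integral {0..x} (\<lambda>t. b t *\<^sub>R (b t *\<^sub>R f t + q t) + (u t + \<mu> * f t))"
    using sol unfolding quasi_solution_def by blast+
  have \<phi>c: "continuous_on {0..1} \<phi>" unfolding \<phi>_def by (intro continuous_intros fc qc)
  have "\<phi> x \<le> norm (q 0) + U + K * integral {0..x} \<phi>" if x: "x \<in> {0..1}" for x
  proof -
    have sub: "{0..x} \<subseteq> {0..1}" using x by auto
    note c = continuous_on_subset[OF fc sub] continuous_on_subset[OF qc sub] continuous_on_subset[OF b(1) sub]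
    have \<phi>i: "\<phi> integrable_on {0..x}"
      by (intro integrable_continuous_real continuous_on_subset[OF \<phi>c sub])
    have nux: "(\<lambda>t. norm (u t)) integrable_on {0..x}" and uix: "u integrable_on {0..x}"
      using x by (auto intro!: integrable_on_subinterval[OF nu] integrable_on_subinterval[OF ui])
    have p: "norm (b t *\<^sub>R f t + q t) \<le> (1 + B) * \<phi> t" if "t \<in> {0..x}" for t
    proof -
      have "norm (b t *\<^sub>R f t + q t) \<le> \<bar>b t\<bar> * norm (f t) + norm (q t)"
        by (rule order_trans[OF norm_triangle_ineq]) simp
      also have "\<dots> \<le> B * \<phi> t + \<phi> t"
        using b(2)[of t] that x B0 by (intro add_mono mult_mono) (auto simp: \<phi>_def)
      finally show ?thesis by (simp add: algebra_simps)
    qed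
    have "norm (f x) = norm (integral {0..x} (\<lambda>t. b t *\<^sub>R f t + q t))"
      using fI[OF x] by (rule arg_cong)
    also have "\<dots> \<le> integral {0..x} (\<lambda>t. (1 + B) * \<phi> t)"
    proof (rule integral_norm_bound_integral)
      show "(\<lambda>t. b t *\<^sub>R f t + q t) integrable_on {0..x}"
        by (intro integrable_continuous_real continuous_intros c)
      show "(\<lambda>t. (1 + B) * \<phi> t) integrable_on {0..x}"
        by (rule integrable_on_mult_right[OF \<phi>i])
    qed (rule p)
    finally have 1: "norm (f x) \<le> (1 + B) * integral {0..x} \<phi>" by simp
    have g: "(\<lambda>t. b t *\<^sub>R (b t *\<^sub>R f t + q t) + \<mu> * f t) integrable_on {0..x}"
      by (intro integrable_continuous_real continuous_intros c)
    have "norm (integral {0..x} (\<lambda>t. b t *\<^sub>R (b t *\<^sub>R f t + q t) + \<mu> * f t)) \<le> integral {0..x} (\<lambda>t. (B * (1 + B) + norm \<mu>) * \<phi> t)"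
    proof (rule integral_norm_bound_integral[OF g])
      show "(\<lambda>t. (B * (1 + B) + norm \<mu>) * \<phi> t) integrable_on {0..x}"
        using integrable_on_cmult_left[OF \<phi>i, of "B * (1 + B) + norm \<mu>"] by simp
      fix t assume t: "t \<in> {0..x}"
      have "norm (b t *\<^sub>R (b t *\<^sub>R f t + q t) + \<mu> * f t) \<le> \<bar>b t\<bar> * norm (b t *\<^sub>R f t + q t) + norm \<mu> * norm (f t)"
        by (rule order_trans[OF norm_triangle_ineq]) (simp add: norm_mult)
      also have "\<dots> \<le> B * ((1 + B) * \<phi> t) + norm \<mu> * \<phi> t"
        using b(2)[of t] t x B0 p[OF t] by (intro add_mono mult_mono) (auto simp: \<phi>_def)
      finally show "norm (b t *\<^sub>R (b t *\<^sub>R f t + q t) + \<mu> * f t) \<le> (B * (1 + B) + norm \<mu>) * \<phi> t"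
        by (simp add: algebra_simps)
    qed
    then have 2: "norm (integral {0..x} (\<lambda>t. b t *\<^sub>R (b t *\<^sub>R f t + q t) + \<mu> * f t)) \<le> (B * (1 + B) + norm \<mu>) * integral {0..x} \<phi>"
      by simp
    have "norm (integral {0..x} u) \<le> integral {0..x} (\<lambda>t. norm (u t))"
      using uix nux by (intro integral_norm_bound_integral) auto
    also have "\<dots> \<le> U"
      unfolding U_def using sub nux nu by (intro integral_subset_le) auto
    finally have 3: "norm (integral {0..x} u) \<le> U" .
    have "integral {0..x} (\<lambda>t. b t *\<^sub>R (b t *\<^sub>R f t + q t) + (u t + \<mu> * f t)) =
        integral {0..x} (\<lambda>t. (b t *\<^sub>R (b t *\<^sub>R f t + q t) + \<mu> * f t) + u t)"
      by (rule integral_cong) (simp add: algebra_simps)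
    also have "\<dots> = integral {0..x} (\<lambda>t. b t *\<^sub>R (b t *\<^sub>R f t + q t) + \<mu> * f t) + integral {0..x} u"
      by (rule Henstock_Kurzweil_Integration.integral_add[OF g uix])
    finally have "q x = q 0 - (integral {0..x} (\<lambda>t. b t *\<^sub>R (b t *\<^sub>R f t + q t) + \<mu> * f t) + integral {0..x} u)"
      using qI[OF x] by simp
    then have "norm (q x) = norm (q 0 - (integral {0..x} (\<lambda>t. b t *\<^sub>R (b t *\<^sub>R f t + q t) + \<mu> * f t) + integral {0..x} u))"
      by (rule arg_cong)
    then have "norm (q x) \<le> norm (q 0) + (norm (integral {0..x} (\<lambda>t. b t *\<^sub>R (b t *\<^sub>R f t + q t) + \<mu> * f t)) + norm (integral {0..x} u))"
      using norm_triangle_ineq4[of "q 0" "integral {0..x} (\<lambda>t. b t *\<^sub>R (b t *\<^sub>R f t + q t) + \<mu> * f t) + integral {0..x} u"]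
        norm_triangle_ineq[of "integral {0..x} (\<lambda>t. b t *\<^sub>R (b t *\<^sub>R f t + q t) + \<mu> * f t)" "integral {0..x} u"]
      by linarith
    with 2 3 have "norm (q x) \<le> norm (q 0) + U + (B * (1 + B) + norm \<mu>) * integral {0..x} \<phi>"
      by linarith
    with 1 show ?thesis
      unfolding \<phi>_def[of x] K_def by (simp add: algebra_simps)
  qed
  from gronwall01[OF K \<phi>c _ _ this x] U0 show ?thesis
    by (simp add: \<phi>_def K_def U_def)
qed

lemma quasi_solution_lincomb:
  fixes v v' f f' q q' :: "real \<Rightarrow> complex"
  assumes b: "continuous_on {0..1} b"
    and sol: "quasi_solution b v f q" "quasi_solution b v' f' q'"
    and v: "v integrable_on {0..1}" "v' integrable_on {0..1}"
  shows "quasi_solution b (\<lambda>x. v x + c * v' x) (\<lambda>x. f x + c * f' x) (\<lambda>x. q x + c * q' x)"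
proof -
  have fc: "continuous_on {0..1} f" and qc: "continuous_on {0..1} q"
    and fI: "\<And>x. x \<in> {0..1} \<Longrightarrow> f x = integral {0..x} (\<lambda>t. b t *\<^sub>R f t + q t)"
    and qI: "\<And>x. x \<in> {0..1} \<Longrightarrow> q x = q 0 - integral {0..x} (\<lambda>t. b t *\<^sub>R (b t *\<^sub>R f t + q t) + v t)"
    using sol(1) unfolding quasi_solution_def by blast+
  have fc': "continuous_on {0..1} f'" and qc': "continuous_on {0..1} q'"
    and fI': "\<And>x. x \<in> {0..1} \<Longrightarrow> f' x = integral {0..x} (\<lambda>t. b t *\<^sub>R f' t + q' t)"
    and qI': "\<And>x. x \<in> {0..1} \<Longrightarrow> q' x = q' 0 - integral {0..x} (\<lambda>t. b t *\<^sub>R (b t *\<^sub>R f' t + q' t) + v' t)"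
    using sol(2) unfolding quasi_solution_def by blast+
  have comb: "integral {0..x} g + c * integral {0..x} g' = integral {0..x} (\<lambda>t. g t + c * g' t)"
    if "g integrable_on {0..x}" "g' integrable_on {0..x}" for g g' :: "real \<Rightarrow> complex" and x
    using that integrable_on_mult_right[OF that(2), of c]
    by (subst Henstock_Kurzweil_Integration.integral_add) auto
  have f: "f x + c * f' x = integral {0..x} (\<lambda>t. b t *\<^sub>R (f t + c * f' t) + (q t + c * q' t))" if x: "x \<in> {0..1}" for x
  proof -
    have sub: "{0..x} \<subseteq> {0..1}" using x by auto
    note s = continuous_on_subset[OF _ sub]
    have "f x + c * f' x = integral {0..x} (\<lambda>t. b t *\<^sub>R f t + q t) + c * integral {0..x} (\<lambda>t. b t *\<^sub>R f' t + q' t)"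
      using fI[OF x] fI'[OF x] by simp
    also have "\<dots> = integral {0..x} (\<lambda>t. (b t *\<^sub>R f t + q t) + c * (b t *\<^sub>R f' t + q' t))"
      by (intro comb integrable_continuous_real continuous_intros s[OF b] s[OF fc] s[OF qc] s[OF fc'] s[OF qc'])
    also have "(\<lambda>t. (b t *\<^sub>R f t + q t) + c * (b t *\<^sub>R f' t + q' t)) = (\<lambda>t. b t *\<^sub>R (f t + c * f' t) + (q t + c * q' t))"
      by (auto simp: algebra_simps)
    finally show ?thesis .
  qed
  have q: "q x + c * q' x = q 0 + c * q' 0 -
      integral {0..x} (\<lambda>t. b t *\<^sub>R (b t *\<^sub>R (f t + c * f' t) + (q t + c * q' t)) + (v t + c * v' t))" if x: "x \<in> {0..1}" for x
  proof -
    have sub: "{0..x} \<subseteq> {0..1}" using x by auto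
    note s = continuous_on_subset[OF _ sub]
    have vi: "v integrable_on {0..x}" "v' integrable_on {0..x}"
      using sub by (auto intro: integrable_on_subinterval[OF v(1)] integrable_on_subinterval[OF v(2)])
    have "q x + c * q' x = q 0 + c * q' 0 - (integral {0..x} (\<lambda>t. b t *\<^sub>R (b t *\<^sub>R f t + q t) + v t) +
        c * integral {0..x} (\<lambda>t. b t *\<^sub>R (b t *\<^sub>R f' t + q' t) + v' t))"
      by (subst qI[OF x], subst qI'[OF x]) (simp add: right_diff_distrib)
    also have "integral {0..x} (\<lambda>t. b t *\<^sub>R (b t *\<^sub>R f t + q t) + v t) +
        c * integral {0..x} (\<lambda>t. b t *\<^sub>R (b t *\<^sub>R f' t + q' t) + v' t) =
        integral {0..x} (\<lambda>t. (b t *\<^sub>R (b t *\<^sub>R f t + q t) + v t) + c * (b t *\<^sub>R (b t *\<^sub>R f' t + q' t) + v' t))"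
      by (intro comb integrable_add vi integrable_continuous_real continuous_intros s[OF b] s[OF fc] s[OF qc] s[OF fc'] s[OF qc'])
    also have "(\<lambda>t. (b t *\<^sub>R (b t *\<^sub>R f t + q t) + v t) + c * (b t *\<^sub>R (b t *\<^sub>R f' t + q' t) + v' t)) =
        (\<lambda>t. b t *\<^sub>R (b t *\<^sub>R (f t + c * f' t) + (q t + c * q' t)) + (v t + c * v' t))"
      by (auto simp: algebra_simps)
    finally show ?thesis .
  qed
  show ?thesis
    unfolding quasi_solution_def using f q by (intro conjI ballI continuous_intros fc qc fc' qc') blast+
qed

text \<open>Because \<open>b\<close> is real, every real-linear functional commutes with the system.
  Multiplication by a complex \<open>\<mu>\<close>, which would mix the two parts, stays hidden
  inside \<open>v\<close>.\<close>

lemma quasi_solution_Re_Im: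
  fixes v f q :: "real \<Rightarrow> complex"
  assumes b: "continuous_on {0..1} b" and sol: "quasi_solution b v f q" and v: "v integrable_on {0..1}"
  shows "quasi_solution b (\<lambda>x. Re (v x)) (\<lambda>x. Re (f x)) (\<lambda>x. Re (q x))"
    and "quasi_solution b (\<lambda>x. Im (v x)) (\<lambda>x. Im (f x)) (\<lambda>x. Im (q x))"
proof -
  have fc: "continuous_on {0..1} f" and qc: "continuous_on {0..1} q"
    and fI: "\<And>x. x \<in> {0..1} \<Longrightarrow> f x = integral {0..x} (\<lambda>t. b t *\<^sub>R f t + q t)"
    and qI: "\<And>x. x \<in> {0..1} \<Longrightarrow> q x = q 0 - integral {0..x} (\<lambda>t. b t *\<^sub>R (b t *\<^sub>R f t + q t) + v t)"
    using sol unfolding quasi_solution_def by blast+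
  have i1: "(\<lambda>t. b t *\<^sub>R f t + q t) integrable_on {0..x}" and i2: "(\<lambda>t. b t *\<^sub>R (b t *\<^sub>R f t + q t) + v t) integrable_on {0..x}"
    if x: "x \<in> {0..1}" for x
  proof -
    have sub: "{0..x} \<subseteq> {0..1}" using x by auto
    note s = continuous_on_subset[OF _ sub]
    show "(\<lambda>t. b t *\<^sub>R f t + q t) integrable_on {0..x}"
      by (intro integrable_continuous_real continuous_intros s[OF b] s[OF fc] s[OF qc])
    show "(\<lambda>t. b t *\<^sub>R (b t *\<^sub>R f t + q t) + v t) integrable_on {0..x}"
      by (intro integrable_add integrable_on_subinterval[OF v sub] integrable_continuous_real continuous_intros s[OF b] s[OF fc] s[OF qc])
  qed
  have *: "quasi_solution b (\<lambda>x. h (v x)) (\<lambda>x. h (f x)) (\<lambda>x. h (q x))"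
    if h: "bounded_linear h" for h :: "complex \<Rightarrow> real"
  proof -
    interpret bounded_linear h by (rule h)
    have "h (f x) = integral {0..x} (\<lambda>t. b t *\<^sub>R h (f t) + h (q t))" if x: "x \<in> {0..1}" for x
    proof -
      have "h (f x) = h (integral {0..x} (\<lambda>t. b t *\<^sub>R f t + q t))" using fI[OF x] by (rule arg_cong)
      also have "\<dots> = integral {0..x} (h \<circ> (\<lambda>t. b t *\<^sub>R f t + q t))"
        by (rule integral_linear[OF i1[OF x] h, symmetric])
      finally show ?thesis by (simp add: o_def add scaleR)
    qed
    moreover have "h (q x) = h (q 0) - integral {0..x} (\<lambda>t. b t *\<^sub>R (b t *\<^sub>R h (f t) + h (q t)) + h (v t))" if x: "x \<in> {0..1}" for x
    proof -
      have "h (q x) = h (q 0) - h (integral {0..x} (\<lambda>t. b t *\<^sub>R (b t *\<^sub>R f t + q t) + v t))"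
        using arg_cong[OF qI[OF x], of h] by (simp only: diff)
      also have "h (integral {0..x} (\<lambda>t. b t *\<^sub>R (b t *\<^sub>R f t + q t) + v t)) = integral {0..x} (h \<circ> (\<lambda>t. b t *\<^sub>R (b t *\<^sub>R f t + q t) + v t))"
        by (rule integral_linear[OF i2[OF x] h, symmetric])
      finally show ?thesis by (simp add: o_def add scaleR)
    qed
    ultimately show ?thesis
      unfolding quasi_solution_def by (intro conjI ballI continuous_on fc qc) blast+
  qed
  from *[OF bounded_linear_Re] *[OF bounded_linear_Im]
  show "quasi_solution b (\<lambda>x. Re (v x)) (\<lambda>x. Re (f x)) (\<lambda>x. Re (q x))"
    and "quasi_solution b (\<lambda>x. Im (v x)) (\<lambda>x. Im (f x)) (\<lambda>x. Im (q x))" .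
qed

lemma quasi_solution_Complex:
  fixes v f :: "real \<Rightarrow> complex"
  assumes b: "continuous_on {0..1} b" and v: "v integrable_on {0..1}"
    and re: "quasi_solution b (\<lambda>x. Re (v x)) (\<lambda>x. Re (f x)) q1"
    and im: "quasi_solution b (\<lambda>x. Im (v x)) (\<lambda>x. Im (f x)) q2"
  shows "quasi_solution b v f (\<lambda>x. Complex (q1 x) (q2 x))"
proof -
  have Rc: "continuous_on {0..1} (\<lambda>x. Re (f x))" "continuous_on {0..1} q1"
    and RI: "\<And>x. x \<in> {0..1} \<Longrightarrow> Re (f x) = integral {0..x} (\<lambda>t. b t *\<^sub>R Re (f t) + q1 t)"
      "\<And>x. x \<in> {0..1} \<Longrightarrow> q1 x = q1 0 - integral {0..x} (\<lambda>t. b t *\<^sub>R (b t *\<^sub>R Re (f t) + q1 t) + Re (v t))"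
    using re unfolding quasi_solution_def by blast+
  have Ic: "continuous_on {0..1} (\<lambda>x. Im (f x))" "continuous_on {0..1} q2"
    and II: "\<And>x. x \<in> {0..1} \<Longrightarrow> Im (f x) = integral {0..x} (\<lambda>t. b t *\<^sub>R Im (f t) + q2 t)"
      "\<And>x. x \<in> {0..1} \<Longrightarrow> q2 x = q2 0 - integral {0..x} (\<lambda>t. b t *\<^sub>R (b t *\<^sub>R Im (f t) + q2 t) + Im (v t))"
    using im unfolding quasi_solution_def by blast+
  have fc: "continuous_on {0..1} f"
    using continuous_on_Complex[OF Rc(1) Ic(1)] by simp
  define q where "q x = Complex (q1 x) (q2 x)" for x
  have qc: "continuous_on {0..1} q"
    unfolding q_def by (rule continuous_on_Complex[OF Rc(2) Ic(2)])
  have parts: "Re (integral {0..x} g) = integral {0..x} (\<lambda>t. Re (g t))" "Im (integral {0..x} g) = integral {0..x} (\<lambda>t. Im (g t))"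
    if "g integrable_on {0..x}" for g :: "real \<Rightarrow> complex" and x
    using integral_linear[OF that bounded_linear_Re] integral_linear[OF that bounded_linear_Im] by (auto simp: o_def)
  have fI: "f x = integral {0..x} (\<lambda>t. b t *\<^sub>R f t + q t)" if x: "x \<in> {0..1}" for x
  proof -
    have sub: "{0..x} \<subseteq> {0..1}" using x by auto
    note s = continuous_on_subset[OF _ sub]
    have "(\<lambda>t. b t *\<^sub>R f t + q t) integrable_on {0..x}"
      by (intro integrable_continuous_real continuous_intros s[OF b] s[OF fc] s[OF qc])
    from parts[OF this] RI(1)[OF x] II(1)[OF x] show ?thesis
      by (simp add: complex_eq_iff q_def)
  qed
  have qI: "q x = q 0 - integral {0..x} (\<lambda>t. b t *\<^sub>R (b t *\<^sub>R f t + q t) + v t)" if x: "x \<in> {0..1}" for x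
  proof -
    have sub: "{0..x} \<subseteq> {0..1}" using x by auto
    note s = continuous_on_subset[OF _ sub]
    have "(\<lambda>t. b t *\<^sub>R (b t *\<^sub>R f t + q t) + v t) integrable_on {0..x}"
      by (intro integrable_add integrable_on_subinterval[OF v sub] integrable_continuous_real continuous_intros s[OF b] s[OF fc] s[OF qc])
    from parts[OF this] RI(2)[OF x] II(2)[OF x] show ?thesis
      by (simp add: complex_eq_iff q_def)
  qed
  show ?thesis
    unfolding quasi_solution_def q_def[symmetric] using fc qc fI qI by blast
qed

section \<open>The spectrum\<close>

lemma HC_space_absolutely_integrable:
  assumes "u \<in> HC_space"
  shows "u absolutely_integrable_on {0..1}"
proof (rule absolutely_integrable_componentwise)
  fix i :: complex assume "i \<in> Basis"
  then show "(\<lambda>x. u x \<bullet> i) absolutely_integrable_on {0..1}"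
    using assms H_space_absolutely_integrable[of "\<lambda>x. Re (u x)"] H_space_absolutely_integrable[of "\<lambda>x. Im (u x)"]
    by (auto simp: HC_space_def Basis_complex_def)
qed

lemma H_space_add:
  assumes "g \<in> H_space" "h \<in> H_space"
  shows "(\<lambda>x. g x + h x) \<in> H_space"
proof -
  have m: "g \<in> borel_measurable leb01" "h \<in> borel_measurable leb01"
    and i: "integrable leb01 (\<lambda>x. (g x)\<^sup>2)" "integrable leb01 (\<lambda>x. (h x)\<^sup>2)"
    using assms by (auto simp: H_space_def)
  have "integrable leb01 (\<lambda>x. (g x + h x)\<^sup>2)"
  proof (rule Bochner_Integration.integrable_bound)
    show "integrable leb01 (\<lambda>x. 2 * (g x)\<^sup>2 + 2 * (h x)\<^sup>2)"
      using i by auto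
    show "(\<lambda>x. (g x + h x)\<^sup>2) \<in> borel_measurable leb01"
      using m by measurable
    have "(g x + h x)\<^sup>2 \<le> 2 * (g x)\<^sup>2 + 2 * (h x)\<^sup>2" for x
      using zero_le_power2[of "g x - h x"] by (simp add: power2_eq_square algebra_simps)
    then show "AE x in leb01. norm ((g x + h x)\<^sup>2) \<le> norm (2 * (g x)\<^sup>2 + 2 * (h x)\<^sup>2)"
      by (intro AE_I2) simp
  qed
  with assms m show ?thesis by (auto simp: H_space_def)
qed

lemma measure_leb01 [simp]: "measure leb01 {0..1} = 1"
  by (simp add: measure_restrict_space)

lemma integral_norm_le_normC01:
  assumes "u \<in> HC_space"
  shows "integral {0..1} (\<lambda>t. norm (u t)) \<le> normC01 u"
proof -
  have i1: "integrable leb01 (\<lambda>x. norm (u x))"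
    using absolutely_integrable_norm[OF HC_space_absolutely_integrable[OF assms]]
    by (simp add: o_def absolutely_integrable_on_iff_integrable01)
  have i2: "integrable leb01 (\<lambda>x. (norm (u x))\<^sup>2)"
    using assms by (auto simp: HC_space_def H_space_def cmod_power2)
  interpret finite_measure leb01
    by (rule finite_measure_lebesgue_on) auto
  define N where "N = (\<integral>x. norm (u x) \<partial>leb01)"
  \<comment> \<open>Nonnegativity of a variance: as \<open>leb01\<close> has total mass 1, this is
    the Cauchy-Schwarz inequality against the constant 1.\<close>
  have "0 \<le> (\<integral>x. (norm (u x) - N)\<^sup>2 \<partial>leb01)"
    by (rule integral_nonneg_AE) auto
  also have "\<dots> = (\<integral>x. (norm (u x))\<^sup>2 - 2 * N * norm (u x) + N\<^sup>2 \<partial>leb01)"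
    by (rule Bochner_Integration.integral_cong) (auto simp: power2_diff algebra_simps)
  also have "\<dots> = (\<integral>x. (norm (u x))\<^sup>2 \<partial>leb01) - 2 * N * N + N\<^sup>2"
    using i1 i2 by (simp add: N_def)
  finally have "N\<^sup>2 \<le> (\<integral>x. (norm (u x))\<^sup>2 \<partial>leb01)"
    by (simp add: power2_eq_square)
  then have "N \<le> normC01 u"
    unfolding normC01_def by (rule real_le_rsqrt)
  moreover have "N = integral {0..1} (\<lambda>t. norm (u t))"
    unfolding N_def using i1 by (intro lebesgue_integral01_eq) (simp add: absolutely_integrable_on_iff_integrable01)
  ultimately show ?thesis by simp
qed

lemma normC01_le_bound:
  assumes f: "continuous_on {0..1} f" and S: "\<And>x. x \<in> {0..1} \<Longrightarrow> norm (f x) \<le> S"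
  shows "normC01 f \<le> S"
proof -
  have S0: "0 \<le> S" using order_trans[OF norm_ge_zero S[of 0]] by simp
  have "integrable leb01 (\<lambda>x. (norm (f x))\<^sup>2)"
    using f by (intro continuous_imp_integrable_real continuous_intros)
  then have "(\<integral>x. (norm (f x))\<^sup>2 \<partial>leb01) = integral {0..1} (\<lambda>x. (norm (f x))\<^sup>2)"
    by (intro lebesgue_integral_eq_integral) auto
  also have "\<dots> \<le> integral {0..1::real} (\<lambda>x. S\<^sup>2)"
    using S by (intro integral_le integrable_continuous_real continuous_intros f power_mono) auto
  finally have "(\<integral>x. (norm (f x))\<^sup>2 \<partial>leb01) \<le> S\<^sup>2" by simp
  then show ?thesis
    unfolding normC01_def using S0 by (simp add: real_le_lsqrt real_sqrt_le_iff sqrt_le_D)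
qed

lemma L_graph_symmetric:
  assumes "L_graph b f v" "L_graph b g w"
  shows "inner01 v g = inner01 w f"
proof -
  have "L_form b f g (inner01 v g)" "L_form b g f (inner01 w f)"
    using assms by (auto simp: L_graph_def)
  then obtain I J where
    "has_stieltjes_integral (\<lambda>x. f x * g x) b I" "inner01 v g = (\<integral>x. deriv f x * deriv g x \<partial>leb01) + I"
    "has_stieltjes_integral (\<lambda>x. g x * f x) b J" "inner01 w f = (\<integral>x. deriv g x * deriv f x \<partial>leb01) + J"
    unfolding L_form_def by blast
  then show ?thesis
    using has_stieltjes_integral_unique[of "\<lambda>x. f x * g x" b I J] by (simp add: mult.commute)
qed

lemma LC_shift_graph_if_quasi_solution:
  assumes b: "continuous_on {0..1} b" and u: "u \<in> HC_space"
    and sol: "quasi_solution b (\<lambda>x. u x + \<mu> * f x) f q" and "f 1 = 0"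
  shows "LC_shift_graph b \<mu> f u"
proof -
  have fc: "continuous_on {0..1} f" and "f 0 = 0"
    using sol unfolding quasi_solution_def by auto
  have i: "(\<lambda>x. u x + \<mu> * f x) integrable_on {0..1}"
  proof (rule integrable_add)
    show "u integrable_on {0..1}"
      using HC_space_absolutely_integrable[OF u] by (auto simp: absolutely_integrable_on_def)
    show "(\<lambda>x. \<mu> * f x) integrable_on {0..1}"
      by (intro integrable_continuous_real continuous_intros fc)
  qed
  \<comment> \<open>\<open>L_graph\<close> also wants the right-hand side in \<open>H_space\<close>,
    including its zero boundary values; here they come from those of \<open>u\<close> and of
    \<open>f\<close>.\<close>
  have "(\<lambda>x. Re (u x) + Re (\<mu> * f x)) \<in> H_space" "(\<lambda>x. Im (u x) + Im (\<mu> * f x)) \<in> H_space"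
    using u \<open>f 0 = 0\<close> \<open>f 1 = 0\<close> unfolding HC_space_def
    by (auto intro!: H_space_add H_spaceI_continuous continuous_intros fc simp del: times_complex.sel)
  then show ?thesis
    unfolding LC_shift_graph_def LC_graph_def using quasi_solution_Re_Im[OF b sol i] \<open>f 1 = 0\<close>
    by (auto intro!: L_graph_if_quasi_solution[OF b])
qed

lemma zero_HC_space: "(\<lambda>_. 0) \<in> HC_space"
  by (simp add: HC_space_def H_space_def)

lemma L_kernelE:
  assumes b: "continuous_on {0..1} b" and f: "f \<in> L_kernel b \<mu>"
  obtains q where "quasi_solution b (\<lambda>x. \<mu> * f x) f q" "f 1 = 0"
proof -
  have L: "L_graph b (\<lambda>x. Re (f x)) (\<lambda>x. Re (\<mu> * f x))" "L_graph b (\<lambda>x. Im (f x)) (\<lambda>x. Im (\<mu> * f x))"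
    using f by (auto simp: L_kernel_def LC_shift_graph_def LC_graph_def simp del: times_complex.sel)
  have H: "(\<lambda>x. Re (f x)) \<in> H1_space" "(\<lambda>x. Im (f x)) \<in> H1_space"
    using L by (auto simp: L_graph_def)
  have "f 1 = 0"
    using H1_spaceD(3)[OF H(1)] H1_spaceD(3)[OF H(2)] by (simp add: complex_eq_iff)
  have fc: "continuous_on {0..1} f"
    using continuous_on_Complex[OF abs_continuous01_continuous[OF H1_spaceD(1)[OF H(1)]]
        abs_continuous01_continuous[OF H1_spaceD(1)[OF H(2)]]] by simp
  obtain q1 q2 where q: "quasi_solution b (\<lambda>x. Re (\<mu> * f x)) (\<lambda>x. Re (f x)) q1"
    "quasi_solution b (\<lambda>x. Im (\<mu> * f x)) (\<lambda>x. Im (f x)) q2"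
    using quasi_solution_if_L_graph[OF b L(1)] quasi_solution_if_L_graph[OF b L(2)] by blast
  have "quasi_solution b (\<lambda>x. \<mu> * f x) f (\<lambda>x. Complex (q1 x) (q2 x))"
    using fc by (intro quasi_solution_Complex b q integrable_continuous_real continuous_intros)
  then show thesis using \<open>f 1 = 0\<close> by (rule that)
qed

text \<open>The combination \<open>f - c g\<close> has neither source nor initial data, so the a
  priori bound for it is 0. The factor \<open>c\<close> is dictated by the initial
  quasi-derivatives, because the first components all start at 0.\<close>

lemma quasi_solution_unique:
  fixes f g :: "real \<Rightarrow> complex"
  assumes b: "continuous_on {0..1} b"
    and f: "quasi_solution b (\<lambda>x. \<mu> * f x) f p" and g: "quasi_solution b (\<lambda>x. \<mu> * g x) g q"
    and "p 0 = c * q 0" and x: "x \<in> {0..1}"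
  shows "f x = c * g x"
proof -
  have fc: "continuous_on {0..1} f" and gc: "continuous_on {0..1} g"
    using f g by (auto simp: quasi_solution_def)
  have "quasi_solution b (\<lambda>x. \<mu> * f x + (- c) * (\<mu> * g x)) (\<lambda>x. f x + (- c) * g x) (\<lambda>x. p x + (- c) * q x)"
    using fc gc by (intro quasi_solution_lincomb b f g integrable_continuous_real continuous_intros)
  moreover have "(\<lambda>x. \<mu> * f x + (- c) * (\<mu> * g x)) = (\<lambda>x. 0 + \<mu> * (f x + (- c) * g x))"
    by (auto simp: algebra_simps)
  ultimately have sol: "quasi_solution b (\<lambda>x. 0 + \<mu> * (f x + (- c) * g x)) (\<lambda>x. f x + (- c) * g x) (\<lambda>x. p x + (- c) * q x)"
    by simp
  have "bounded (b ` {0..1})"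
    using b by (intro compact_imp_bounded compact_continuous_image) auto
  then obtain B where B: "\<And>x. x \<in> {0..1} \<Longrightarrow> \<bar>b x\<bar> \<le> B"
    unfolding bounded_iff image_iff Bex_def real_norm_def by blast
  have "norm (f x + (- c) * g x) + norm (p x + (- c) * q x) \<le> 0"
    using quasi_solution_bound[OF b B _ sol x] \<open>p 0 = c * q 0\<close> by simp
  then have "norm (f x + (- c) * g x) \<le> 0"
    using norm_ge_zero[of "p x + (- c) * q x"] by linarith
  then show ?thesis by simp
qed

text \<open>On the unit interval the choice is immaterial by \<open>quasi_solution_unique\<close>
  when \<open>b\<close> is continuous there; outside it the values are arbitrary. The value at 1, as
  a function of \<open>\<mu>\<close>, plays the part of a characteristic determinant.\<close>

definition fundamental_solution :: "(real \<Rightarrow> real) \<Rightarrow> complex \<Rightarrow> real \<Rightarrow> complex" where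
  "fundamental_solution b \<mu> = (SOME f. \<exists>q. quasi_solution b (\<lambda>x. \<mu> * f x) f q \<and> q 0 = 1)"

lemma fundamental_solutionE:
  assumes "continuous_on {0..1} b"
  obtains q where "quasi_solution b (\<lambda>x. \<mu> * fundamental_solution b \<mu> x) (fundamental_solution b \<mu>) q" "q 0 = 1"
proof -
  have "(\<lambda>_. 0::complex) integrable_on {0..1::real}" by (rule integrable_0)
  from quasi_solution_exists[OF assms this, of \<mu> 1]
  have "\<exists>f q. quasi_solution b (\<lambda>x. \<mu> * f x) f q \<and> q 0 = 1" by simp
  from someI_ex[OF this] show thesis
    unfolding fundamental_solution_def[symmetric] using that by blast
qed

section \<open>Characteristic condition at 1, orthogonality and isolation of eigenvalues\<close>

context
  fixes b :: "real \<Rightarrow> real"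
  assumes b: "continuous_on {0..1} b"
begin

lemma fundamental_solution_continuous: "continuous_on {0..1} (fundamental_solution b \<mu>)"
  using fundamental_solutionE[OF b, of \<mu>] by (auto simp: quasi_solution_def)

text \<open>If it vanished, the first equation would leave \<open>integral {0..x} q = 0\<close> for
  all \<open>x\<close>, and differentiating at 0 would contradict \<open>q 0 = 1\<close>.\<close>

lemma fundamental_solution_nonzero: "\<exists>x\<in>{0..1}. fundamental_solution b \<mu> x \<noteq> 0"
proof (rule ccontr)
  assume "\<not> ?thesis"
  then have z: "fundamental_solution b \<mu> x = 0" if "x \<in> {0..1}" for x using that by blast
  obtain q where q: "quasi_solution b (\<lambda>x. \<mu> * fundamental_solution b \<mu> x) (fundamental_solution b \<mu>) q" "q 0 = 1"
    using fundamental_solutionE[OF b] by blast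
  have qc: "continuous_on {0..1} q"
    and I: "\<And>x. x \<in> {0..1} \<Longrightarrow> fundamental_solution b \<mu> x =
        integral {0..x} (\<lambda>t. b t *\<^sub>R fundamental_solution b \<mu> t + q t)"
    using q(1) unfolding quasi_solution_def by blast+
  have int0: "integral {0..x} q = 0" if x: "x \<in> {0..1}" for x
  proof -
    have "integral {0..x} q = integral {0..x} (\<lambda>t. b t *\<^sub>R fundamental_solution b \<mu> t + q t)"
      by (rule integral_cong) (use x z in auto)
    with I[OF x] z[OF x] show ?thesis by simp
  qed
  have "((\<lambda>x. integral {0..x} q) has_vector_derivative q 0) (at 0 within {0..1})"
    by (rule integral_has_vector_derivative[OF qc]) auto
  then have "((\<lambda>x. 0) has_vector_derivative q 0) (at 0 within {0..1::real})"
    by (rule has_vector_derivative_transform[rotated 2]) (auto simp: int0)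
  moreover have "((\<lambda>x. 0::complex) has_vector_derivative 0) (at 0 within {0..1::real})"
    by simp
  ultimately have "q 0 = 0"
    using vector_derivative_unique_within_closed_interval[of 0 1 0 "\<lambda>x. 0::complex" "q 0" 0] by simp
  with q(2) show False by simp
qed

lemma L_kernel_eq_multiple:
  assumes "f \<in> L_kernel b \<mu>"
  obtains c where "\<And>x. x \<in> {0..1} \<Longrightarrow> f x = c * fundamental_solution b \<mu> x" "f 1 = 0"
proof -
  obtain p where p: "quasi_solution b (\<lambda>x. \<mu> * f x) f p" "f 1 = 0"
    using L_kernelE[OF b assms] by blast
  obtain q where q: "quasi_solution b (\<lambda>x. \<mu> * fundamental_solution b \<mu> x) (fundamental_solution b \<mu>) q" "q 0 = 1"
    using fundamental_solutionE[OF b] by blast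
  have "f x = p 0 * fundamental_solution b \<mu> x" if "x \<in> {0..1}" for x
    by (rule quasi_solution_unique[OF b p(1) q(1) _ that]) (simp add: q(2))
  then show thesis using p(2) by (rule that)
qed

lemma fundamental_solution_in_kernel:
  assumes "fundamental_solution b \<mu> 1 = 0"
  shows "fundamental_solution b \<mu> \<in> L_kernel b \<mu>"
proof -
  obtain q where "quasi_solution b (\<lambda>x. \<mu> * fundamental_solution b \<mu> x) (fundamental_solution b \<mu>) q"
    using fundamental_solutionE[OF b] by blast
  then have "quasi_solution b (\<lambda>x. 0 + \<mu> * fundamental_solution b \<mu> x) (fundamental_solution b \<mu>) q"
    by simp
  then have "LC_shift_graph b \<mu> (fundamental_solution b \<mu>) (\<lambda>_. 0)"
    using assms by (rule LC_shift_graph_if_quasi_solution[OF b zero_HC_space])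
  then show ?thesis by (simp add: L_kernel_def)
qed

lemma finite_dimensional_L_kernel: "finite_dimensional01 (L_kernel b \<mu>)"
  unfolding finite_dimensional01_def
proof (intro exI[of _ "1::nat"] exI[of _ "\<lambda>_. fundamental_solution b \<mu>"] ballI)
  fix f assume "f \<in> L_kernel b \<mu>"
  then obtain c where "\<And>x. x \<in> {0..1} \<Longrightarrow> f x = c * fundamental_solution b \<mu> x"
    using L_kernel_eq_multiple by blast
  then show "\<exists>c. \<forall>x\<in>{0..1}. f x = (\<Sum>i<1::nat. c i * fundamental_solution b \<mu> x)"
    by (intro exI[of _ "\<lambda>_. c"]) simp
qed

lemma L_spectrum_eq: "L_spectrum b = {\<mu>. fundamental_solution b \<mu> 1 = 0}"
proof -
  have "\<mu> \<notin> L_resolvent_set b" if "fundamental_solution b \<mu> 1 = 0" for \<mu>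
    using fundamental_solution_in_kernel[OF that] fundamental_solution_nonzero[of \<mu>]
    unfolding L_resolvent_set_def by blast
  moreover have "\<mu> \<in> L_resolvent_set b" if ne: "fundamental_solution b \<mu> 1 \<noteq> 0" for \<mu>
  proof -
    define e where "e = fundamental_solution b \<mu>"
    have ec: "continuous_on {0..1} e" unfolding e_def by (rule fundamental_solution_continuous)
    obtain q where q: "quasi_solution b (\<lambda>x. \<mu> * e x) e q"
      unfolding e_def using fundamental_solutionE[OF b] by blast
    have "f x = 0" if f: "f \<in> L_kernel b \<mu>" and x: "x \<in> {0..1}" for f x
    proof -
      obtain c where c: "\<And>x. x \<in> {0..1} \<Longrightarrow> f x = c * fundamental_solution b \<mu> x" "f 1 = 0"
        using L_kernel_eq_multiple[OF f] by blast
      with ne have "c = 0" by (metis atLeastAtMost_iff mult_eq_0_iff order_refl zero_le_one)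
      with c(1)[OF x] show ?thesis by simp
    qed
    moreover have "\<exists>C. \<forall>u\<in>HC_space. \<exists>f. LC_shift_graph b \<mu> f u \<and> normC01 f \<le> C * normC01 u"
    proof -
      have "bounded (b ` {0..1})" "bounded (e ` {0..1})"
        using b ec by (auto intro!: compact_imp_bounded compact_continuous_image)
      then obtain B E where B: "\<And>x. x \<in> {0..1} \<Longrightarrow> \<bar>b x\<bar> \<le> B" and E: "\<And>x. x \<in> {0..1} \<Longrightarrow> norm (e x) \<le> E"
        unfolding bounded_iff image_iff Bex_def real_norm_def by blast
      have E0: "0 \<le> E" using order_trans[OF norm_ge_zero E[of 0]] by simp
      define C where "C = 2 * exp (2 * ((1 + B) * (1 + B) + norm \<mu>))"
      have C0: "0 \<le> C" by (simp add: C_def)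
      \<comment> \<open>\<open>A\<close> pays for restoring the boundary condition: the correcting
        coefficient is at most \<open>norm (g 1) / norm (e 1)\<close>, and \<open>e\<close> is at
        most \<open>E\<close>. The \<open>1\<close> accounts for \<open>g\<close> itself.\<close>
      define A where "A = 1 + E / norm (e 1)"
      have A0: "0 \<le> A" using E0 by (simp add: A_def)
      have "\<exists>f. LC_shift_graph b \<mu> f u \<and> normC01 f \<le> A * C * normC01 u" if u: "u \<in> HC_space" for u
      proof -
        note ua = HC_space_absolutely_integrable[OF u]
        have ui: "u integrable_on {0..1}" using ua by (simp add: absolutely_integrable_on_def)
        obtain g p where g: "quasi_solution b (\<lambda>x. u x + \<mu> * g x) g p" "p 0 = 0"
          using quasi_solution_exists[OF b ui, of \<mu> 0] by blast
        have gc: "continuous_on {0..1} g" using g(1) by (simp add: quasi_solution_def)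
        have gb: "norm (g x) \<le> C * normC01 u" if x: "x \<in> {0..1}" for x
        proof -
          have "norm (g x) \<le> norm (g x) + norm (p x)" by simp
          also have "\<dots> \<le> 2 * (norm (p 0) + integral {0..1} (\<lambda>t. norm (u t))) * exp (2 * ((1 + B) * (1 + B) + norm \<mu>))"
            by (rule quasi_solution_bound[OF b B ua g(1) x])
          also have "\<dots> = C * integral {0..1} (\<lambda>t. norm (u t))" by (simp add: g(2) C_def)
          also have "\<dots> \<le> C * normC01 u"
            by (intro mult_left_mono integral_norm_le_normC01 u C0)
          finally show ?thesis .
        qed
        \<comment> \<open>This multiple of \<open>e\<close> cancels \<open>g 1\<close> at the right
          end and leaves the source \<open>u\<close> unchanged.\<close>
        define c where "c = - g 1 / e 1"
        define f where "f x = g x + c * e x" for x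
        have f1: "f 1 = 0" using ne by (simp add: f_def c_def e_def)
        have fc: "continuous_on {0..1} f" unfolding f_def by (intro continuous_intros gc ec)
        have "(\<lambda>x. u x + \<mu> * g x) integrable_on {0..1}"
        proof (rule integrable_add[OF ui])
          show "(\<lambda>x. \<mu> * g x) integrable_on {0..1}"
            by (intro integrable_continuous_real continuous_intros gc)
        qed
        then have "quasi_solution b (\<lambda>x. (u x + \<mu> * g x) + c * (\<mu> * e x)) (\<lambda>x. g x + c * e x) (\<lambda>x. p x + c * q x)"
          by (rule quasi_solution_lincomb[OF b g(1) q]) (intro integrable_continuous_real continuous_intros ec)
        moreover have "(\<lambda>x. (u x + \<mu> * g x) + c * (\<mu> * e x)) = (\<lambda>x. u x + \<mu> * f x)"
          by (auto simp: f_def algebra_simps)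
        ultimately have "quasi_solution b (\<lambda>x. u x + \<mu> * f x) f (\<lambda>x. p x + c * q x)"
          by (simp add: f_def[abs_def])
        then have "LC_shift_graph b \<mu> f u"
          using f1 by (rule LC_shift_graph_if_quasi_solution[OF b u])
        moreover have "normC01 f \<le> A * C * normC01 u"
        proof (rule normC01_le_bound[OF fc])
          fix x :: real assume x: "x \<in> {0..1}"
          have "norm (f x) \<le> norm (g x) + norm c * norm (e x)"
            unfolding f_def by (rule order_trans[OF norm_triangle_ineq]) (simp add: norm_mult)
          also have "\<dots> \<le> C * normC01 u + (C * normC01 u / norm (e 1)) * E"
          proof (intro add_mono mult_mono gb E x)
            show "norm c \<le> C * normC01 u / norm (e 1)"
              using gb[of 1] by (simp add: c_def norm_divide divide_right_mono)
            show "0 \<le> C * normC01 u / norm (e 1)"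
              using order_trans[OF norm_ge_zero gb[OF x]] by simp
          qed simp
          also have "\<dots> = A * C * normC01 u" by (simp add: A_def algebra_simps)
          finally show "norm (f x) \<le> A * C * normC01 u" .
        qed
        ultimately show ?thesis by blast
      qed
      then show ?thesis by blast
    qed
    ultimately show ?thesis unfolding L_resolvent_set_def by blast
  qed
  ultimately show ?thesis unfolding L_spectrum_def by blast
qed

text \<open>Symmetry is available for the real graph, so it is applied to the four pairs of real and
  imaginary parts, which are then reassembled into a sesquilinear identity. With
  \<open>cnj \<nu>\<close> in the factor, \<open>\<nu> = \<mu>\<close> gives reality of the spectrum
  and distinct real values give orthogonality.\<close>

lemma fundamental_solutions_orthogonal:
  assumes \<mu>: "fundamental_solution b \<mu> 1 = 0" and \<nu>: "fundamental_solution b \<nu> 1 = 0"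
  shows "(\<mu> - cnj \<nu>) * integral {0..1} (\<lambda>x. fundamental_solution b \<mu> x * cnj (fundamental_solution b \<nu> x)) = 0"
proof -
  define e where "e = fundamental_solution b \<mu>"
  define d where "d = fundamental_solution b \<nu>"
  have ec: "continuous_on {0..1} e" and dc: "continuous_on {0..1} d"
    unfolding e_def d_def by (rule fundamental_solution_continuous)+
  have e: "L_graph b (\<lambda>x. Re (e x)) (\<lambda>x. Re (\<mu> * e x))" "L_graph b (\<lambda>x. Im (e x)) (\<lambda>x. Im (\<mu> * e x))"
    using fundamental_solution_in_kernel[OF \<mu>]
    by (auto simp: e_def L_kernel_def LC_shift_graph_def LC_graph_def simp del: times_complex.sel)
  have d: "L_graph b (\<lambda>x. Re (d x)) (\<lambda>x. Re (\<nu> * d x))" "L_graph b (\<lambda>x. Im (d x)) (\<lambda>x. Im (\<nu> * d x))"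
    using fundamental_solution_in_kernel[OF \<nu>]
    by (auto simp: d_def L_kernel_def LC_shift_graph_def LC_graph_def simp del: times_complex.sel)
  have inner: "inner01 g h = integral {0..1} (\<lambda>x. g x * h x)"
    if "continuous_on {0..1} g" "continuous_on {0..1} h" for g h
    using inner01_eq[OF continuous01_absolutely_integrable[OF that(1)] that(2)] by (simp add: mult.commute)
  have sym: "integral {0..1} (\<lambda>x. v x * g x) = integral {0..1} (\<lambda>x. w x * f x)"
    if "L_graph b f v" "L_graph b g w" "continuous_on {0..1} f" "continuous_on {0..1} v"
      "continuous_on {0..1} g" "continuous_on {0..1} w" for f v g w
    using L_graph_symmetric[OF that(1,2)] inner[OF that(4,5)] inner[OF that(6,3)] by simp
  have comm: "integral {0..1} (\<lambda>x. Re (\<mu> * e x) * Re (d x)) = integral {0..1} (\<lambda>x. Re (\<nu> * d x) * Re (e x))"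
    "integral {0..1} (\<lambda>x. Re (\<mu> * e x) * Im (d x)) = integral {0..1} (\<lambda>x. Im (\<nu> * d x) * Re (e x))"
    "integral {0..1} (\<lambda>x. Im (\<mu> * e x) * Re (d x)) = integral {0..1} (\<lambda>x. Re (\<nu> * d x) * Im (e x))"
    "integral {0..1} (\<lambda>x. Im (\<mu> * e x) * Im (d x)) = integral {0..1} (\<lambda>x. Im (\<nu> * d x) * Im (e x))"
    by (rule sym[OF e(1) d(1)] sym[OF e(1) d(2)] sym[OF e(2) d(1)] sym[OF e(2) d(2)];
        intro continuous_intros ec dc)+
  have parts: "Re (integral {0..1} (\<lambda>x. g x * cnj (h x))) =
      integral {0..1} (\<lambda>x. Re (g x) * Re (h x)) + integral {0..1} (\<lambda>x. Im (g x) * Im (h x))"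
    "Im (integral {0..1} (\<lambda>x. g x * cnj (h x))) =
      integral {0..1} (\<lambda>x. Im (g x) * Re (h x)) - integral {0..1} (\<lambda>x. Re (g x) * Im (h x))"
    if gc: "continuous_on {0..1} g" and hc: "continuous_on {0..1} h" for g h :: "real \<Rightarrow> complex"
  proof -
    have i: "(\<lambda>x. g x * cnj (h x)) integrable_on {0..1}"
      by (intro integrable_continuous_real continuous_intros gc hc)
    have r: "(\<lambda>x. Re (g x) * Re (h x)) integrable_on {0..1}" "(\<lambda>x. Im (g x) * Im (h x)) integrable_on {0..1}"
      "(\<lambda>x. Im (g x) * Re (h x)) integrable_on {0..1}" "(\<lambda>x. Re (g x) * Im (h x)) integrable_on {0..1}"
      by (intro integrable_continuous_real continuous_intros gc hc)+
    show "Re (integral {0..1} (\<lambda>x. g x * cnj (h x))) =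
      integral {0..1} (\<lambda>x. Re (g x) * Re (h x)) + integral {0..1} (\<lambda>x. Im (g x) * Im (h x))"
      using integral_linear[OF i bounded_linear_Re] Henstock_Kurzweil_Integration.integral_add[OF r(1,2)]
      by (simp add: o_def)
    show "Im (integral {0..1} (\<lambda>x. g x * cnj (h x))) =
      integral {0..1} (\<lambda>x. Im (g x) * Re (h x)) - integral {0..1} (\<lambda>x. Re (g x) * Im (h x))"
      using integral_linear[OF i bounded_linear_Im] Henstock_Kurzweil_Integration.integral_diff[OF r(3,4)]
      by (simp add: o_def)
  qed
  have \<mu>e: "continuous_on {0..1} (\<lambda>x. \<mu> * e x)" and \<nu>d: "continuous_on {0..1} (\<lambda>x. \<nu> * d x)"
    by (intro continuous_intros ec dc)+
  have "integral {0..1} (\<lambda>x. \<mu> * e x * cnj (d x)) = integral {0..1} (\<lambda>x. e x * cnj (\<nu> * d x))"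
    unfolding complex_eq_iff parts[OF \<mu>e dc] parts[OF ec \<nu>d] comm
    by (simp only: mult.commute)
  moreover have "integral {0..1} (\<lambda>x. \<mu> * e x * cnj (d x)) = \<mu> * integral {0..1} (\<lambda>x. e x * cnj (d x))"
    by (simp add: mult.assoc)
  moreover have "integral {0..1} (\<lambda>x. e x * cnj (\<nu> * d x)) = cnj \<nu> * integral {0..1} (\<lambda>x. e x * cnj (d x))"
    by (simp add: mult.left_commute)
  ultimately show ?thesis
    by (simp add: e_def d_def left_diff_distrib)
qed

lemma fundamental_solution_norm_pos:
  "integral {0..1} (\<lambda>x. fundamental_solution b \<mu> x * cnj (fundamental_solution b \<mu> x)) \<noteq> 0"
proof
  define e where "e = fundamental_solution b \<mu>"
  have ec: "continuous_on {0..1} e"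
    unfolding e_def by (rule fundamental_solution_continuous)
  assume "integral {0..1} (\<lambda>x. fundamental_solution b \<mu> x * cnj (fundamental_solution b \<mu> x)) = 0"
  then have "Re (integral {0..1} (\<lambda>x. e x * cnj (e x))) = 0" by (simp add: e_def)
  moreover have "(\<lambda>x. e x * cnj (e x)) integrable_on {0..1}"
    by (intro integrable_continuous_real continuous_intros ec)
  from integral_linear[OF this bounded_linear_Re]
  have "Re (integral {0..1} (\<lambda>x. e x * cnj (e x))) = integral {0..1} (\<lambda>x. (norm (e x))\<^sup>2)"
    by (simp add: o_def cmod_power2) (simp add: power2_eq_square)
  ultimately have "integral {0..1} (\<lambda>x. (norm (e x))\<^sup>2) = 0" by simp
  moreover have "continuous_on {0..1} (\<lambda>x. (norm (e x))\<^sup>2)"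
    by (intro continuous_intros ec)
  ultimately have "\<forall>x\<in>{0..1}. (norm (e x))\<^sup>2 = 0"
    using integral_eq_0_iff[of 0 1 "\<lambda>x. (norm (e x))\<^sup>2"] by simp
  with fundamental_solution_nonzero[of \<mu>] show False by (auto simp: e_def)
qed

lemma L_spectrum_real:
  assumes "fundamental_solution b \<mu> 1 = 0"
  shows "cnj \<mu> = \<mu>"
  using fundamental_solutions_orthogonal[OF assms assms] fundamental_solution_norm_pos[of \<mu>] by simp

text \<open>The difference of the two solutions solves the system at \<open>z\<close> with source
  \<open>w - z\<close> times the solution at \<open>w\<close> and with zero initial data, so the a
  priori bound is linear in \<open>norm (w - z)\<close>.\<close>

lemma fundamental_solution_Lipschitz:
  obtains C where "\<And>w x. norm (w - z) \<le> 1 \<Longrightarrow> x \<in> {0..1} \<Longrightarrow>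
    norm (fundamental_solution b w x - fundamental_solution b z x) \<le> C * norm (w - z)"
proof -
  have "bounded (b ` {0..1})"
    using b by (intro compact_imp_bounded compact_continuous_image) auto
  then obtain B where B: "\<And>x. x \<in> {0..1} \<Longrightarrow> \<bar>b x\<bar> \<le> B"
    unfolding bounded_iff image_iff Bex_def real_norm_def by blast
  define K where "K w = (1 + B) * (1 + B) + norm w" for w :: complex
  \<comment> \<open>In the unit disc around \<open>z\<close> one has
    \<open>K w \<le> K z + 1\<close>, so \<open>m\<close> bounds all fundamental solutions there
    uniformly.\<close>
  define m where "m = 2 * exp (2 * (K z + 1))"
  define C where "C = 2 * m * exp (2 * K z)"
  have "norm (fundamental_solution b w x - fundamental_solution b z x) \<le> C * norm (w - z)"
    if w: "norm (w - z) \<le> 1" and x: "x \<in> {0..1}" for w x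
  proof -
    define e where "e = fundamental_solution b w"
    define d where "d = fundamental_solution b z"
    have ec: "continuous_on {0..1} e" and dc: "continuous_on {0..1} d"
      unfolding e_def d_def by (rule fundamental_solution_continuous)+
    obtain p where p: "quasi_solution b (\<lambda>x. w * e x) e p" "p 0 = 1"
      unfolding e_def using fundamental_solutionE[OF b] by blast
    obtain q where q: "quasi_solution b (\<lambda>x. z * d x) d q" "q 0 = 1"
      unfolding d_def using fundamental_solutionE[OF b] by blast
    have em: "norm (e t) \<le> m" if t: "t \<in> {0..1}" for t
    proof -
      have "quasi_solution b (\<lambda>x. 0 + w * e x) e p" using p(1) by simp
      from quasi_solution_bound[OF b B _ this t] p(2)
      have "norm (e t) + norm (p t) \<le> 2 * exp (2 * K w)" by (simp add: K_def)
      then have "norm (e t) \<le> 2 * exp (2 * K w)"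
        using norm_ge_zero[of "p t"] by linarith
      also have "norm w \<le> norm z + 1"
        using w norm_triangle_sub[of w z] by linarith
      then have "2 * exp (2 * K w) \<le> m" by (simp add: m_def K_def)
      finally show ?thesis .
    qed
    have "quasi_solution b (\<lambda>x. w * e x + (- 1) * (z * d x)) (\<lambda>x. e x + (- 1) * d x) (\<lambda>x. p x + (- 1) * q x)"
      by (intro quasi_solution_lincomb b p q integrable_continuous_real continuous_intros ec dc)
    moreover have "(\<lambda>x. w * e x + (- 1) * (z * d x)) = (\<lambda>x. (w - z) * e x + z * (e x + (- 1) * d x))"
      by (auto simp: algebra_simps)
    ultimately have sol: "quasi_solution b (\<lambda>x. (w - z) * e x + z * (e x + (- 1) * d x))
        (\<lambda>x. e x + (- 1) * d x) (\<lambda>x. p x + (- 1) * q x)" by simp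
    have "(\<lambda>x. (w - z) * e x) absolutely_integrable_on {0..1}"
      by (intro absolutely_integrable_continuous_real continuous_intros ec)
    from quasi_solution_bound[OF b B this sol x] p(2) q(2)
    have "norm (e x - d x) + norm (p x - q x) \<le> 2 * integral {0..1} (\<lambda>t. norm ((w - z) * e t)) * exp (2 * K z)"
      by (simp add: K_def)
    then have "norm (e x - d x) \<le> 2 * integral {0..1} (\<lambda>t. norm ((w - z) * e t)) * exp (2 * K z)"
      using norm_ge_zero[of "p x - q x"] by linarith
    also have "integral {0..1} (\<lambda>t. norm ((w - z) * e t)) \<le> integral {0..1::real} (\<lambda>t. norm (w - z) * m)"
      using em by (intro integral_le integrable_continuous_real continuous_intros ec)
        (auto simp: norm_mult intro!: mult_left_mono)
    finally show ?thesis
      by (simp add: e_def d_def C_def mult_ac)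
  qed
  then show thesis by (rule that)
qed

lemma fundamental_solution_integral_tendsto:
  assumes g: "continuous_on {0..1} g" and w: "w \<longlonglongrightarrow> z"
  shows "(\<lambda>n. integral {0..1} (\<lambda>x. fundamental_solution b (w n) x * g x))
    \<longlonglongrightarrow> integral {0..1} (\<lambda>x. fundamental_solution b z x * g x)"
proof -
  obtain C where C: "\<And>w x. norm (w - z) \<le> 1 \<Longrightarrow> x \<in> {0..1} \<Longrightarrow>
    norm (fundamental_solution b w x - fundamental_solution b z x) \<le> C * norm (w - z)"
    using fundamental_solution_Lipschitz by blast
  have "bounded (g ` {0..1})"
    using g by (intro compact_imp_bounded compact_continuous_image) auto
  then obtain G where G: "\<And>x. x \<in> {0..1} \<Longrightarrow> norm (g x) \<le> G"
    unfolding bounded_iff image_iff Bex_def by blast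
  have lim: "(\<lambda>n. norm (w n - z)) \<longlonglongrightarrow> 0"
    using w by (simp add: LIM_zero_iff tendsto_norm_zero_iff)
  then have ev: "\<forall>\<^sub>F n in sequentially. norm (w n - z) < 1"
    by (rule order_tendstoD) simp
  show ?thesis
  proof (rule Lim_null_comparison[of _ "\<lambda>n. norm (w n - z) * (C * G)" sequentially, THEN LIM_zero_cancel])
    show "(\<lambda>n. norm (w n - z) * (C * G)) \<longlonglongrightarrow> 0"
      using tendsto_mult_right[OF lim, of "C * G"] by simp
    show "\<forall>\<^sub>F n in sequentially. norm (integral {0..1} (\<lambda>x. fundamental_solution b (w n) x * g x) -
        integral {0..1} (\<lambda>x. fundamental_solution b z x * g x)) \<le> norm (w n - z) * (C * G)"
      using ev
    proof eventually_elim
      case (elim n)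
      have i: "(\<lambda>x. fundamental_solution b \<mu> x * g x) integrable_on {0..1}" for \<mu>
        by (intro integrable_continuous_real continuous_intros g fundamental_solution_continuous)
      have "integral {0..1} (\<lambda>x. fundamental_solution b (w n) x * g x) -
          integral {0..1} (\<lambda>x. fundamental_solution b z x * g x) =
          integral {0..1} (\<lambda>x. fundamental_solution b (w n) x * g x - fundamental_solution b z x * g x)"
        by (rule Henstock_Kurzweil_Integration.integral_diff[OF i i, symmetric])
      also have "norm \<dots> \<le> integral {0..1::real} (\<lambda>x. norm (w n - z) * (C * G))"
      proof (rule integral_norm_bound_integral)
        fix x :: real assume x: "x \<in> {0..1}"
        have "norm (fundamental_solution b (w n) x * g x - fundamental_solution b z x * g x) =
            norm (fundamental_solution b (w n) x - fundamental_solution b z x) * norm (g x)"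
          by (simp add: norm_mult[symmetric] left_diff_distrib)
        also have "\<dots> \<le> C * norm (w n - z) * G"
          using C[of "w n" x] elim x G[OF x] order_trans[OF norm_ge_zero C[of "w n" x]] by (intro mult_mono) auto
        finally show "norm (fundamental_solution b (w n) x * g x - fundamental_solution b z x * g x) \<le> norm (w n - z) * (C * G)"
          by (simp add: mult_ac)
      qed (auto intro: integrable_diff i)
      finally show ?case by simp
    qed
  qed
qed

text \<open>The limits are taken one after the other: the first makes the solution at
  \<open>z\<close> orthogonal to each solution at \<open>w n\<close>, the second makes it orthogonal
  to itself. Each time only one factor varies, as
  \<open>fundamental_solution_integral_tendsto\<close> requires.\<close>

lemma L_spectrum_no_limit_point: "\<not> z islimpt L_spectrum b"
proof
  assume "z islimpt L_spectrum b"
  then obtain w where w: "\<And>n. w n \<in> L_spectrum b - {z}" "w \<longlonglongrightarrow> z"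
    unfolding islimpt_sequential by blast
  define e where "e = fundamental_solution b"
  have ec: "continuous_on {0..1} (e \<mu>)" for \<mu>
    unfolding e_def by (rule fundamental_solution_continuous)
  have zero: "e (w n) 1 = 0" and real: "cnj (w n) = w n" for n
    using w(1)[of n] L_spectrum_real[of "w n"] by (auto simp: L_spectrum_eq e_def)
  have "integral {0..1} (\<lambda>x. e z x * cnj (e (w n) x)) = 0" for n
  proof (rule LIMSEQ_unique)
    show "(\<lambda>m. integral {0..1} (\<lambda>x. e (w m) x * cnj (e (w n) x))) \<longlonglongrightarrow> integral {0..1} (\<lambda>x. e z x * cnj (e (w n) x))"
      unfolding e_def by (intro fundamental_solution_integral_tendsto w(2) continuous_intros fundamental_solution_continuous)
    \<comment> \<open>The sequence may repeat values, but it tends to \<open>z\<close> and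
      \<open>w n \<noteq> z\<close>, so it eventually avoids the value \<open>w n\<close>.\<close>
    have "\<forall>\<^sub>F m in sequentially. w m \<noteq> w n"
      using tendsto_imp_eventually_ne[OF w(2)] w(1)[of n] by auto
    then have "\<forall>\<^sub>F m in sequentially. integral {0..1} (\<lambda>x. e (w m) x * cnj (e (w n) x)) = 0"
    proof eventually_elim
      case (elim m)
      then show ?case
        using fundamental_solutions_orthogonal[of "w m" "w n"] zero real by (simp add: e_def)
    qed
    then show "(\<lambda>m. integral {0..1} (\<lambda>x. e (w m) x * cnj (e (w n) x))) \<longlonglongrightarrow> 0"
      by (rule tendsto_eventually)
  qed
  moreover have "integral {0..1} (\<lambda>x. e (w n) x * cnj (e z x)) = cnj (integral {0..1} (\<lambda>x. e z x * cnj (e (w n) x)))" for n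
    by (simp add: integral_cnj mult.commute)
  ultimately have "integral {0..1} (\<lambda>x. e (w n) x * cnj (e z x)) = 0" for n by simp
  moreover have "(\<lambda>n. integral {0..1} (\<lambda>x. e (w n) x * cnj (e z x))) \<longlonglongrightarrow> integral {0..1} (\<lambda>x. e z x * cnj (e z x))"
    unfolding e_def by (intro fundamental_solution_integral_tendsto w(2) continuous_intros fundamental_solution_continuous)
  ultimately have "integral {0..1} (\<lambda>x. e z x * cnj (e z x)) = 0"
    by (simp add: LIMSEQ_const_iff)
  with fundamental_solution_norm_pos show False by (simp add: e_def)
qed

text \<open>\<open>L_eigenvalue\<close> combines a real eigenfunction with a complex number. Testing
  with the eigenfunction itself forces that number to be real. Conversely, reality of the spectrum
  makes the real and imaginary parts of the fundamental solution solve the same real problem, and at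
  least one of them is nonzero.\<close>

lemma L_eigenvalue_iff: "L_eigenvalue b \<mu> \<longleftrightarrow> fundamental_solution b \<mu> 1 = 0"
proof
  assume "L_eigenvalue b \<mu>"
  then obtain e where e: "e \<in> H1_space" "\<exists>x\<in>{0..1}. e x \<noteq> 0"
    and eig: "\<And>h. h \<in> H1_space \<Longrightarrow> \<exists>c. L_form b e h c \<and> complex_of_real c = \<mu> * complex_of_real (inner01 e h)"
    unfolding L_eigenvalue_def by blast
  note E = H1_spaceD[OF e(1)]
  note ec = abs_continuous01_continuous[OF E(1)]
  have "inner01 e e = integral {0..1} (\<lambda>x. (e x)\<^sup>2)"
    using inner01_eq[OF continuous01_absolutely_integrable[OF ec] ec] by (simp add: power2_eq_square)
  moreover have "continuous_on {0..1} (\<lambda>x. (e x)\<^sup>2)" by (intro continuous_intros ec)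
  ultimately have ne: "inner01 e e \<noteq> 0"
    using integral_eq_0_iff[of 0 1 "\<lambda>x. (e x)\<^sup>2"] e(2) by auto
  obtain c where "complex_of_real c = \<mu> * complex_of_real (inner01 e e)"
    using eig[OF e(1)] by blast
  then have \<mu>: "\<mu> = complex_of_real (c / inner01 e e)"
    using ne by (simp add: field_simps)
  define l where "l = c / inner01 e e"
  have Lv: "(\<lambda>x. l * e x) \<in> H_space"
    using E ec by (intro H_spaceI_continuous continuous_intros) auto
  have "L_form b e h (inner01 (\<lambda>x. l * e x) h)" if h: "h \<in> H1_space" for h
  proof -
    obtain c where c: "L_form b e h c" "complex_of_real c = \<mu> * complex_of_real (inner01 e h)"
      using eig[OF h] by blast
    then have "c = l * inner01 e h"
      unfolding \<mu> l_def[symmetric] by (metis of_real_eq_iff of_real_mult)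
    moreover have "inner01 (\<lambda>x. l * e x) h = l * inner01 e h"
      by (simp add: inner01_def mult.assoc)
    ultimately show ?thesis using c(1) by simp
  qed
  then have L: "L_graph b e (\<lambda>x. l * e x)"
    using e(1) Lv by (simp add: L_graph_def)
  \<comment> \<open>The embedded real eigenfunction has imaginary part 0, so membership in the
    complex kernel also needs the pair of zero functions to lie in the graph.\<close>
  have "quasi_solution b (\<lambda>_. 0::real) (\<lambda>_. 0) (\<lambda>_. 0)" by (simp add: quasi_solution_def)
  then have L0: "L_graph b (\<lambda>_. 0) (\<lambda>_. 0)"
    by (rule L_graph_if_quasi_solution[OF b]) (auto simp: H_space_def)
  have "(\<lambda>x. complex_of_real (e x)) \<in> L_kernel b \<mu>"
    using L L0 unfolding L_kernel_def LC_shift_graph_def LC_graph_def \<mu> l_def[symmetric] by simp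
  then obtain k where k: "\<And>x. x \<in> {0..1} \<Longrightarrow> complex_of_real (e x) = k * fundamental_solution b \<mu> x"
    using L_kernel_eq_multiple[of "\<lambda>x. complex_of_real (e x)"] by blast
  have "k \<noteq> 0" using k e(2) by auto
  with k[of 1] E(3) show "fundamental_solution b \<mu> 1 = 0" by simp
next
  assume z: "fundamental_solution b \<mu> 1 = 0"
  define e where "e = fundamental_solution b \<mu>"
  have "Im \<mu> = 0" using L_spectrum_real[OF z] by (simp add: complex_eq_iff)
  then have \<mu>: "\<mu> = complex_of_real (Re \<mu>)" by (simp add: complex_eq_iff)
  have L: "L_graph b (\<lambda>x. Re (e x)) (\<lambda>x. Re \<mu> * Re (e x))" "L_graph b (\<lambda>x. Im (e x)) (\<lambda>x. Re \<mu> * Im (e x))"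
    using fundamental_solution_in_kernel[OF z] \<open>Im \<mu> = 0\<close>
    by (auto simp: e_def L_kernel_def LC_shift_graph_def LC_graph_def)
  have eigen: "L_eigenvalue b \<mu>" if "L_graph b r (\<lambda>x. Re \<mu> * r x)" "\<exists>x\<in>{0..1}. r x \<noteq> 0" for r
    unfolding L_eigenvalue_def
  proof (intro bexI[of _ r] conjI that(2) ballI)
    show "r \<in> H1_space" using that(1) by (simp add: L_graph_def)
    fix h assume "h \<in> H1_space"
    then have "L_form b r h (inner01 (\<lambda>x. Re \<mu> * r x) h)"
      using that(1) by (simp add: L_graph_def)
    moreover have "inner01 (\<lambda>x. Re \<mu> * r x) h = Re \<mu> * inner01 r h"
      by (simp add: inner01_def mult.assoc)
    ultimately show "\<exists>c. L_form b r h c \<and> complex_of_real c = \<mu> * complex_of_real (inner01 r h)"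
      using \<mu> by (metis of_real_mult)
  qed
  obtain x where "x \<in> {0..1}" "e x \<noteq> 0"
    using fundamental_solution_nonzero unfolding e_def by blast
  then have "Re (e x) \<noteq> 0 \<or> Im (e x) \<noteq> 0" by (simp add: complex_eq_iff)
  with \<open>x \<in> {0..1}\<close> eigen[OF L(1)] eigen[OF L(2)] show "L_eigenvalue b \<mu>" by blast
qed

end

theorem corollary9:
  fixes M :: "'w measure" and F :: "real \<Rightarrow> 'w measure" and B :: "real \<Rightarrow> 'w \<Rightarrow> real"
  assumes "brownian_motion M F B"
  shows "AE \<omega> in M. L_has_discrete_spectrum (\<lambda>x. B x \<omega>) \<and>
           L_spectrum (\<lambda>x. B x \<omega>) = {\<mu>. L_eigenvalue (\<lambda>x. B x \<omega>) \<mu>}"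
proof -
  have "AE \<omega> in M. continuous_on {0..1} (\<lambda>t. B t \<omega>)"
    using assms by (rule brownian_motion.continuous_paths)
  then show ?thesis
  proof eventually_elim
    case (elim \<omega>)
    then show ?case
      using L_spectrum_no_limit_point[OF elim] finite_dimensional_L_kernel[OF elim]
        L_spectrum_eq[OF elim] L_eigenvalue_iff[OF elim]
      by (auto simp: L_has_discrete_spectrum_def)
  qed
qed

end
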